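(* For ${\rm APP}=\{{\rm APP}_d\}_{d\in\mathbb N}$ in the average case setting: (i) with the absolute error criterion, ${\rm APP}$ is EXP-PT for $\Lambda^{\rm all}$ iff it is EXP-PT for $\Lambda^{\rm std}$, and ${\rm APP}$ is EXP-SPT for $\Lambda^{\rm all}$ iff it is EXP-SPT for $\Lambda^{\rm std}$; (ii) for $\star\in\{{\rm ABS},{\rm NOR}\}$, if ${\rm APP}$ is EXP-SPT for $\Lambda^{\rm all}$ with error criterion $\star$, then it is EXP-SPT for $\Lambda^{\rm std}$ with criterion $\star$ and ${\rm EXP}\text{-}p^{\star}(\Lambda^{\rm all})={\rm EXP}\text{-}p^{\star}(\Lambda^{\rm std})$.
   Context: Setting (average case approximation). For each $d\in\mathbb N$: $D_d\subset\mathbb R^d$ is a Borel set of positive Lebesgue measure, $\rho_d$ is a probability density on $D_d$, and $G_d=L_2(D_d,\rho_d(x)\,dx)$. $F_d$ is a separable Banach space of real-valued functions on $D_d$, continuously embedded in $G_d$, such that every point evaluation $f\mapsto f(x)$, $x\in D_d$, is a continuous linear functional on $F_d$; $F_d$ carries a zero-mean Gaussian measure $\mu_d$. ${\rm APP}_d:F_d\to G_d$, ${\rm APP}_d f=f$. $\Lambda^{\rm all}$ is the class of all continuous linear functionals on $F_d$, $\Lambda^{\rm std}$ the class of point evaluations. For $\Lambda\in\{\Lambda^{\rm all},\Lambda^{\rm std}\}$, an algorithm is $A_{n,d}f=\phi_{n,d}(L_1(f),\dots,L_n(f))$ with $L_i\in\Lambda$ and $\phi_{n,d}:\mathbb R^n\to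 G_d$ measurable; its average case error is $e^{\rm avg}(A_{n,d})=\big(\int_{F_d}\|f-A_{n,d}f\|_{G_d}^2\,\mu_d(df)\big)^{1/2}$, and $e^{\rm avg}(n,d;\Lambda)$ is the infimum of $e^{\rm avg}(A_{n,d})$ over all such algorithms using $n$ functionals from $\Lambda$ (for $n=0$, $A_{0,d}=0$). Set $\Gamma_d=(e^{\rm avg}(0,d;\Lambda))^2$ (same for both classes). Information complexity: $n^{\star}(\varepsilon,d;\Lambda)=\min\{n\ge0:\ e^{\rm avg}(n,d;\Lambda)\le\varepsilon\,{\rm CRI}_d\}$, with ${\rm CRI}_d=1$ for $\star={\rm ABS}$ and ${\rm CRI}_d=\sqrt{\Gamma_d}$ for $\star={\rm NOR}$. EXP-PT for $\Lambda$ (criterion $\star$): there exist $C>0$, $p,q\ge0$ with $n^{\star}(\varepsilon,d;\Lambda)\le Cd^q(1+\ln\varepsilon^{-1})^p$ for all $d\in\mathbb N$, $\varepsilon\in(0,1)$. EXP-SPT: the same with $q=0$; the exponent ${\rm EXP}\text{-}p^{\star}(\Lambda)$ is the infimum of all $p$ for which $n^{\star}(\varepsilon,d;\Lambda)\le C(1+\ln\varepsilon^{-1})^p$ holds for all $d,\varepsilon$ with some $C$. *)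

theory Defs
  imports "HOL-Probability.Probability"
begin

(* Points of R^d: extensional functions on {..<d} (elements of PiE {..<d} UNIV).
   Functions on D_d: type  (nat => real) => real, extended by 0 outside D_d. *)
type_synonym pt = "nat \<Rightarrow> real"
type_synonym fn = "pt \<Rightarrow> real"

record setting =
  dom  :: "nat \<Rightarrow> pt set"
  dens :: "nat \<Rightarrow> pt \<Rightarrow> real"
  sp   :: "nat \<Rightarrow> fn set"
  nrm  :: "nat \<Rightarrow> fn \<Rightarrow> real"
  mu   :: "nat \<Rightarrow> fn measure"

datatype criterion = ABS | NOR
datatype infoclass = Lall | Lstd

definition lebd :: "nat \<Rightarrow> pt measure" where
  "lebd d = PiM {..<d} (\<lambda>_. lborel)"

definition Gm :: "setting \<Rightarrow> nat \<Rightarrow> pt measure" where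
  "Gm S d = density (restrict_space (lebd d) (dom S d)) (\<lambda>x. ennreal (dens S d x))"

definition gnorm2 :: "setting \<Rightarrow> nat \<Rightarrow> fn \<Rightarrow> ennreal" where
  "gnorm2 S d g = (\<integral>\<^sup>+ x. ennreal ((g x)\<^sup>2) \<partial>Gm S d)"

(* representatives of elements of G_d = L_2(D_d, rho_d) *)
definition L2set :: "setting \<Rightarrow> nat \<Rightarrow> fn set" where
  "L2set S d = {g. g \<in> borel_measurable (Gm S d) \<and> gnorm2 S d g < \<infinity>}"

definition L2open :: "setting \<Rightarrow> nat \<Rightarrow> fn set \<Rightarrow> bool" where
  "L2open S d U \<longleftrightarrow> U \<subseteq> L2set S d \<and>
     (\<forall>g\<in>U. \<exists>e>0. \<forall>h\<in>L2set S d. gnorm2 S d (\<lambda>x. h x - g x) < ennreal e \<longrightarrow> h \<in> U)"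

definition Fopen :: "setting \<Rightarrow> nat \<Rightarrow> fn set \<Rightarrow> bool" where
  "Fopen S d U \<longleftrightarrow> U \<subseteq> sp S d \<and>
     (\<forall>f\<in>U. \<exists>e>0. \<forall>g\<in>sp S d. nrm S d (\<lambda>x. g x - f x) < e \<longrightarrow> g \<in> U)"

definition Fdual :: "setting \<Rightarrow> nat \<Rightarrow> (fn \<Rightarrow> real) \<Rightarrow> bool" where
  "Fdual S d L \<longleftrightarrow>
     (\<forall>f\<in>sp S d. \<forall>g\<in>sp S d. L (\<lambda>x. f x + g x) = L f + L g) \<and>
     (\<forall>f\<in>sp S d. \<forall>c. L (\<lambda>x. c * f x) = c * L f) \<and>
     (\<exists>C. \<forall>f\<in>sp S d. \<bar>L f\<bar> \<le> C * nrm S d f)"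

definition banach_fun_space :: "setting \<Rightarrow> nat \<Rightarrow> bool" where
  "banach_fun_space S d \<longleftrightarrow>
     (\<forall>f\<in>sp S d. \<forall>x. x \<notin> dom S d \<longrightarrow> f x = 0) \<and>
     (\<lambda>x. 0) \<in> sp S d \<and>
     (\<forall>f\<in>sp S d. \<forall>g\<in>sp S d. (\<lambda>x. f x + g x) \<in> sp S d) \<and>
     (\<forall>f\<in>sp S d. \<forall>c. (\<lambda>x. c * f x) \<in> sp S d) \<and>
     (\<forall>f\<in>sp S d. 0 \<le> nrm S d f) \<and>
     (\<forall>f\<in>sp S d. nrm S d f = 0 \<longrightarrow> f = (\<lambda>x. 0)) \<and>
     (\<forall>f\<in>sp S d. \<forall>c. nrm S d (\<lambda>x. c * f x) = \<bar>c\<bar> * nrm S d f) \<and>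
     (\<forall>f\<in>sp S d. \<forall>g\<in>sp S d. nrm S d (\<lambda>x. f x + g x) \<le> nrm S d f + nrm S d g) \<and>
     (\<forall>s :: nat \<Rightarrow> fn. (\<forall>k. s k \<in> sp S d) \<and>
          (\<forall>e>0. \<exists>N. \<forall>m\<ge>N. \<forall>k\<ge>N. nrm S d (\<lambda>x. s m x - s k x) < e) \<longrightarrow>
          (\<exists>g\<in>sp S d. \<forall>e>0. \<exists>N. \<forall>k\<ge>N. nrm S d (\<lambda>x. s k x - g x) < e)) \<and>
     (\<exists>Q. countable Q \<and> Q \<subseteq> sp S d \<and>
          (\<forall>f\<in>sp S d. \<forall>e>0. \<exists>g\<in>Q. nrm S d (\<lambda>x. f x - g x) < e))"

definition app_setting :: "setting \<Rightarrow> bool" where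
  "app_setting S \<longleftrightarrow> (\<forall>d\<ge>1.
     \<comment> \<open>D_d Borel of positive Lebesgue measure\<close>
     dom S d \<in> sets (lebd d) \<and> emeasure (lebd d) (dom S d) > 0 \<and>
     \<comment> \<open>rho_d probability density on D_d\<close>
     dens S d \<in> borel_measurable (lebd d) \<and> (\<forall>x\<in>dom S d. 0 \<le> dens S d x) \<and>
     (\<integral>\<^sup>+ x \<in> dom S d. ennreal (dens S d x) \<partial>lebd d) = 1 \<and>
     \<comment> \<open>F_d separable Banach space of functions on D_d\<close>
     banach_fun_space S d \<and>
     \<comment> \<open>continuous point evaluations\<close>
     (\<forall>x\<in>dom S d. \<exists>C. \<forall>f\<in>sp S d. \<bar>f x\<bar> \<le> C * nrm S d f) \<and>
     \<comment> \<open>continuous embedding into G_d\<close>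
     sp S d \<subseteq> L2set S d \<and>
     (\<exists>C. \<forall>f\<in>sp S d. gnorm2 S d f \<le> ennreal ((C * nrm S d f)\<^sup>2)) \<and>
     (\<forall>f\<in>sp S d. gnorm2 S d f = 0 \<longrightarrow> f = (\<lambda>x. 0)) \<and>
     \<comment> \<open>mu_d zero-mean Gaussian Borel probability measure on F_d\<close>
     space (mu S d) = sp S d \<and>
     sets (mu S d) = sigma_sets (sp S d) (Collect (Fopen S d)) \<and>
     prob_space (mu S d) \<and>
     (\<forall>L. Fdual S d L \<longrightarrow>
        (distr (mu S d) borel L = return borel 0 \<or>
         (\<exists>\<sigma>>0. distr (mu S d) borel L = density lborel (normal_density 0 \<sigma>)))))"

definition lam :: "setting \<Rightarrow> infoclass \<Rightarrow> nat \<Rightarrow> (fn \<Rightarrow> real) set" where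
  "lam S c d = (case c of
      Lall \<Rightarrow> {L. Fdual S d L}
    | Lstd \<Rightarrow> {L. \<exists>x\<in>dom S d. L = (\<lambda>f. f x)})"

definition meas_phi :: "setting \<Rightarrow> nat \<Rightarrow> nat \<Rightarrow> (pt \<Rightarrow> fn) \<Rightarrow> bool" where
  "meas_phi S d n \<phi> \<longleftrightarrow>
     (\<forall>y\<in>space (PiM {..<n} (\<lambda>_. borel :: real measure)). \<phi> y \<in> L2set S d) \<and>
     (\<forall>U. L2open S d U \<longrightarrow>
        {y \<in> space (PiM {..<n} (\<lambda>_. borel :: real measure)). \<phi> y \<in> U}
          \<in> sets (PiM {..<n} (\<lambda>_. borel :: real measure)))"

definition algs :: "setting \<Rightarrow> infoclass \<Rightarrow> nat \<Rightarrow> nat \<Rightarrow> (fn \<Rightarrow> fn) set" where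
  "algs S c n d =
     (if n = 0 then {\<lambda>f. (\<lambda>x. 0)}
      else {A. \<exists>Ls \<phi>. (\<forall>i<n. Ls i \<in> lam S c d) \<and> meas_phi S d n \<phi> \<and>
                 A = (\<lambda>f. \<phi> (restrict (\<lambda>i. Ls i f) {..<n}))})"

definition ensqrt :: "ennreal \<Rightarrow> ennreal" where
  "ensqrt x = (if x = \<top> then \<top> else ennreal (sqrt (enn2real x)))"

definition err_avg :: "setting \<Rightarrow> nat \<Rightarrow> (fn \<Rightarrow> fn) \<Rightarrow> ennreal" where
  "err_avg S d A = ensqrt (\<integral>\<^sup>+ f. gnorm2 S d (\<lambda>x. f x - A f x) \<partial>mu S d)"

definition eavg :: "setting \<Rightarrow> infoclass \<Rightarrow> nat \<Rightarrow> nat \<Rightarrow> ennreal" where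
  "eavg S c n d = (INF A \<in> algs S c n d. err_avg S d A)"

definition Gamma :: "setting \<Rightarrow> nat \<Rightarrow> ennreal" where
  "Gamma S d = (eavg S Lall 0 d)\<^sup>2"

definition CRI :: "setting \<Rightarrow> criterion \<Rightarrow> nat \<Rightarrow> ennreal" where
  "CRI S crit d = (case crit of ABS \<Rightarrow> 1 | NOR \<Rightarrow> ensqrt (Gamma S d))"

definition nstar :: "setting \<Rightarrow> criterion \<Rightarrow> infoclass \<Rightarrow> real \<Rightarrow> nat \<Rightarrow> nat" where
  "nstar S crit c \<epsilon> d = (LEAST n. eavg S c n d \<le> ennreal \<epsilon> * CRI S crit d)"

definition exp_pt :: "setting \<Rightarrow> criterion \<Rightarrow> infoclass \<Rightarrow> bool" where
  "exp_pt S crit c \<longleftrightarrow> (\<exists>C>0. \<exists>p\<ge>0. \<exists>q\<ge>0. \<forall>d\<ge>1. \<forall>\<epsilon>. 0 < \<epsilon> \<and> \<epsilon> < 1 \<longrightarrow>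
     real (nstar S crit c \<epsilon> d) \<le> C * real d powr q * (1 + ln (1 / \<epsilon>)) powr p)"

definition spt_bound :: "setting \<Rightarrow> criterion \<Rightarrow> infoclass \<Rightarrow> real \<Rightarrow> bool" where
  "spt_bound S crit c p \<longleftrightarrow> (\<exists>C>0. \<forall>d\<ge>1. \<forall>\<epsilon>. 0 < \<epsilon> \<and> \<epsilon> < 1 \<longrightarrow>
     real (nstar S crit c \<epsilon> d) \<le> C * (1 + ln (1 / \<epsilon>)) powr p)"

definition exp_spt :: "setting \<Rightarrow> criterion \<Rightarrow> infoclass \<Rightarrow> bool" where
  "exp_spt S crit c \<longleftrightarrow> (\<exists>p\<ge>0. spt_bound S crit c p)"

definition exp_p :: "setting \<Rightarrow> criterion \<Rightarrow> infoclass \<Rightarrow> real" where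
  "exp_p S crit c = Inf {p. p \<ge> 0 \<and> spt_bound S crit c p}"

end

theory Submission
  imports Defs
begin

text \<open>Let \<open>a(n)\<close> and \<open>s(n)\<close> be the minimal errors for \<open>Lall\<close> and \<open>Lstd\<close>. The key is the
  inequality \<open>s(n) \<le> (n + 1) a(n)\<close>: a factor polynomial in \<open>n\<close> only changes \<open>\<epsilon>\<close> to a power of
  \<open>\<epsilon>\<close>, which leaves bounds in terms of \<open>1 + ln (1 / \<epsilon>)\<close> intact up to constants.

  For the lower bound on \<open>a(n)\<close>, Gaussianity makes linear prediction optimal, so \<open>a(n)\<^sup>2\<close> is at
  least (up to an arbitrarily small error) the mean squared distance \<open>t\<close> of \<open>f\<close> from some subspace
  \<open>V\<close> of \<open>L\<^sub>2\<close> of dimension at most \<open>n\<close>. For the upper bound on \<open>s(n)\<close>, let \<open>K\<close> be the reproducing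
  kernel of \<open>V\<close>. Averaging over \<open>x\<close> with density \<open>K x x / dim V\<close> yields a sampling point \<open>x\<close>
  such that subtracting \<open>f(x) K(\<cdot>,x) / K(x,x)\<close> reduces \<open>V\<close> to the functions in \<open>V\<close> vanishing at
  \<open>x\<close>, while \<open>t\<close> grows at most by the factor \<open>1 + 1 / dim V\<close>. After \<open>dim V\<close> points \<open>t\<close> has grown
  by at most \<open>dim V + 1\<close>.\<close>

subsection \<open>Square-integrable functions\<close>

text \<open>The hypotheses on \<open>mu S d\<close> concern one functional at a time, which shapes
  the probabilistic half. Optimality of linear prediction against an arbitrary measurable
  \<open>\<phi>\<close> is a statement about joint laws, so these are recovered from one-dimensional
  laws by a Cramer-Wold argument. Exchanging the integral over f with the one over x requires a
  finite second moment of the norm of f in G_d, which is derived from the Gaussianity of the point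
  values. The optimal V would be spanned by eigenfunctions of the covariance operator. Here V is
  built from the coefficients of best linear predictors of finitely many coordinates of f, and those
  coordinates miss a small part of f in mean square; this is the source of the arbitrarily small
  error in the lower bound. The inequality compares both classes at the same n and is homogeneous in
  the error. So the normalisation CRI cancels, and both criteria are treated at once.\<close>

definition sqint :: "'a measure \<Rightarrow> ('a \<Rightarrow> real) \<Rightarrow> bool" where
  "sqint N u \<longleftrightarrow> u \<in> borel_measurable N \<and> integrable N (\<lambda>x. (u x)\<^sup>2)"

text \<open>Functions are kept as representatives rather than L2 classes, because sampling needs
  values at points. The form \<open>ip\<close> is therefore only semidefinite: norm 0 yields
  vanishing almost everywhere.\<close>

definition ip :: "'a measure \<Rightarrow> ('a \<Rightarrow> real) \<Rightarrow> ('a \<Rightarrow> real) \<Rightarrow> real" where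
  "ip N u v = (\<integral>x. u x * v x \<partial>N)"

lemma sqint_mult:
  assumes "sqint N u" "sqint N v"
  shows "integrable N (\<lambda>x. u x * v x)"
proof (rule Bochner_Integration.integrable_bound)
  show "integrable N (\<lambda>x. (u x)\<^sup>2 + (v x)\<^sup>2)" using assms by (auto simp: sqint_def)
  show "(\<lambda>x. u x * v x) \<in> borel_measurable N" using assms by (auto simp: sqint_def)
  have "\<bar>a\<bar> * \<bar>b\<bar> \<le> a\<^sup>2 + b\<^sup>2" for a b :: real
  proof -
    have "0 \<le> \<bar>a\<bar> * \<bar>b\<bar>" by simp
    then show ?thesis using sum_squares_bound[of "\<bar>a\<bar>" "\<bar>b\<bar>"] unfolding power2_abs by linarith
  qed
  then show "AE x in N. norm (u x * v x) \<le> norm ((u x)\<^sup>2 + (v x)\<^sup>2)"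
    by (auto simp: abs_mult)
qed

lemma sqint_zero [simp]: "sqint N (\<lambda>x. 0)" by (auto simp: sqint_def)

lemma sqint_scale: "sqint N u \<Longrightarrow> sqint N (\<lambda>x. c * u x)"
  by (auto simp: sqint_def power_mult_distrib)

lemma sqint_scale': "sqint N u \<Longrightarrow> sqint N (\<lambda>x. u x * c)"
  by (auto simp: sqint_def power_mult_distrib)

lemma sqint_add:
  assumes "sqint N u" "sqint N v" shows "sqint N (\<lambda>x. u x + v x)"
  using sqint_mult[OF assms] assms unfolding sqint_def
  by (auto simp: power2_sum mult.assoc)

lemma sqint_diff:
  assumes "sqint N u" "sqint N v" shows "sqint N (\<lambda>x. u x - v x)"
  using sqint_add[OF assms(1) sqint_scale[OF assms(2), of "-1"]] by simp

lemma sqint_sum: "(\<And>i. i \<in> I \<Longrightarrow> sqint N (u i)) \<Longrightarrow> sqint N (\<lambda>x. \<Sum>i\<in>I. u i x)"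
  by (induction I rule: infinite_finite_induct) (auto intro: sqint_add)

lemma ip_commute: "ip N u v = ip N v u" by (simp add: ip_def mult.commute)

lemma ip_add: "sqint N u \<Longrightarrow> sqint N v \<Longrightarrow> sqint N w \<Longrightarrow> ip N (\<lambda>x. u x + v x) w = ip N u w + ip N v w"
  by (simp add: ip_def sqint_mult distrib_right)

lemma ip_diff: "sqint N u \<Longrightarrow> sqint N v \<Longrightarrow> sqint N w \<Longrightarrow> ip N (\<lambda>x. u x - v x) w = ip N u w - ip N v w"
  by (simp add: ip_def sqint_mult left_diff_distrib)

lemma ip_scale: "ip N (\<lambda>x. c * u x) w = c * ip N u w"
  by (simp add: ip_def mult.assoc)

lemma ip_sum:
  assumes "\<And>i. i \<in> I \<Longrightarrow> sqint N (u i)" "sqint N w"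
  shows "ip N (\<lambda>x. \<Sum>i\<in>I. u i x) w = (\<Sum>i\<in>I. ip N (u i) w)"
  unfolding ip_def sum_distrib_right
  by (rule Bochner_Integration.integral_sum) (use assms in \<open>auto intro: sqint_mult\<close>)

lemma ip_diff_right: "sqint N u \<Longrightarrow> sqint N v \<Longrightarrow> sqint N w \<Longrightarrow> ip N w (\<lambda>x. u x - v x) = ip N w u - ip N w v"
  by (simp add: ip_commute[of N w] ip_diff)

lemma ip_scale_right: "ip N w (\<lambda>x. c * u x) = c * ip N w u"
  by (simp add: ip_commute[of N w] ip_scale)

lemma ip_sum_right:
  assumes "\<And>i. i \<in> I \<Longrightarrow> sqint N (u i)" "sqint N w"
  shows "ip N w (\<lambda>x. \<Sum>i\<in>I. u i x) = (\<Sum>i\<in>I. ip N w (u i))"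
  using assms by (simp add: ip_commute[of N w] ip_sum)

lemma sqint_lincomb:
  assumes "\<And>i. i < n \<Longrightarrow> sqint N (a i)" shows "sqint N (\<lambda>x. \<Sum>i<(n::nat). c i * a i x)"
  using assms by (intro sqint_sum sqint_scale) auto

lemma ip_lincomb:
  assumes "\<And>i. i < n \<Longrightarrow> sqint N (a i)" "sqint N v"
  shows "ip N (\<lambda>x. \<Sum>i<(n::nat). c i * a i x) v = (\<Sum>i<n. c i * ip N (a i) v)"
  by (subst ip_sum) (use assms in \<open>auto simp: ip_scale intro: sqint_scale\<close>)

lemma ip_lincomb_right:
  assumes "\<And>i. i < n \<Longrightarrow> sqint N (a i)" "sqint N v"
  shows "ip N v (\<lambda>x. \<Sum>i<(n::nat). c i * a i x) = (\<Sum>i<n. c i * ip N v (a i))"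
  using ip_lincomb[where c = c, OF assms] by (simp add: ip_commute[of N v])

lemma ip_self: "ip N u u = (\<integral>x. (u x)\<^sup>2 \<partial>N)"
  by (simp add: ip_def power2_eq_square)

lemma ip_self_nonneg [simp]: "0 \<le> ip N u u"
  by (simp add: ip_self)

lemma ip_self_eq_0:
  assumes "sqint N u" shows "ip N u u = 0 \<longleftrightarrow> (AE x in N. u x = 0)"
  unfolding ip_self using assms
  by (subst integral_nonneg_eq_0_iff_AE) (auto simp: sqint_def)

lemma nn_integral_sqint:
  assumes "sqint N u" shows "(\<integral>\<^sup>+x. ennreal ((u x)\<^sup>2) \<partial>N) = ennreal (ip N u u)"
  unfolding ip_self using assms by (intro nn_integral_eq_integral) (auto simp: sqint_def)

lemma sqint_iff_nn:
  "sqint N u \<longleftrightarrow> u \<in> borel_measurable N \<and> (\<integral>\<^sup>+x. ennreal ((u x)\<^sup>2) \<partial>N) < \<infinity>"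
  by (auto simp: sqint_def integrable_iff_bounded)

lemma ip_cong_AE:
  assumes "AE x in N. u x = u' x" "AE x in N. v x = v' x"
    "sqint N u" "sqint N v" "sqint N u'" "sqint N v'"
  shows "ip N u v = ip N u' v'"
  unfolding ip_def using assms by (intro integral_cong_AE) (auto simp: sqint_def)

lemma ip_eq_0_AE:
  assumes "AE x in N. v x = 0" shows "ip N u v = 0"
  unfolding ip_def by (rule integral_eq_zero_AE) (use assms in auto)

section \<open>Orthonormal systems and least squares\<close>

definition orthonormal :: "'a measure \<Rightarrow> nat \<Rightarrow> (nat \<Rightarrow> 'a \<Rightarrow> real) \<Rightarrow> bool" where
  "orthonormal N m \<eta> \<longleftrightarrow> (\<forall>i<m. sqint N (\<eta> i)) \<and> (\<forall>i<m. \<forall>j<m. ip N (\<eta> i) (\<eta> j) = (if i = j then 1 else 0))"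

lemma ip_orthonormal_comb:
  assumes "orthonormal N m \<eta>" "j < m"
  shows "ip N (\<lambda>x. \<Sum>i<m. c i * \<eta> i x) (\<eta> j) = c j"
proof -
  have "ip N (\<lambda>x. \<Sum>i<m. c i * \<eta> i x) (\<eta> j) = (\<Sum>i<m. c i * ip N (\<eta> i) (\<eta> j))"
    using assms by (subst ip_sum) (auto simp: orthonormal_def ip_scale intro: sqint_scale)
  also have "\<dots> = (\<Sum>i<m. if i = j then c i else 0)"
    using assms by (intro sum.cong) (auto simp: orthonormal_def)
  finally show ?thesis using assms by simp
qed

lemma sqint_comb:
  assumes "orthonormal N m \<eta>" shows "sqint N (\<lambda>x. \<Sum>i<m. c i * \<eta> i x)"
  using assms by (intro sqint_sum sqint_scale) (auto simp: orthonormal_def)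

text \<open>Pythagoras: the last sum measures how far \<open>c\<close> is from the coefficients of
  \<open>u\<close>. Hence projection is the best approximation from the span, which serves both
  \<open>projections_dense\<close> and \<open>lower_bound\<close>.\<close>

lemma ip_diff_comb:
  assumes o: "orthonormal N m \<eta>" and u: "sqint N u"
  shows "ip N (\<lambda>x. u x - (\<Sum>i<m. c i * \<eta> i x)) (\<lambda>x. u x - (\<Sum>i<m. c i * \<eta> i x))
     = ip N u u - (\<Sum>i<m. (ip N u (\<eta> i))\<^sup>2) + (\<Sum>i<m. (ip N u (\<eta> i) - c i)\<^sup>2)"
proof -
  let ?s = "\<lambda>x. \<Sum>i<m. c i * \<eta> i x"
  note s = sqint_comb[OF o, of c]
  have \<eta>: "\<And>i. i < m \<Longrightarrow> sqint N (\<eta> i)" using o by (auto simp: orthonormal_def)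
  have 1: "ip N u ?s = (\<Sum>i<m. c i * ip N u (\<eta> i))"
    using \<eta> u by (subst ip_sum_right) (auto simp: ip_scale_right intro: sqint_scale)
  have "ip N ?s ?s = (\<Sum>i<m. c i * ip N ?s (\<eta> i))"
    using \<eta> s by (subst ip_sum_right) (auto simp: ip_scale_right intro: sqint_scale)
  also have "\<dots> = (\<Sum>i<m. c i * c i)"
    by (intro sum.cong) (auto simp: ip_orthonormal_comb[OF o])
  finally have 2: "ip N ?s ?s = (\<Sum>i<m. c i * c i)" .
  have "ip N (\<lambda>x. u x - ?s x) (\<lambda>x. u x - ?s x) = ip N u u - 2 * ip N u ?s + ip N ?s ?s"
    using u s by (simp add: ip_diff ip_diff_right sqint_diff ip_commute[of N ?s u])
  also have "\<dots> = ip N u u + (\<Sum>i<m. c i * c i - 2 * (c i * ip N u (\<eta> i)))"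
    by (simp add: 1 2 sum_subtractf sum_distrib_left)
  also have "(\<Sum>i<m. c i * c i - 2 * (c i * ip N u (\<eta> i))) = (\<Sum>i<m. (ip N u (\<eta> i) - c i)\<^sup>2 - (ip N u (\<eta> i))\<^sup>2)"
    by (intro sum.cong) (auto simp: power2_eq_square algebra_simps)
  finally show ?thesis by (simp add: sum_subtractf)
qed

lemma ip_diff_proj:
  assumes "orthonormal N m \<eta>" "sqint N u"
  shows "ip N (\<lambda>x. u x - (\<Sum>i<m. ip N u (\<eta> i) * \<eta> i x)) (\<lambda>x. u x - (\<Sum>i<m. ip N u (\<eta> i) * \<eta> i x))
     = ip N u u - (\<Sum>i<m. (ip N u (\<eta> i))\<^sup>2)"
  using ip_diff_comb[OF assms, of "\<lambda>i. ip N u (\<eta> i)"] by simp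

lemma bessel:
  assumes "orthonormal N m \<eta>" "sqint N u"
  shows "(\<Sum>i<m. (ip N u (\<eta> i))\<^sup>2) \<le> ip N u u"
  using ip_self_nonneg[of N "\<lambda>x. u x - (\<Sum>i<m. ip N u (\<eta> i) * \<eta> i x)"]
  unfolding ip_diff_proj[OF assms] by simp

text \<open>Gram-Schmidt. A vector whose remainder has norm 0 adds no new basis element, hence
  \<open>m \<le> n\<close> and a representation that holds only almost everywhere.\<close>

lemma orthonormalise:
  assumes "\<And>i. i < n \<Longrightarrow> sqint N (a i)"
  shows "\<exists>m \<eta>. m \<le> n \<and> orthonormal N m \<eta> \<and> (\<forall>i<n. \<exists>c. AE x in N. a i x = (\<Sum>j<m. c j * \<eta> j x))"
  using assms
proof (induction n)
  case 0
  show ?case by (rule exI[of _ 0]) (auto simp: orthonormal_def)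
next
  case (Suc n)
  then obtain m \<eta> where m: "m \<le> n" and o: "orthonormal N m \<eta>"
    and rep: "\<And>i. i < n \<Longrightarrow> \<exists>c. AE x in N. a i x = (\<Sum>j<m. c j * \<eta> j x)" by (metis less_SucI)
  define b where "b = (\<lambda>x. a n x - (\<Sum>j<m. ip N (a n) (\<eta> j) * \<eta> j x))"
  have an: "sqint N (a n)" using Suc by auto
  have b: "sqint N b" unfolding b_def by (intro sqint_diff an sqint_comb[OF o])
  have \<eta>: "\<And>i. i < m \<Longrightarrow> sqint N (\<eta> i)" using o by (auto simp: orthonormal_def)
  have borth: "ip N b (\<eta> j) = 0" if "j < m" for j
    unfolding b_def using that by (simp add: ip_diff an sqint_comb[OF o] \<eta> ip_orthonormal_comb[OF o])
  show ?case
  proof (cases "ip N b b = 0")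
    case True
    then have "AE x in N. b x = 0" using ip_self_eq_0[OF b] by simp
    then have "AE x in N. a n x = (\<Sum>j<m. ip N (a n) (\<eta> j) * \<eta> j x)" by (auto simp: b_def)
    then have "\<exists>c. AE x in N. a n x = (\<Sum>j<m. c j * \<eta> j x)" by (intro exI[of _ "\<lambda>j. ip N (a n) (\<eta> j)"])
    then show ?thesis using rep m o by (intro exI[of _ m] exI[of _ \<eta>]) (auto simp: less_Suc_eq)
  next
    case False
    define s where "s = sqrt (ip N b b)"
    have s0: "s > 0" unfolding s_def using False ip_self_nonneg[of N b] by (simp add: less_eq_real_def)
    have s2: "ip N b b = s * s" unfolding s_def by simp
    define \<zeta> where "\<zeta> = \<eta>(m := (\<lambda>x. (1/s) * b x))"
    have sb: "sqint N (\<lambda>x. (1/s) * b x)" by (rule sqint_scale[OF b])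
    have z1: "ip N (\<lambda>x. (1/s) * b x) (\<eta> j) = 0" "ip N (\<eta> j) (\<lambda>x. (1/s) * b x) = 0" if "j < m" for j
      using borth[OF that] by (simp_all only: ip_scale ip_scale_right ip_commute[of N "\<eta> j" b] mult_zero_right)
    have z2: "ip N (\<lambda>x. (1/s) * b x) (\<lambda>x. (1/s) * b x) = 1"
      unfolding ip_scale ip_scale_right s2 using s0 by simp
    have o': "orthonormal N (Suc m) \<zeta>"
      unfolding orthonormal_def \<zeta>_def using o sb z1 z2 by (auto simp: less_Suc_eq orthonormal_def)
    have old: "\<exists>c. AE x in N. a i x = (\<Sum>j<Suc m. c j * \<zeta> j x)" if i: "i < n" for i
    proof -
      obtain c where c: "AE x in N. a i x = (\<Sum>j<m. c j * \<eta> j x)" using rep[OF i] by auto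
      show ?thesis by (rule exI[of _ "c(m := 0)"]) (use c in \<open>simp add: \<zeta>_def\<close>)
    qed
    have "\<exists>c. AE x in N. a n x = (\<Sum>j<Suc m. c j * \<zeta> j x)"
      by (rule exI[of _ "\<lambda>j. if j = m then s else ip N (a n) (\<eta> j)"]) (use s0 in \<open>simp add: \<zeta>_def b_def\<close>)
    then show ?thesis using m o' old
      by (intro exI[of _ "Suc m"] exI[of _ \<zeta>]) (auto simp: less_Suc_eq)
  qed
qed

text \<open>The \<open>a i\<close> may be linearly dependent, as the functionals of an algorithm may
  be. The remainder \<open>e\<close> of \<open>a n\<close> after its own least squares fit is
  orthogonal to the earlier vectors, so a multiple of \<open>e\<close> repairs the equation for
  \<open>a n\<close> without spoiling the others.\<close>

lemma normal_equations:
  fixes n :: nat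
  assumes "\<And>i. i < n \<Longrightarrow> sqint N (a i)" "sqint N z"
  shows "\<exists>b. \<forall>j<n. ip N (\<lambda>x. z x - (\<Sum>i<n. b i * a i x)) (a j) = 0"
  using assms
proof (induction n arbitrary: z)
  case 0 then show ?case by simp
next
  case (Suc n)
  have a: "\<And>i. i < n \<Longrightarrow> sqint N (a i)" and an: "sqint N (a n)" and z: "sqint N z" using Suc by auto
  obtain b where b: "\<And>j. j < n \<Longrightarrow> ip N (\<lambda>x. z x - (\<Sum>i<n. b i * a i x)) (a j) = 0"
    using Suc.IH[OF a z] by blast
  obtain c where c: "\<And>j. j < n \<Longrightarrow> ip N (\<lambda>x. a n x - (\<Sum>i<n. c i * a i x)) (a j) = 0"
    using Suc.IH[OF a an] by blast
  define r where "r = (\<lambda>x. z x - (\<Sum>i<n. b i * a i x))"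
  define e where "e = (\<lambda>x. a n x - (\<Sum>i<n. c i * a i x))"
  have r: "sqint N r" and e: "sqint N e" unfolding r_def e_def using a an z by (auto intro!: sqint_diff sqint_lincomb)
  \<comment> \<open>If \<open>e\<close> has norm 0, this is 0 by the convention for division, and
    the equation for \<open>a n\<close> holds anyway because \<open>ip N r e = 0\<close>.\<close>
  define t where "t = ip N r (a n) / ip N e (a n)"
  have ee: "ip N e (a n) = ip N e e"
  proof -
    have "ip N e e = ip N e (a n) - (\<Sum>i<n. c i * ip N e (a i))"
      by (subst (2) e_def) (simp only: ip_diff_right[OF an sqint_lincomb[OF a] e] ip_lincomb_right[OF a e])
    also have "(\<Sum>i<n. c i * ip N e (a i)) = 0" using c by (intro sum.neutral) (auto simp: e_def)
    finally show ?thesis by simp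
  qed
  have re: "ip N r (a n) = ip N r e"
  proof -
    have "ip N r e = ip N r (a n) - (\<Sum>i<n. c i * ip N r (a i))"
      by (subst e_def) (simp only: ip_diff_right[OF an sqint_lincomb[OF a] r] ip_lincomb_right[OF a r])
    also have "(\<Sum>i<n. c i * ip N r (a i)) = 0" using b by (intro sum.neutral) (auto simp: r_def)
    finally show ?thesis by simp
  qed
  have lin: "ip N (\<lambda>x. r x - t * e x) v = ip N r v - t * ip N e v" if "sqint N v" for v
    by (simp only: ip_diff[OF r sqint_scale[OF e] that] ip_scale)
  have "t * ip N e (a n) = ip N r (a n)"
  proof (cases "ip N e e = 0")
    case True
    then have "AE x in N. e x = 0" using ip_self_eq_0[OF e] by simp
    then have "ip N r e = 0" by (rule ip_eq_0_AE)
    then show ?thesis using True by (simp add: re ee)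
  qed (simp add: t_def ee)
  then have main: "ip N (\<lambda>x. r x - t * e x) (a j) = 0" if "j < Suc n" for j
    using that b[of j] c[of j] a[of j] an
    by (auto simp: less_Suc_eq lin r_def[symmetric] e_def[symmetric])
  have eq: "(\<lambda>x. r x - t * e x) = (\<lambda>x. z x - (\<Sum>i<Suc n. ((\<lambda>i. b i - t * c i)(n := t)) i * a i x))"
    by (auto simp: r_def e_def algebra_simps sum_subtractf sum_distrib_left)
  show ?case using main unfolding eq by blast
qed

lemma ip_Cauchy_Schwarz:
  assumes u: "sqint N u" and v: "sqint N v"
  shows "(ip N u v)\<^sup>2 \<le> ip N u u * ip N v v"
proof -
  obtain b where "\<forall>j<Suc 0. ip N (\<lambda>x. u x - (\<Sum>i<Suc 0. b i * v x)) v = 0"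
    using normal_equations[of "Suc 0" N "\<lambda>_. v" u] u v by auto
  then have b: "ip N (\<lambda>x. u x - b 0 * v x) v = 0" by simp
  then have uv: "ip N u v = b 0 * ip N v v"
    by (simp add: ip_diff[OF u sqint_scale[OF v] v] ip_scale)
  have "0 \<le> ip N (\<lambda>x. u x - b 0 * v x) (\<lambda>x. u x - b 0 * v x)" by simp
  also have "\<dots> = ip N u u - b 0 * ip N u v"
    unfolding ip_diff_right[OF u sqint_scale[OF v] sqint_diff[OF u sqint_scale[OF v]]] ip_scale_right b
    by (simp only: ip_diff[OF u sqint_scale[OF v] u] ip_scale) (simp add: ip_commute)
  finally have "ip N v v * (b 0 * ip N u v) \<le> ip N v v * ip N u u"
    by (intro mult_left_mono) auto
  then show ?thesis unfolding uv by (simp add: power2_eq_square mult_ac)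
qed

subsection \<open>Sampling a random field\<close>

text \<open>Square integrability along paths and at points is demanded for every \<omega> and every
  x, not almost every: a single sampling point is selected later and must be usable.\<close>

definition field :: "'a measure \<Rightarrow> 'b measure \<Rightarrow> ('a \<Rightarrow> 'b \<Rightarrow> real) \<Rightarrow> bool" where
  "field M N r \<longleftrightarrow> sqint (M \<Otimes>\<^sub>M N) (\<lambda>(\<omega>, x). r \<omega> x) \<and>
     (\<forall>\<omega>\<in>space M. sqint N (r \<omega>)) \<and> (\<forall>x\<in>space N. sqint M (\<lambda>\<omega>. r \<omega> x))"

definition msq :: "'a measure \<Rightarrow> 'b measure \<Rightarrow> ('a \<Rightarrow> 'b \<Rightarrow> real) \<Rightarrow> real" where
  "msq M N r = (\<integral>\<omega>. ip N (r \<omega>) (r \<omega>) \<partial>M)"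

text \<open>Reproducing kernel of a finite-dimensional V that stays implicit: membership in V is
  expressed as \<open>ip N u (K y) = u y\<close>, and the trace \<open>t\<close> plays the role of
  dim V.\<close>

definition kernel :: "'b measure \<Rightarrow> ('b \<Rightarrow> 'b \<Rightarrow> real) \<Rightarrow> real \<Rightarrow> bool" where
  "kernel N K t \<longleftrightarrow> (\<forall>x\<in>space N. sqint N (K x)) \<and> (\<forall>x\<in>space N. \<forall>y\<in>space N. K x y = K y x) \<and>
     (\<forall>x\<in>space N. \<forall>y\<in>space N. ip N (K x) (K y) = K x y) \<and> has_bochner_integral N (\<lambda>x. K x x) t"

lemma fieldD:
  assumes "field M N r"
  shows "\<omega> \<in> space M \<Longrightarrow> sqint N (r \<omega>)" "x \<in> space N \<Longrightarrow> sqint M (\<lambda>\<omega>. r \<omega> x)"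
  using assms by (auto simp: field_def)

lemma field_add: "field M N r \<Longrightarrow> field M N s \<Longrightarrow> field M N (\<lambda>\<omega> x. r \<omega> x + s \<omega> x)"
  using sqint_add[of "M \<Otimes>\<^sub>M N" "\<lambda>(\<omega>, x). r \<omega> x" "\<lambda>(\<omega>, x). s \<omega> x"]
  by (auto simp: field_def case_prod_unfold intro: sqint_add)

lemma field_diff: "field M N r \<Longrightarrow> field M N s \<Longrightarrow> field M N (\<lambda>\<omega> x. r \<omega> x - s \<omega> x)"
  using sqint_diff[of "M \<Otimes>\<^sub>M N" "\<lambda>(\<omega>, x). r \<omega> x" "\<lambda>(\<omega>, x). s \<omega> x"]
  by (auto simp: field_def case_prod_unfold intro: sqint_diff)

lemma field_zero: "field M N (\<lambda>\<omega> x. 0)"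
  by (auto simp: field_def case_prod_unfold)

lemma field_sum: "(\<And>i. i \<in> I \<Longrightarrow> field M N (r i)) \<Longrightarrow> field M N (\<lambda>\<omega> x. \<Sum>i\<in>I. r i \<omega> x)"
  by (induction I rule: infinite_finite_induct) (auto intro: field_add field_zero)

lemma msq_nonneg: "0 \<le> msq M N r"
  unfolding msq_def by (rule integral_nonneg_AE) simp

lemma kernel_diag_nonneg: "kernel N K t \<Longrightarrow> x \<in> space N \<Longrightarrow> 0 \<le> K x x"
  unfolding kernel_def using ip_self_nonneg[of N "K x"] by auto

lemma kernel_diag_0:
  assumes "kernel N K t" "x \<in> space N" "K x x = 0"
  shows "ip N u (K x) = 0"
proof -
  have "AE y in N. K x y = 0" using ip_self_eq_0[of N "K x"] assms by (auto simp: kernel_def)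
  then show ?thesis by (rule ip_eq_0_AE)
qed

text \<open>If the inequality failed at every point with \<open>K x x > 0\<close>, then
  \<open>h x - c * K x x\<close> would be nonnegative everywhere with integral 0, so the diagonal
  would vanish almost everywhere, against \<open>t > 0\<close>. Negative values of \<open>h\<close>
  are allowed for the sake of \<open>exists_kaczmarz\<close>.\<close>

lemma kernel_select:
  assumes K: "kernel N K t" and t: "t > 0" and h: "integrable N h"
    and h0: "\<And>x. x \<in> space N \<Longrightarrow> K x x = 0 \<Longrightarrow> h x \<ge> 0"
  shows "\<exists>x\<in>space N. K x x > 0 \<and> h x \<le> (\<integral>y. h y \<partial>N) / t * K x x"
proof (rule ccontr)
  define c where "c = (\<integral>y. h y \<partial>N) / t"
  assume "\<not> ?thesis"
  then have gt: "h x > c * K x x" if "x \<in> space N" "K x x > 0" for x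
    using that by (auto simp: c_def not_le)
  have Ki: "integrable N (\<lambda>x. K x x)" and Kt: "(\<integral>x. K x x \<partial>N) = t"
    using K by (auto simp: kernel_def has_bochner_integral_iff)
  have ge: "h x - c * K x x \<ge> 0" if "x \<in> space N" for x
    using gt[OF that] h0[OF that] kernel_diag_nonneg[OF K that] by (cases "K x x = 0") auto
  have "(\<integral>x. h x - c * K x x \<partial>N) = 0"
    using Ki Kt h t by (simp add: c_def)
  then have "AE x in N. h x - c * K x x = 0"
    using Ki h ge by (subst (asm) integral_nonneg_eq_0_iff_AE) auto
  then have "AE x in N. K x x = 0"
  proof (rule AE_mp, intro AE_I2 impI)
    fix x assume x: "x \<in> space N" and e: "h x - c * K x x = 0"
    show "K x x = 0" using gt[OF x] e kernel_diag_nonneg[OF K x] by force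
  qed
  then have "(\<integral>x. K x x \<partial>N) = 0" by (rule integral_eq_zero_AE)
  then show False using Kt t by simp
qed

context pair_prob_space
begin

lemma field_tensor:
  assumes c: "sqint M1 c" and u: "sqint M2 u"
  shows "field M1 M2 (\<lambda>\<omega> x. c \<omega> * u x)"
proof -
  have [measurable]: "c \<in> borel_measurable M1" "u \<in> borel_measurable M2" using c u by (auto simp: sqint_def)
  have "(\<integral>\<^sup>+z. ennreal ((case z of (\<omega>, x) \<Rightarrow> c \<omega> * u x)\<^sup>2) \<partial>(M1 \<Otimes>\<^sub>M M2))
     = (\<integral>\<^sup>+\<omega>. (\<integral>\<^sup>+x. ennreal ((c \<omega>)\<^sup>2) * ennreal ((u x)\<^sup>2) \<partial>M2) \<partial>M1)"
    by (subst M2.nn_integral_fst[symmetric]) (auto simp: power_mult_distrib ennreal_mult)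
  also have "\<dots> = ennreal (ip M1 c c) * ennreal (ip M2 u u)"
    by (simp add: nn_integral_cmult nn_integral_multc nn_integral_sqint[OF c] nn_integral_sqint[OF u])
  also have "\<dots> < \<infinity>" by (simp add: ennreal_mult_less_top)
  finally have "sqint (M1 \<Otimes>\<^sub>M M2) (\<lambda>(\<omega>, x). c \<omega> * u x)" by (auto simp: sqint_iff_nn)
  then show ?thesis using c u by (auto simp: field_def intro: sqint_scale sqint_scale')
qed

text \<open>By Fubini the mean squared norm is also the integral over x of the mean square at x;
  \<open>kernel_select\<close> turns that integral into a choice of point.\<close>

lemma field_integrable:
  assumes "field M1 M2 r"
  shows "integrable M1 (\<lambda>\<omega>. ip M2 (r \<omega>) (r \<omega>))" "integrable M2 (\<lambda>x. ip M1 (\<lambda>\<omega>. r \<omega> x) (\<lambda>\<omega>. r \<omega> x))"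
    "(\<integral>x. ip M1 (\<lambda>\<omega>. r \<omega> x) (\<lambda>\<omega>. r \<omega> x) \<partial>M2) = msq M1 M2 r"
proof -
  have i: "integrable (M1 \<Otimes>\<^sub>M M2) (\<lambda>(\<omega>, x). (r \<omega> x)\<^sup>2)"
    using assms by (auto simp: field_def sqint_def case_prod_unfold)
  show "integrable M1 (\<lambda>\<omega>. ip M2 (r \<omega>) (r \<omega>))" using integrable_fst[OF i] by (simp add: ip_self)
  show "integrable M2 (\<lambda>x. ip M1 (\<lambda>\<omega>. r \<omega> x) (\<lambda>\<omega>. r \<omega> x))" using integrable_snd[OF i] by (simp add: ip_self)
  show "(\<integral>x. ip M1 (\<lambda>\<omega>. r \<omega> x) (\<lambda>\<omega>. r \<omega> x) \<partial>M2) = msq M1 M2 r"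
    using integral_snd[OF i] integral_fst[OF i] by (simp add: ip_self msq_def)
qed

lemma nn_integral_field:
  assumes "field M1 M2 r"
  shows "(\<integral>\<^sup>+\<omega>. (\<integral>\<^sup>+x. ennreal ((r \<omega> x)\<^sup>2) \<partial>M2) \<partial>M1) = ennreal (msq M1 M2 r)"
proof -
  have "(\<integral>\<^sup>+\<omega>. (\<integral>\<^sup>+x. ennreal ((r \<omega> x)\<^sup>2) \<partial>M2) \<partial>M1) = (\<integral>\<^sup>+\<omega>. ennreal (ip M2 (r \<omega>) (r \<omega>)) \<partial>M1)"
    by (intro nn_integral_cong nn_integral_sqint fieldD(1)[OF assms])
  also have "\<dots> = ennreal (msq M1 M2 r)"
    unfolding msq_def by (intro nn_integral_eq_integral field_integrable[OF assms]) simp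
  finally show ?thesis .
qed

text \<open>The factors \<open>1 + 1 / j\<close> for \<open>j = 1, \<dots>, m\<close> telescope to \<open>m + 1\<close>.\<close>

theorem exists_interpolation:
  assumes "kernel M2 K (real m)" "field M1 M2 g" "field M1 M2 p"
    and "\<And>\<omega> y. \<omega> \<in> space M1 \<Longrightarrow> y \<in> space M2 \<Longrightarrow> ip M2 (g \<omega>) (K y) = 0"
    and "\<And>\<omega> y. \<omega> \<in> space M1 \<Longrightarrow> y \<in> space M2 \<Longrightarrow> ip M2 (p \<omega>) (K y) = p \<omega> y"
  shows "\<exists>xs us. (\<forall>i<m. xs i \<in> space M2 \<and> sqint M2 (us i)) \<and>
    msq M1 M2 (\<lambda>\<omega> y. (g \<omega> y + p \<omega> y) - (\<Sum>i<m. (g \<omega> (xs i) + p \<omega> (xs i)) * us i y)) \<le> (real m + 1) * msq M1 M2 g"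
  using assms
proof (induction m arbitrary: K g p)
  case 0
  note K = 0(1) and g = 0(2) and p = 0(3) and rep = 0(5)
  \<comment> \<open>Trace 0 forces the diagonal, and with it every function reproduced by
    \<open>K\<close>, to vanish almost everywhere; no samples remain to be taken.\<close>
  have "AE x in M2. K x x = 0"
  proof -
    have "integrable M2 (\<lambda>x. K x x)" "(\<integral>x. K x x \<partial>M2) = 0"
      using K by (auto simp: kernel_def has_bochner_integral_iff)
    then show ?thesis using kernel_diag_nonneg[OF K] by (subst (asm) integral_nonneg_eq_0_iff_AE) auto
  qed
  then have p0: "AE x in M2. p \<omega> x = 0" if "\<omega> \<in> space M1" for \<omega>
  proof (rule AE_mp, intro AE_I2 impI)
    fix x assume "x \<in> space M2" "K x x = 0"
    then show "p \<omega> x = 0" using kernel_diag_0[OF K, of x "p \<omega>"] rep[OF that] by simp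
  qed
  have "msq M1 M2 (\<lambda>\<omega> y. g \<omega> y + p \<omega> y) = msq M1 M2 g"
    unfolding msq_def
  proof (intro Bochner_Integration.integral_cong refl)
    fix \<omega> assume w: "\<omega> \<in> space M1"
    have e: "AE x in M2. g \<omega> x + p \<omega> x = g \<omega> x" using p0[OF w] by auto
    show "ip M2 (\<lambda>y. g \<omega> y + p \<omega> y) (\<lambda>y. g \<omega> y + p \<omega> y) = ip M2 (g \<omega>) (g \<omega>)"
      by (rule ip_cong_AE[OF e e]) (intro sqint_add fieldD(1)[OF g w] fieldD(1)[OF p w])+
  qed
  then show ?case by simp
next
  case (Suc m)
  note K = Suc.prems(1) and g = Suc.prems(2) and p = Suc.prems(3) and orth = Suc.prems(4) and rep = Suc.prems(5)
  have Ksq: "sqint M2 (K y)" if "y \<in> space M2" for y using K that by (auto simp: kernel_def)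
  have Ksym: "K y z = K z y" if "y \<in> space M2" "z \<in> space M2" for y z using K that by (auto simp: kernel_def)
  have Krep: "ip M2 (K y) (K z) = K y z" if "y \<in> space M2" "z \<in> space M2" for y z using K that by (auto simp: kernel_def)
  obtain x where x: "x \<in> space M2" and pos: "K x x > 0"
    and sel: "ip M1 (\<lambda>\<omega>. g \<omega> x) (\<lambda>\<omega>. g \<omega> x) \<le> msq M1 M2 g / real (Suc m) * K x x"
    using kernel_select[OF K _ field_integrable(2)[OF g]] unfolding field_integrable(3)[OF g] by auto
  \<comment> \<open>The element of V with value 1 at x and least norm; its squared norm is
    \<open>1 / K x x\<close>.\<close>
  define k where "k = (\<lambda>y. (1 / K x x) * K x y)"
  have k: "sqint M2 k" unfolding k_def by (rule sqint_scale[OF Ksq[OF x]])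
  have kr: "ip M2 k u = (1 / K x x) * ip M2 (K x) u" for u unfolding k_def by (rule ip_scale)
  have kK: "ip M2 k (K y) = k y" if "y \<in> space M2" for y
    unfolding kr by (simp add: Krep[OF x that] k_def)
  have kx: "k x = 1" using pos by (simp add: k_def)
  have kk: "ip M2 k k = 1 / K x x"
    using kr[of k] kK[OF x] kx by (simp only: ip_commute[of M2 "K x" k] mult_1_right)
  have Kk: "K y x = K x x * k y" if "y \<in> space M2" for y using pos Ksym[OF that x] by (simp add: k_def)
  \<comment> \<open>Kernel of the functions in V that vanish at x: the rank-one part
    \<open>K x x * k y * k z\<close> is removed, which lowers the trace by
    \<open>K x x * ip M2 k k = 1\<close>.\<close>
  define K' where "K' = (\<lambda>y z. K y z - K y x * k z)"
  have K'sq: "sqint M2 (K' y)" if "y \<in> space M2" for y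
    unfolding K'_def by (intro sqint_diff sqint_scale k Ksq[OF that])
  have ipK': "ip M2 u (K' y) = ip M2 u (K y) - K y x * ip M2 u k" if "sqint M2 u" "y \<in> space M2" for u y
    unfolding K'_def by (simp only: ip_diff_right[OF Ksq[OF that(2)] sqint_scale[OF k] that(1)] ip_scale_right)
  have ker: "kernel M2 K' (real m)"
    unfolding kernel_def
  proof (intro conjI ballI)
    fix y assume y: "y \<in> space M2"
    show "sqint M2 (K' y)" by (rule K'sq[OF y])
    fix z assume z: "z \<in> space M2"
    show "K' y z = K' z y" unfolding K'_def using Ksym[OF y z] Kk[OF y] Kk[OF z] by simp
    have a: "ip M2 (K' y) (K z) = K' y z"
      unfolding K'_def by (simp only: ip_diff[OF Ksq[OF y] sqint_scale[OF k] Ksq[OF z]] ip_scale Krep[OF y z] kK[OF z])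
    have b: "ip M2 (K' y) k = 0"
    proof -
      have "ip M2 (K' y) k = ip M2 (K y) k - K y x * ip M2 k k"
        unfolding K'_def by (simp only: ip_diff[OF Ksq[OF y] sqint_scale[OF k] k] ip_scale)
      also have "ip M2 (K y) k = k y" by (simp add: ip_commute[of M2 "K y"] kK[OF y])
      finally show ?thesis using Kk[OF y] pos by (simp add: kk)
    qed
    show "ip M2 (K' y) (K' z) = K' y z" unfolding ipK'[OF K'sq[OF y] z] a b by simp
  next
    have "has_bochner_integral M2 (\<lambda>y. K y y - K x x * (k y)\<^sup>2) (real (Suc m) - K x x * ip M2 k k)"
      using K k by (intro has_bochner_integral_diff has_bochner_integral_mult_right)
        (auto simp: kernel_def ip_self has_bochner_integral_iff sqint_def)
    then show "has_bochner_integral M2 (\<lambda>y. K' y y) (real m)"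
      unfolding kk using pos
      by (simp cong: has_bochner_integral_cong add: K'_def Kk power2_eq_square mult.assoc)
  qed
  \<comment> \<open>Both parts of f are updated separately: \<open>g'\<close> is orthogonal to the
    smaller space because \<open>g\<close> and \<open>k\<close> are, and \<open>p'\<close> vanishes
    at x and so lies in it.\<close>
  define g' where "g' = (\<lambda>\<omega> y. g \<omega> y - g \<omega> x * k y)"
  define p' where "p' = (\<lambda>\<omega> y. p \<omega> y - p \<omega> x * k y)"
  have g': "field M1 M2 g'" unfolding g'_def by (intro field_diff g field_tensor fieldD(2)[OF g x] k)
  have p': "field M1 M2 p'" unfolding p'_def by (intro field_diff p field_tensor fieldD(2)[OF p x] k)
  have gk: "ip M2 (g \<omega>) k = 0" if "\<omega> \<in> space M1" for \<omega>
    using orth[OF that x] kr[of "g \<omega>"] by (simp add: ip_commute)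
  have pk: "ip M2 (p \<omega>) k = p \<omega> x / K x x" if "\<omega> \<in> space M1" for \<omega>
    using rep[OF that x] kr[of "p \<omega>"] by (simp add: ip_commute)
  have orth': "ip M2 (g' \<omega>) (K' y) = 0" if w: "\<omega> \<in> space M1" and y: "y \<in> space M2" for \<omega> y
  proof -
    note gw = fieldD(1)[OF g w]
    have l: "ip M2 (g' \<omega>) v = ip M2 (g \<omega>) v - g \<omega> x * ip M2 k v" if "sqint M2 v" for v
      unfolding g'_def by (simp only: ip_diff[OF gw sqint_scale[OF k] that] ip_scale)
    show ?thesis unfolding ipK'[OF fieldD(1)[OF g' w] y] l[OF Ksq[OF y]] l[OF k]
      using orth[OF w y] gk[OF w] kK[OF y] Kk[OF y] kk pos by simp
  qed
  have rep': "ip M2 (p' \<omega>) (K' y) = p' \<omega> y" if w: "\<omega> \<in> space M1" and y: "y \<in> space M2" for \<omega> y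
  proof -
    note pw = fieldD(1)[OF p w]
    have l: "ip M2 (p' \<omega>) v = ip M2 (p \<omega>) v - p \<omega> x * ip M2 k v" if "sqint M2 v" for v
      unfolding p'_def by (simp only: ip_diff[OF pw sqint_scale[OF k] that] ip_scale)
    show ?thesis unfolding ipK'[OF fieldD(1)[OF p' w] y] l[OF Ksq[OF y]] l[OF k]
      using rep[OF w y] pk[OF w] kK[OF y] Kk[OF y] kk pos by (simp add: p'_def)
  qed
  obtain xs us where xs: "\<And>i. i < m \<Longrightarrow> xs i \<in> space M2" and us: "\<And>i. i < m \<Longrightarrow> sqint M2 (us i)"
    and IH: "msq M1 M2 (\<lambda>\<omega> y. (g' \<omega> y + p' \<omega> y) - (\<Sum>i<m. (g' \<omega> (xs i) + p' \<omega> (xs i)) * us i y))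
      \<le> (real m + 1) * msq M1 M2 g'"
    using Suc.IH[OF ker g' p' orth' rep'] by blast
  \<comment> \<open>Pythagoras, as \<open>g\<close> is orthogonal to \<open>k\<close>. The choice of
    x bounds the mean of the added term by \<open>msq M1 M2 g / real (Suc m)\<close>.\<close>
  have "msq M1 M2 g' = (\<integral>\<omega>. ip M2 (g \<omega>) (g \<omega>) + (1 / K x x) * (g \<omega> x)\<^sup>2 \<partial>M1)"
    unfolding msq_def
  proof (intro Bochner_Integration.integral_cong refl)
    fix \<omega> assume w: "\<omega> \<in> space M1"
    note gw = fieldD(1)[OF g w]
    have l: "ip M2 (g' \<omega>) v = ip M2 (g \<omega>) v - g \<omega> x * ip M2 k v" if "sqint M2 v" for v
      unfolding g'_def by (simp only: ip_diff[OF gw sqint_scale[OF k] that] ip_scale)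
    show "ip M2 (g' \<omega>) (g' \<omega>) = ip M2 (g \<omega>) (g \<omega>) + (1 / K x x) * (g \<omega> x)\<^sup>2"
      using l[OF fieldD(1)[OF g' w]] l[OF gw] l[OF k] gk[OF w] kk
        ip_commute[of M2 "g \<omega>" "g' \<omega>"] ip_commute[of M2 k "g \<omega>"] ip_commute[of M2 k "g' \<omega>"]
      by (simp add: power2_eq_square)
  qed
  also have "\<dots> = msq M1 M2 g + (1 / K x x) * ip M1 (\<lambda>\<omega>. g \<omega> x) (\<lambda>\<omega>. g \<omega> x)"
    unfolding msq_def ip_self[of M1] using field_integrable(1)[OF g] fieldD(2)[OF g x] by (simp add: sqint_def)
  also have "\<dots> \<le> msq M1 M2 g + (1 / K x x) * (msq M1 M2 g / real (Suc m) * K x x)"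
    using sel pos by (intro add_left_mono mult_left_mono) auto
  also have "\<dots> = msq M1 M2 g * (1 + 1 / (real m + 1))" using pos by (simp add: field_simps)
  finally have "(real m + 1) * msq M1 M2 g' \<le> (real m + 1) * (msq M1 M2 g * (1 + 1 / (real m + 1)))"
    by (intro mult_left_mono) auto
  also have "\<dots> = (real (Suc m) + 1) * msq M1 M2 g" by (simp add: field_simps)
  finally have bound: "(real m + 1) * msq M1 M2 g' \<le> (real (Suc m) + 1) * msq M1 M2 g" .
  define xs' where "xs' = xs(m := x)"
  \<comment> \<open>The later samples see f minus \<open>f x * k\<close>; rewriting them as samples
    of f moves their correction into the coefficient function of x.\<close>
  define us' where "us' = us(m := (\<lambda>y. k y - (\<Sum>i<m. k (xs i) * us i y)))"
  have eq: "(g' \<omega> y + p' \<omega> y) - (\<Sum>i<m. (g' \<omega> (xs i) + p' \<omega> (xs i)) * us i y)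
    = (g \<omega> y + p \<omega> y) - (\<Sum>i<Suc m. (g \<omega> (xs' i) + p \<omega> (xs' i)) * us' i y)" for \<omega> y
    by (simp add: xs'_def us'_def g'_def p'_def algebra_simps sum.distrib sum_subtractf sum_distrib_left)
  have "\<forall>i<Suc m. xs' i \<in> space M2 \<and> sqint M2 (us' i)"
    using xs us x k unfolding xs'_def us'_def
    by (auto simp: less_Suc_eq intro!: sqint_diff sqint_sum sqint_scale)
  moreover have "msq M1 M2 (\<lambda>\<omega> y. (g \<omega> y + p \<omega> y) - (\<Sum>i<Suc m. (g \<omega> (xs' i) + p \<omega> (xs' i)) * us' i y))
     \<le> (real (Suc m) + 1) * msq M1 M2 g"
    using IH bound unfolding eq by linarith
  ultimately show ?case by blast
qed

end

context pair_prob_space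
begin

lemma msq_add_le:
  assumes g: "field M1 M2 g" and p: "field M1 M2 p"
  shows "msq M1 M2 (\<lambda>\<omega> y. g \<omega> y + p \<omega> y) \<le> 2 * msq M1 M2 g + 2 * msq M1 M2 p"
proof -
  have "msq M1 M2 (\<lambda>\<omega> y. g \<omega> y + p \<omega> y) \<le> (\<integral>\<omega>. 2 * ip M2 (g \<omega>) (g \<omega>) + 2 * ip M2 (p \<omega>) (p \<omega>) \<partial>M1)"
    unfolding msq_def
  proof (rule integral_mono)
    fix \<omega> assume w: "\<omega> \<in> space M1"
    note gw = fieldD(1)[OF g w] and pw = fieldD(1)[OF p w]
    have "ip M2 (\<lambda>y. g \<omega> y + p \<omega> y) (\<lambda>y. g \<omega> y + p \<omega> y) \<le> (\<integral>y. 2 * (g \<omega> y)\<^sup>2 + 2 * (p \<omega> y)\<^sup>2 \<partial>M2)"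
      unfolding ip_self
    proof (rule integral_mono)
      fix y show "(g \<omega> y + p \<omega> y)\<^sup>2 \<le> 2 * (g \<omega> y)\<^sup>2 + 2 * (p \<omega> y)\<^sup>2"
        using zero_le_power2[of "g \<omega> y - p \<omega> y"] by (simp add: power2_eq_square algebra_simps)
    qed (use sqint_add[OF gw pw] gw pw in \<open>auto simp: sqint_def\<close>)
    also have "\<dots> = 2 * ip M2 (g \<omega>) (g \<omega>) + 2 * ip M2 (p \<omega>) (p \<omega>)"
      using gw pw by (simp add: ip_self sqint_def)
    finally show "ip M2 (\<lambda>y. g \<omega> y + p \<omega> y) (\<lambda>y. g \<omega> y + p \<omega> y) \<le> 2 * ip M2 (g \<omega>) (g \<omega>) + 2 * ip M2 (p \<omega>) (p \<omega>)" .
  qed (use field_integrable(1)[OF field_add[OF g p]] field_integrable(1)[OF g] field_integrable(1)[OF p] in auto)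
  also have "\<dots> = 2 * msq M1 M2 g + 2 * msq M1 M2 p"
    unfolding msq_def using field_integrable(1)[OF g] field_integrable(1)[OF p] by simp
  finally show ?thesis .
qed

text \<open>Randomised Kaczmarz iteration: the same one-point update, but keeping \<open>K\<close> fixed. Interpolation alone
  does not give errors tending to 0, because \<open>(n + 1) a(n)\<close> need not be a null sequence.\<close>

lemma exists_kaczmarz:
  assumes K: "kernel M2 K (real m)" and m: "m > 0" and g: "field M1 M2 g" and p: "field M1 M2 p"
    and orth: "\<And>\<omega> y. \<omega> \<in> space M1 \<Longrightarrow> y \<in> space M2 \<Longrightarrow> ip M2 (g \<omega>) (K y) = 0"
    and rep: "\<And>\<omega> y. \<omega> \<in> space M1 \<Longrightarrow> y \<in> space M2 \<Longrightarrow> ip M2 (p \<omega>) (K y) = p \<omega> y"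
  shows "\<exists>xs us q. (\<forall>i<(n::nat). xs i \<in> space M2 \<and> sqint M2 (us i)) \<and> field M1 M2 q \<and>
    (\<forall>\<omega>\<in>space M1. \<forall>y\<in>space M2. ip M2 (q \<omega>) (K y) = q \<omega> y) \<and>
    (\<forall>\<omega> y. (g \<omega> y + p \<omega> y) - (\<Sum>i<n. (g \<omega> (xs i) + p \<omega> (xs i)) * us i y) = g \<omega> y + q \<omega> y) \<and>
    msq M1 M2 q \<le> msq M1 M2 g + (1 - 1 / real m) ^ n * msq M1 M2 p"
proof (induction n)
  case 0
  show ?case using p rep msq_nonneg[of M1 M2 g] by (intro exI[of _ "\<lambda>_. undefined"] exI[of _ "\<lambda>_ _. 0"] exI[of _ p]) auto
next
  case (Suc n)
  then obtain xs us q where xs: "\<And>i. i < n \<Longrightarrow> xs i \<in> space M2" and us: "\<And>i. i < n \<Longrightarrow> sqint M2 (us i)"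
    and q: "field M1 M2 q" and qrep: "\<And>\<omega> y. \<omega> \<in> space M1 \<Longrightarrow> y \<in> space M2 \<Longrightarrow> ip M2 (q \<omega>) (K y) = q \<omega> y"
    and eq: "\<And>\<omega> y. (g \<omega> y + p \<omega> y) - (\<Sum>i<n. (g \<omega> (xs i) + p \<omega> (xs i)) * us i y) = g \<omega> y + q \<omega> y"
    and IH: "msq M1 M2 q \<le> msq M1 M2 g + (1 - 1 / real m) ^ n * msq M1 M2 p" by blast
  \<comment> \<open>Up to the factor \<open>1 / K x x\<close>, this is the mean change of the
    squared norm of \<open>q\<close> caused by a step at x. It may be negative, but not where
    \<open>K x x = 0\<close>, since \<open>q\<close> vanishes there.\<close>
  define h where "h = (\<lambda>x. ip M1 (\<lambda>\<omega>. g \<omega> x) (\<lambda>\<omega>. g \<omega> x) - ip M1 (\<lambda>\<omega>. q \<omega> x) (\<lambda>\<omega>. q \<omega> x))"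
  have h: "integrable M2 h" "(\<integral>x. h x \<partial>M2) = msq M1 M2 g - msq M1 M2 q"
    unfolding h_def using field_integrable(2,3)[OF g] field_integrable(2,3)[OF q] by auto
  have h0: "h x \<ge> 0" if x: "x \<in> space M2" and K0: "K x x = 0" for x
  proof -
    have "q \<omega> x = 0" if "\<omega> \<in> space M1" for \<omega>
      using kernel_diag_0[OF K x K0, of "q \<omega>"] qrep[OF that x] by simp
    then have "ip M1 (\<lambda>\<omega>. q \<omega> x) (\<lambda>\<omega>. q \<omega> x) = 0" by (intro ip_eq_0_AE) auto
    then show ?thesis by (simp add: h_def)
  qed
  obtain x where x: "x \<in> space M2" and pos: "K x x > 0"
    and sel: "h x \<le> (msq M1 M2 g - msq M1 M2 q) / real m * K x x"
    using kernel_select[OF K of_nat_0_less_iff[THEN iffD2, OF m] h(1) h0] unfolding h(2) by blast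
  have Kx: "sqint M2 (K x)" using K x by (auto simp: kernel_def)
  define k where "k = (\<lambda>y. (1 / K x x) * K x y)"
  have k: "sqint M2 k" unfolding k_def by (rule sqint_scale[OF Kx])
  have kr: "ip M2 u k = (1 / K x x) * ip M2 u (K x)" for u unfolding k_def by (rule ip_scale_right)
  have kK: "ip M2 k (K y) = k y" if "y \<in> space M2" for y
    unfolding k_def ip_scale using K x that by (simp add: kernel_def)
  have kx: "k x = 1" using pos by (simp add: k_def)
  have kk: "ip M2 k k = 1 / K x x" using kr[of k] kK[OF x] kx by simp
  define r where "r = (\<lambda>\<omega>. g \<omega> x + q \<omega> x)"
  have r: "sqint M1 r" unfolding r_def by (intro sqint_add fieldD(2)[OF g x] fieldD(2)[OF q x])
  \<comment> \<open>The whole correction is charged to \<open>q\<close>, as \<open>k\<close> lies in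
    V; \<open>g\<close> never changes, so the same \<open>K\<close> serves in every step.\<close>
  define q' where "q' = (\<lambda>\<omega> y. q \<omega> y - r \<omega> * k y)"
  have q': "field M1 M2 q'" unfolding q'_def by (intro field_diff q field_tensor r k)
  have l: "ip M2 (q' \<omega>) v = ip M2 (q \<omega>) v - r \<omega> * ip M2 k v" if "\<omega> \<in> space M1" "sqint M2 v" for \<omega> v
    unfolding q'_def by (simp only: ip_diff[OF fieldD(1)[OF q that(1)] sqint_scale[OF k] that(2)] ip_scale)
  have rep': "ip M2 (q' \<omega>) (K y) = q' \<omega> y" if w: "\<omega> \<in> space M1" and y: "y \<in> space M2" for \<omega> y
  proof -
    have "sqint M2 (K y)" using K y by (auto simp: kernel_def)
    from l[OF w this] show ?thesis using qrep[OF w y] kK[OF y] by (simp add: q'_def)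
  qed
  have "msq M1 M2 q' = (\<integral>\<omega>. ip M2 (q \<omega>) (q \<omega>) + (1 / K x x) * ((g \<omega> x)\<^sup>2 - (q \<omega> x)\<^sup>2) \<partial>M1)"
    unfolding msq_def
  proof (intro Bochner_Integration.integral_cong refl)
    fix \<omega> assume w: "\<omega> \<in> space M1"
    have qk: "ip M2 (q \<omega>) k = q \<omega> x / K x x" using kr[of "q \<omega>"] qrep[OF w x] by simp
    have "ip M2 (q' \<omega>) (q' \<omega>) = ip M2 (q \<omega>) (q \<omega>) - 2 * r \<omega> * (q \<omega> x / K x x) + r \<omega> * r \<omega> * (1 / K x x)"
      using l[OF w fieldD(1)[OF q' w]] l[OF w fieldD(1)[OF q w]] l[OF w k] qk kk
        ip_commute[of M2 "q \<omega>" "q' \<omega>"] ip_commute[of M2 k "q \<omega>"] ip_commute[of M2 k "q' \<omega>"]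
      by (simp add: algebra_simps)
    also have "\<dots> = ip M2 (q \<omega>) (q \<omega>) + (1 / K x x) * (r \<omega> * r \<omega> - 2 * r \<omega> * q \<omega> x)"
      using pos by (simp add: field_simps)
    also have "r \<omega> * r \<omega> - 2 * r \<omega> * q \<omega> x = (g \<omega> x)\<^sup>2 - (q \<omega> x)\<^sup>2"
      by (simp add: r_def power2_eq_square algebra_simps)
    finally show "ip M2 (q' \<omega>) (q' \<omega>) = ip M2 (q \<omega>) (q \<omega>) + (1 / K x x) * ((g \<omega> x)\<^sup>2 - (q \<omega> x)\<^sup>2)" .
  qed
  also have "\<dots> = msq M1 M2 q + (1 / K x x) * h x"
    unfolding msq_def h_def ip_self[of M1]
    using field_integrable(1)[OF q] fieldD(2)[OF g x] fieldD(2)[OF q x] by (simp add: sqint_def)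
  also have "\<dots> \<le> msq M1 M2 q + (1 / K x x) * ((msq M1 M2 g - msq M1 M2 q) / real m * K x x)"
    using sel pos by (intro add_left_mono mult_left_mono) auto
  also have "\<dots> = (1 - 1 / real m) * msq M1 M2 q + msq M1 M2 g / real m"
    using pos by (simp add: diff_divide_distrib left_diff_distrib)
  \<comment> \<open>The recursion has fixed point \<open>msq M1 M2 g\<close> and contracts towards
    it with ratio \<open>1 - 1 / real m\<close>.\<close>
  also have "\<dots> \<le> (1 - 1 / real m) * (msq M1 M2 g + (1 - 1 / real m) ^ n * msq M1 M2 p) + msq M1 M2 g / real m"
    using m by (intro add_right_mono mult_left_mono IH) auto
  also have "\<dots> = msq M1 M2 g + (1 - 1 / real m) ^ Suc n * msq M1 M2 p"
    using m by (simp add: field_simps)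
  finally have bound: "msq M1 M2 q' \<le> msq M1 M2 g + (1 - 1 / real m) ^ Suc n * msq M1 M2 p" .
  define xs' where "xs' = xs(n := x)"
  \<comment> \<open>Here the new sample is taken of the current residual, so each old coefficient
    function is corrected by its value at x; in \<open>exists_interpolation\<close> the new point
    comes first instead.\<close>
  define us' where "us' = (\<lambda>i. if i = n then k else (\<lambda>y. us i y - us i x * k y))"
  have eq': "(g \<omega> y + p \<omega> y) - (\<Sum>i<Suc n. (g \<omega> (xs' i) + p \<omega> (xs' i)) * us' i y) = g \<omega> y + q' \<omega> y" for \<omega> y
  proof -
    have "(\<Sum>i<Suc n. (g \<omega> (xs' i) + p \<omega> (xs' i)) * us' i y)
      = (\<Sum>i<n. (g \<omega> (xs i) + p \<omega> (xs i)) * us i y)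
        + ((g \<omega> x + p \<omega> x) - (\<Sum>i<n. (g \<omega> (xs i) + p \<omega> (xs i)) * us i x)) * k y"
      by (simp add: xs'_def us'_def algebra_simps sum.distrib sum_subtractf sum_distrib_left)
    then show ?thesis using eq[of \<omega> y] unfolding eq[of \<omega> x] by (simp add: q'_def r_def)
  qed
  have "\<forall>i<Suc n. xs' i \<in> space M2 \<and> sqint M2 (us' i)"
    using xs us x k unfolding xs'_def us'_def
    by (auto simp: less_Suc_eq intro!: sqint_diff sqint_scale)
  then show ?case using q' rep' eq' bound by blast
qed

end

section \<open>Projections and their kernels\<close>

lemma kernel_orthonormal:
  assumes o: "orthonormal N m \<eta>"
  shows "kernel N (\<lambda>x y. \<Sum>i<m. \<eta> i x * \<eta> i y) (real m)"
proof -
  have \<eta>: "\<And>i. i < m \<Longrightarrow> sqint N (\<eta> i)" using o by (auto simp: orthonormal_def)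
  have "has_bochner_integral N (\<lambda>x. \<Sum>i<m. \<eta> i x * \<eta> i x) (\<Sum>i<m. ip N (\<eta> i) (\<eta> i))"
    using \<eta> by (intro has_bochner_integral_sum) (auto simp: has_bochner_integral_iff ip_def intro: sqint_mult)
  also have "(\<Sum>i<m. ip N (\<eta> i) (\<eta> i)) = real m" using o by (simp add: orthonormal_def)
  finally have t: "has_bochner_integral N (\<lambda>x. \<Sum>i<m. \<eta> i x * \<eta> i x) (real m)" .
  have "ip N (\<lambda>z. \<Sum>i<m. \<eta> i x * \<eta> i z) (\<lambda>z. \<Sum>i<m. \<eta> i y * \<eta> i z) = (\<Sum>i<m. \<eta> i x * \<eta> i y)" for x y
  proof -
    have "ip N (\<lambda>z. \<Sum>i<m. \<eta> i x * \<eta> i z) (\<lambda>z. \<Sum>i<m. \<eta> i y * \<eta> i z)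
      = (\<Sum>i<m. \<eta> i y * ip N (\<lambda>z. \<Sum>i<m. \<eta> i x * \<eta> i z) (\<eta> i))"
      by (rule ip_lincomb_right[OF \<eta> sqint_comb[OF o]])
    also have "\<dots> = (\<Sum>i<m. \<eta> i y * \<eta> i x)"
      by (intro sum.cong refl) (simp add: ip_orthonormal_comb[OF o])
    finally show ?thesis by (simp add: mult.commute)
  qed
  then show ?thesis unfolding kernel_def using sqint_comb[OF o] t by (auto simp: mult.commute)
qed

definition proj :: "'b measure \<Rightarrow> nat \<Rightarrow> (nat \<Rightarrow> 'b \<Rightarrow> real) \<Rightarrow> ('b \<Rightarrow> real) \<Rightarrow> 'b \<Rightarrow> real" where
  "proj N m \<eta> u = (\<lambda>y. \<Sum>i<m. ip N u (\<eta> i) * \<eta> i y)"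

context pair_prob_space
begin

lemma sqint_coeff:
  assumes f: "field M1 M2 f" and u: "sqint M2 u"
  shows "sqint M1 (\<lambda>\<omega>. ip M2 (f \<omega>) u)"
proof -
  have [measurable]: "(\<lambda>(\<omega>, x). f \<omega> x) \<in> borel_measurable (M1 \<Otimes>\<^sub>M M2)" "u \<in> borel_measurable M2"
    using f u by (auto simp: field_def sqint_def)
  have [measurable]: "(\<lambda>\<omega>. ip M2 (f \<omega>) u) \<in> borel_measurable M1" unfolding ip_def by measurable
  have le: "(ip M2 (f \<omega>) u)\<^sup>2 \<le> ip M2 (f \<omega>) (f \<omega>) * ip M2 u u" if "\<omega> \<in> space M1" for \<omega>
    by (rule ip_Cauchy_Schwarz[OF fieldD(1)[OF f that] u])
  have "integrable M1 (\<lambda>\<omega>. (ip M2 (f \<omega>) u)\<^sup>2)"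
  proof (rule Bochner_Integration.integrable_bound)
    show "integrable M1 (\<lambda>\<omega>. ip M2 (f \<omega>) (f \<omega>) * ip M2 u u)" using field_integrable(1)[OF f] by simp
    show "AE \<omega> in M1. norm ((ip M2 (f \<omega>) u)\<^sup>2) \<le> norm (ip M2 (f \<omega>) (f \<omega>) * ip M2 u u)"
      using le by (intro AE_I2) (simp add: abs_mult)
  qed simp
  then show ?thesis by (auto simp: sqint_def)
qed

lemma field_proj:
  assumes f: "field M1 M2 f" and o: "orthonormal M2 m \<eta>"
  shows "field M1 M2 (\<lambda>\<omega>. proj M2 m \<eta> (f \<omega>))"
  unfolding proj_def using o
  by (intro field_sum field_tensor sqint_coeff[OF f]) (auto simp: orthonormal_def)

text \<open>Supplies the reproducing and orthogonality hypotheses of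
  \<open>exists_interpolation\<close> and \<open>exists_kaczmarz\<close>, with the projection as
  \<open>p\<close> and the remainder as \<open>g\<close>.\<close>

lemma ip_proj_kernel:
  assumes o: "orthonormal M2 m \<eta>" and u: "sqint M2 u"
  shows "ip M2 (proj M2 m \<eta> u) (\<lambda>z. \<Sum>i<m. \<eta> i y * \<eta> i z) = proj M2 m \<eta> u y"
    and "ip M2 (\<lambda>x. u x - proj M2 m \<eta> u x) (\<lambda>z. \<Sum>i<m. \<eta> i y * \<eta> i z) = 0"
proof -
  have \<eta>: "\<And>i. i < m \<Longrightarrow> sqint M2 (\<eta> i)" using o by (auto simp: orthonormal_def)
  have pu: "sqint M2 (proj M2 m \<eta> u)" unfolding proj_def by (rule sqint_comb[OF o])
  have "ip M2 (proj M2 m \<eta> u) (\<lambda>z. \<Sum>i<m. \<eta> i y * \<eta> i z) = (\<Sum>i<m. \<eta> i y * ip M2 (proj M2 m \<eta> u) (\<eta> i))"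
    by (rule ip_lincomb_right[OF \<eta> pu])
  also have "\<dots> = (\<Sum>i<m. \<eta> i y * ip M2 u (\<eta> i))"
    by (intro sum.cong refl) (simp add: proj_def ip_orthonormal_comb[OF o])
  finally show 1: "ip M2 (proj M2 m \<eta> u) (\<lambda>z. \<Sum>i<m. \<eta> i y * \<eta> i z) = proj M2 m \<eta> u y"
    by (simp add: proj_def mult.commute)
  have "ip M2 u (\<lambda>z. \<Sum>i<m. \<eta> i y * \<eta> i z) = proj M2 m \<eta> u y"
    using ip_lincomb_right[where c = "\<lambda>i. \<eta> i y", OF \<eta> u] by (simp add: proj_def mult.commute[of "ip M2 u _"])
  then show "ip M2 (\<lambda>x. u x - proj M2 m \<eta> u x) (\<lambda>z. \<Sum>i<m. \<eta> i y * \<eta> i z) = 0"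
    unfolding ip_diff[OF u pu sqint_comb[OF o]] 1 by simp
qed

lemma exists_samples:
  assumes f: "field M1 M2 f" and o: "orthonormal M2 m \<eta>"
  shows "\<exists>xs us. (\<forall>i<m. xs i \<in> space M2 \<and> sqint M2 (us i)) \<and>
    msq M1 M2 (\<lambda>\<omega> y. f \<omega> y - (\<Sum>i<m. f \<omega> (xs i) * us i y))
      \<le> (real m + 1) * msq M1 M2 (\<lambda>\<omega> y. f \<omega> y - proj M2 m \<eta> (f \<omega>) y)"
  using exists_interpolation[OF kernel_orthonormal[OF o] field_diff[OF f field_proj[OF f o]] field_proj[OF f o]
      ip_proj_kernel(2)[OF o fieldD(1)[OF f]] ip_proj_kernel(1)[OF o fieldD(1)[OF f]]] by simp

text \<open>Only convergence matters here, so \<open>n\<close> is not controlled by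
  \<open>m\<close>. The 4 comes from splitting the error into two parts with factor 2 each, where
  the second part exceeds the first by at most \<open>e / 2\<close> in mean square.\<close>

lemma exists_many_samples:
  assumes f: "field M1 M2 f" and o: "orthonormal M2 m \<eta>" and e: "e > 0"
  shows "\<exists>(n::nat) xs us. (\<forall>i<n. xs i \<in> space M2 \<and> sqint M2 (us i)) \<and>
    msq M1 M2 (\<lambda>\<omega> y. f \<omega> y - (\<Sum>i<n. f \<omega> (xs i) * us i y))
      \<le> 4 * msq M1 M2 (\<lambda>\<omega> y. f \<omega> y - proj M2 m \<eta> (f \<omega>) y) + e"
proof (cases "m = 0")
  case True
  then show ?thesis
    using e msq_nonneg[of M1 M2 f] by (intro exI[of _ 0] exI[of _ "\<lambda>_. undefined"] exI[of _ "\<lambda>_ _. 0"]) (auto simp: proj_def)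
next
  case False
  then have m: "m > 0" by simp
  let ?p = "\<lambda>\<omega>. proj M2 m \<eta> (f \<omega>)" and ?g = "\<lambda>\<omega> y. f \<omega> y - proj M2 m \<eta> (f \<omega>) y"
  note p = field_proj[OF f o] note g = field_diff[OF f p]
  have "(\<lambda>n. (1 - 1 / real m) ^ n * msq M1 M2 ?p) \<longlonglongrightarrow> 0 * msq M1 M2 ?p"
    using m by (intro tendsto_mult tendsto_const LIMSEQ_power_zero) (auto simp: field_simps)
  then have "eventually (\<lambda>n. (1 - 1 / real m) ^ n * msq M1 M2 ?p < e / 2) sequentially"
    using e by (intro order_tendstoD) auto
  then obtain n where n: "(1 - 1 / real m) ^ n * msq M1 M2 ?p < e / 2" by (auto simp: eventually_sequentially)
  obtain xs us q where xs: "\<forall>i<n. xs i \<in> space M2 \<and> sqint M2 (us i)" and q: "field M1 M2 q"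
    and eq: "\<forall>\<omega> y. (?g \<omega> y + ?p \<omega> y) - (\<Sum>i<n. (?g \<omega> (xs i) + ?p \<omega> (xs i)) * us i y) = ?g \<omega> y + q \<omega> y"
    and le: "msq M1 M2 q \<le> msq M1 M2 ?g + (1 - 1 / real m) ^ n * msq M1 M2 ?p"
    using exists_kaczmarz[OF kernel_orthonormal[OF o] m g p
      ip_proj_kernel(2)[OF o fieldD(1)[OF f]] ip_proj_kernel(1)[OF o fieldD(1)[OF f]], of n] by blast
  have eq: "f \<omega> y - (\<Sum>i<n. f \<omega> (xs i) * us i y) = ?g \<omega> y + q \<omega> y" for \<omega> y using eq by simp
  have "msq M1 M2 (\<lambda>\<omega> y. f \<omega> y - (\<Sum>i<n. f \<omega> (xs i) * us i y)) \<le> 2 * msq M1 M2 ?g + 2 * msq M1 M2 q"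
    unfolding eq by (rule msq_add_le[OF g q])
  also have "\<dots> \<le> 4 * msq M1 M2 ?g + e" using le n by linarith
  finally show ?thesis using xs by blast
qed

end

subsection \<open>Joint laws and linear combinations\<close>

lemma (in prob_space) integrable_bounded:
  fixes f :: "'a \<Rightarrow> real"
  assumes "f \<in> borel_measurable M" "\<And>x. x \<in> space M \<Longrightarrow> \<bar>f x\<bar> \<le> B" shows "integrable M f"
  by (rule integrable_const_bound[of _ B]) (use assms in auto)

text \<open>\<open>V\<close> and \<open>W\<close> act as unnormalised densities. Under them
  \<open>X\<close> and \<open>Y\<close> have the same characteristic function, whose real and
  imaginary parts are the cases \<open>b = 0\<close> and \<open>b = - pi / 2\<close>; this keeps all
  hypotheses real.\<close>

lemma (in prob_space) weighted_Levy_uniqueness: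
  fixes V W X Y :: "'a \<Rightarrow> real"
  assumes [measurable]: "V \<in> borel_measurable M" "W \<in> borel_measurable M"
      "X \<in> borel_measurable M" "Y \<in> borel_measurable M"
    and V: "\<And>x. x \<in> space M \<Longrightarrow> 0 \<le> V x \<and> V x \<le> B" and W: "\<And>x. x \<in> space M \<Longrightarrow> 0 \<le> W x \<and> W x \<le> B"
    and eq: "\<And>t b. expectation (\<lambda>x. V x * cos (t * X x + b)) = expectation (\<lambda>x. W x * cos (t * Y x + b))"
    and A: "A \<in> sets borel"
  shows "expectation (\<lambda>x. V x * indicator A (X x)) = expectation (\<lambda>x. W x * indicator A (Y x))"
proof -
  have Vi: "integrable M V" and Wi: "integrable M W"
    using V W by (auto intro!: integrable_bounded[where B = B])
  define c where "c = expectation V"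
  have c: "c = expectation V" "c = expectation W" using eq[of 0 0] by (auto simp: c_def)
  have c0: "c \<ge> 0" unfolding c(1) using V by (intro integral_nonneg_AE) auto
  show ?thesis
  \<comment> \<open>With total mass 0 there is nothing to normalise; both weights vanish almost
    everywhere.\<close>
  proof (cases "c = 0")
    case True
    have "AE x in M. V x = 0" "AE x in M. W x = 0"
      using integral_nonneg_eq_0_iff_AE[OF Vi] integral_nonneg_eq_0_iff_AE[OF Wi] V W c True by auto
    then have "expectation (\<lambda>x. V x * indicator A (X x)) = 0" "expectation (\<lambda>x. W x * indicator A (Y x)) = 0"
      by (auto intro!: integral_eq_zero_AE)
    then show ?thesis by simp
  next
    case False
    then have cpos: "c > 0" using c0 by simp
    define N where "N = (\<lambda>U Z :: 'a \<Rightarrow> real. distr (density M (\<lambda>x. ennreal (U x / c))) borel Z)"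
    have rd: "real_distribution (N U Z)" if [measurable]: "U \<in> borel_measurable M" "Z \<in> borel_measurable M"
      and U: "\<And>x. x \<in> space M \<Longrightarrow> 0 \<le> U x" and Ui: "integrable M U" and Uc: "expectation U = c" for U Z
    proof -
      have "(\<integral>\<^sup>+x. ennreal (U x / c) \<partial>M) = ennreal (expectation (\<lambda>x. U x / c))"
        using Ui U cpos by (intro nn_integral_eq_integral) auto
      then have "prob_space (density M (\<lambda>x. ennreal (U x / c)))"
        using Uc cpos by (intro prob_spaceI) (simp add: emeasure_density nn_integral_set_ennreal[symmetric] cong: nn_integral_cong)
      then show ?thesis unfolding N_def real_distribution_def real_distribution_axioms_def
        by (auto intro!: prob_space.prob_space_distr)
    qed
    have ch: "char (N U Z) t = Complex (expectation (\<lambda>x. U x * cos (t * Z x + 0)) / c) (expectation (\<lambda>x. U x * cos (t * Z x - pi / 2)) / c)"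
      if [measurable]: "U \<in> borel_measurable M" "Z \<in> borel_measurable M"
      and U: "\<And>x. x \<in> space M \<Longrightarrow> 0 \<le> U x \<and> U x \<le> B" for U Z t
    proof -
      have "char (N U Z) t = (CLINT x|M. (U x / c) *\<^sub>R iexp (t * Z x))"
        unfolding char_def N_def using U cpos by (simp add: integral_distr integral_density)
      also have "\<dots> = (CLINT x|M. complex_of_real (U x * cos (t * Z x + 0) / c) + \<i> * complex_of_real (U x * cos (t * Z x - pi / 2) / c))"
        by (intro Bochner_Integration.integral_cong refl)
          (simp add: exp_Euler cos_of_real sin_of_real cos_diff scaleR_conv_of_real algebra_simps cos_of_real[symmetric] sin_of_real[symmetric] add_divide_distrib)
      also have "\<dots> = complex_of_real (expectation (\<lambda>x. U x * cos (t * Z x + 0)) / c) + \<i> * complex_of_real (expectation (\<lambda>x. U x * cos (t * Z x - pi / 2)) / c)"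
      proof -
        have b: "\<bar>U x * cos y\<bar> \<le> B" if "x \<in> space M" for x y
          using U[OF that] abs_cos_le_one[of y] mult_mono[of "\<bar>U x\<bar>" B "\<bar>cos y\<bar>" 1] by (auto simp: abs_mult)
        have "integrable M (\<lambda>x. U x * cos (t * Z x + 0))" "integrable M (\<lambda>x. U x * cos (t * Z x - pi / 2))"
          by (rule integrable_bounded[where B = B]; use b in simp)+
        then have i: "integrable M (\<lambda>x. U x * cos (t * Z x + 0) / c)" "integrable M (\<lambda>x. U x * cos (t * Z x - pi / 2) / c)" by simp_all
        have cx: "(CLINT x|M. complex_of_real (f x) + \<i> * complex_of_real (g x)) = complex_of_real (expectation f) + \<i> * complex_of_real (expectation g)"
          if "integrable M f" "integrable M g" for f g
          using that by simp
        show ?thesis unfolding cx[OF i] by simp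
      qed
      finally show ?thesis by (simp add: complex_eq_iff)
    qed
    have "char (N V X) = char (N W Y)"
    proof
      fix t
      show "char (N V X) t = char (N W Y) t"
        using eq[of t 0] eq[of t "- pi / 2"] V W by (simp add: ch)
    qed
    then have NN: "N V X = N W Y"
      using V W Vi Wi c by (intro Levy_uniqueness rd) auto
    have int: "integral\<^sup>L (N U Z) (indicator A) = expectation (\<lambda>x. U x * indicator A (Z x)) / c"
      if [measurable]: "U \<in> borel_measurable M" "Z \<in> borel_measurable M"
      and U: "\<And>x. x \<in> space M \<Longrightarrow> 0 \<le> U x" for U Z
    proof -
      have "integral\<^sup>L (N U Z) (indicator A) = expectation (\<lambda>x. (U x / c) * indicator A (Z x))"
        unfolding N_def using U cpos A by (subst integral_distr) (auto simp: integral_density)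
      then show ?thesis by simp
    qed
    show ?thesis using int[of V X] int[of W Y] V W NN cpos by auto
  qed
qed

text \<open>Interpolates between the hypothesis at \<open>k = 0\<close>, where the cosine of a
  linear combination depends on its law only, and the joint law on boxes at \<open>k = n\<close>.
  Each induction step trades one coordinate in the cosine for an indicator.\<close>

lemma (in prob_space) expectation_prod_cos:
  fixes X :: "nat \<Rightarrow> 'a \<Rightarrow> real"
  assumes X[measurable]: "\<And>i. X i \<in> borel_measurable M" and Y[measurable]: "\<And>i. Y i \<in> borel_measurable M"
    and eq: "\<And>s. distr M borel (\<lambda>\<omega>. \<Sum>i<n. s i * X i \<omega>) = distr M borel (\<lambda>\<omega>. \<Sum>i<n. s i * Y i \<omega>)"
    and A: "\<And>i. A i \<in> sets borel" and k: "k \<le> n"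
  shows "expectation (\<lambda>\<omega>. (\<Prod>i<k. indicator (A i) (X i \<omega>)) * cos ((\<Sum>j\<in>{k..<n}. s j * X j \<omega>) + c))
       = expectation (\<lambda>\<omega>. (\<Prod>i<k. indicator (A i) (Y i \<omega>)) * cos ((\<Sum>j\<in>{k..<n}. s j * Y j \<omega>) + c))"
  using k
proof (induction k arbitrary: s c)
  case 0
  have e: "expectation (\<lambda>\<omega>. cos ((\<Sum>j<n. s j * Z j \<omega>) + c)) = (\<integral>x. cos (x + c) \<partial>distr M borel (\<lambda>\<omega>. \<Sum>j<n. s j * Z j \<omega>))"
    if [measurable]: "\<And>i. Z i \<in> borel_measurable M" for Z :: "nat \<Rightarrow> 'a \<Rightarrow> real"
    by (subst integral_distr) auto
  show ?case using e[OF X] e[OF Y] eq[of s] by (simp add: atLeast0LessThan)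
next
  case (Suc k)
  then have IH: "\<And>s c. expectation (\<lambda>\<omega>. (\<Prod>i<k. indicator (A i) (X i \<omega>)) * cos ((\<Sum>j\<in>{k..<n}. s j * X j \<omega>) + c))
       = expectation (\<lambda>\<omega>. (\<Prod>i<k. indicator (A i) (Y i \<omega>)) * cos ((\<Sum>j\<in>{k..<n}. s j * Y j \<omega>) + c))"
    and kn: "k < n" by auto
  have [measurable]: "A i \<in> sets borel" for i by (rule A)
  define I where "I = (\<lambda>(Z :: nat \<Rightarrow> 'a \<Rightarrow> real) \<omega>. (\<Prod>i<k. indicator (A i) (Z i \<omega>)) :: real)"
  define \<theta> where "\<theta> = (\<lambda>(Z :: nat \<Rightarrow> 'a \<Rightarrow> real) \<omega>. (\<Sum>j\<in>{Suc k..<n}. s j * Z j \<omega>))"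
  have I[measurable]: "I Z \<in> borel_measurable M" and \<theta>[measurable]: "\<theta> Z \<in> borel_measurable M"
    if [measurable]: "\<And>i. Z i \<in> borel_measurable M" for Z unfolding I_def \<theta>_def by measurable
  have I01: "0 \<le> I Z \<omega>" "I Z \<omega> \<le> 1" for Z \<omega>
    unfolding I_def by (auto intro!: prod_nonneg prod_le_1 simp: indicator_def)
  have bnd: "\<bar>I Z \<omega> * cos x\<bar> \<le> 1" for Z \<omega> x
    using I01[of Z \<omega>] abs_cos_le_one[of x] mult_mono[of "\<bar>I Z \<omega>\<bar>" 1 "\<bar>cos x\<bar>" 1] by (auto simp: abs_mult)
  \<comment> \<open>Giving the rest of the sum its own factor \<open>r\<close> provides the values
    0, 1 and -1 needed below.\<close>
  have IH1: "expectation (\<lambda>\<omega>. I X \<omega> * cos (t * X k \<omega> + r * \<theta> X \<omega> + b)) = expectation (\<lambda>\<omega>. I Y \<omega> * cos (t * Y k \<omega> + r * \<theta> Y \<omega> + b))" for t r b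
  proof -
    have "(\<Sum>j\<in>{k..<n}. (if j = k then t else r * s j) * Z j \<omega>) = t * Z k \<omega> + r * \<theta> Z \<omega>" for Z \<omega>
      using kn by (simp add: sum.atLeast_Suc_lessThan \<theta>_def sum_distrib_left mult.assoc)
    then show ?thesis using IH[of "\<lambda>j. if j = k then t else r * s j" b] by (simp add: I_def)
  qed
  \<comment> \<open>A cosine is not a weight, but \<open>1 + cos\<close> is nonnegative; the
    instance \<open>a = 0\<close> is subtracted again in \<open>split\<close>.\<close>
  have step: "expectation (\<lambda>\<omega>. (I X \<omega> * (1 + a * cos (\<theta> X \<omega> + c))) * indicator (A k) (X k \<omega>)) = expectation (\<lambda>\<omega>. (I Y \<omega> * (1 + a * cos (\<theta> Y \<omega> + c))) * indicator (A k) (Y k \<omega>))"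
    if a: "a = 0 \<or> a = 1" for a
  proof (rule weighted_Levy_uniqueness[where B = 2])
    have w: "0 \<le> I Z \<omega> * (1 + a * cos (\<theta> Z \<omega> + c)) \<and> I Z \<omega> * (1 + a * cos (\<theta> Z \<omega> + c)) \<le> 2" for Z \<omega>
    proof -
      have "0 \<le> 1 + a * cos (\<theta> Z \<omega> + c)" "1 + a * cos (\<theta> Z \<omega> + c) \<le> 2"
        using a cos_ge_minus_one[of "\<theta> Z \<omega> + c"] cos_le_one[of "\<theta> Z \<omega> + c"] by (elim disjE; simp; linarith?)+
      then show ?thesis using I01[of Z \<omega>] mult_mono[of "I Z \<omega>" 1 "1 + a * cos (\<theta> Z \<omega> + c)" 2] by auto
    qed
    show "0 \<le> I X \<omega> * (1 + a * cos (\<theta> X \<omega> + c)) \<and> I X \<omega> * (1 + a * cos (\<theta> X \<omega> + c)) \<le> 2" for \<omega> by (rule w)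
    show "0 \<le> I Y \<omega> * (1 + a * cos (\<theta> Y \<omega> + c)) \<and> I Y \<omega> * (1 + a * cos (\<theta> Y \<omega> + c)) \<le> 2" for \<omega> by (rule w)
    \<comment> \<open>Product to sum: the weighted cosine is a combination of three terms of the
      form in \<open>IH1\<close>.\<close>
    have ex: "expectation (\<lambda>\<omega>. I Z \<omega> * (1 + a * cos (\<theta> Z \<omega> + c)) * cos (t * Z k \<omega> + b))
      = expectation (\<lambda>\<omega>. I Z \<omega> * cos (t * Z k \<omega> + 0 * \<theta> Z \<omega> + b))
        + a / 2 * expectation (\<lambda>\<omega>. I Z \<omega> * cos (t * Z k \<omega> + 1 * \<theta> Z \<omega> + (b + c)))
        + a / 2 * expectation (\<lambda>\<omega>. I Z \<omega> * cos (t * Z k \<omega> + (-1) * \<theta> Z \<omega> + (b - c)))"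
      if [measurable]: "\<And>i. Z i \<in> borel_measurable M" for Z t b
    proof -
      have i: "integrable M (\<lambda>\<omega>. I Z \<omega> * cos (t * Z k \<omega> + r * \<theta> Z \<omega> + d))" for r d
        by (rule integrable_bounded[where B = 1]) (use bnd in simp_all)
      have p: "I Z \<omega> * (1 + a * cos (\<theta> Z \<omega> + c)) * cos (t * Z k \<omega> + b)
        = I Z \<omega> * cos (t * Z k \<omega> + 0 * \<theta> Z \<omega> + b)
        + a / 2 * (I Z \<omega> * cos (t * Z k \<omega> + 1 * \<theta> Z \<omega> + (b + c)))
        + a / 2 * (I Z \<omega> * cos (t * Z k \<omega> + (-1) * \<theta> Z \<omega> + (b - c)))" for \<omega>
      proof -
        have "cos (\<theta> Z \<omega> + c) * cos (t * Z k \<omega> + b) = (cos (t * Z k \<omega> + 1 * \<theta> Z \<omega> + (b + c)) + cos (t * Z k \<omega> + (-1) * \<theta> Z \<omega> + (b - c))) / 2"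
          unfolding cos_times_cos[of "\<theta> Z \<omega> + c"] cos_minus[of "\<theta> Z \<omega> + c - (t * Z k \<omega> + b)", symmetric]
          by (simp add: algebra_simps)
        moreover have "I Z \<omega> * (1 + a * x) * y = I Z \<omega> * y + a * I Z \<omega> * (x * y)" for x y
          by (simp add: algebra_simps)
        ultimately show ?thesis by (simp add: distrib_left add_divide_distrib mult.assoc)
      qed
      show ?thesis unfolding p using i[of 0 b] i[of 1 "b + c"] i[of "-1" "b - c"] by simp
    qed
    show "expectation (\<lambda>\<omega>. I X \<omega> * (1 + a * cos (\<theta> X \<omega> + c)) * cos (t * X k \<omega> + b)) = expectation (\<lambda>\<omega>. I Y \<omega> * (1 + a * cos (\<theta> Y \<omega> + c)) * cos (t * Y k \<omega> + b))" for t b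
      by (simp only: ex[of X, OF X] ex[of Y, OF Y] IH1)
  qed measurable
  have split: "expectation (\<lambda>\<omega>. (\<Prod>i<Suc k. indicator (A i) (Z i \<omega>)) * cos ((\<Sum>j\<in>{Suc k..<n}. s j * Z j \<omega>) + c))
    = expectation (\<lambda>\<omega>. (I Z \<omega> * (1 + 1 * cos (\<theta> Z \<omega> + c))) * indicator (A k) (Z k \<omega>))
      - expectation (\<lambda>\<omega>. (I Z \<omega> * (1 + 0 * cos (\<theta> Z \<omega> + c))) * indicator (A k) (Z k \<omega>))"
    if [measurable]: "\<And>i. Z i \<in> borel_measurable M" for Z
  proof -
    have b: "\<bar>I Z \<omega> * cos x * indicator (A k) (Z k \<omega>)\<bar> \<le> 1" for \<omega> x
      using bnd[of Z \<omega> x] by (auto simp: indicator_def)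
    have b': "\<bar>I Z \<omega> * indicator (A k) (Z k \<omega>)\<bar> \<le> 1" for \<omega>
      using b[of \<omega> 0] by simp
    have "integrable M (\<lambda>\<omega>. I Z \<omega> * cos (\<theta> Z \<omega> + c) * indicator (A k) (Z k \<omega>))"
      by (rule integrable_bounded[where B = 1]) (use b in simp_all)
    moreover have "integrable M (\<lambda>\<omega>. I Z \<omega> * indicator (A k) (Z k \<omega>))"
      by (rule integrable_bounded[where B = 1]) (use b' in simp_all)
    ultimately show ?thesis by (simp add: I_def \<theta>_def algebra_simps)
  qed
  show ?case unfolding split[OF X] split[OF Y] using step[of 0] step[of 1] by simp
qed

text \<open>Boxes determine the joint law, and their probabilities are the expectations in
  \<open>expectation_prod_cos\<close> at \<open>k = n\<close> with the cosine equal to 1.\<close>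

theorem (in prob_space) Cramer_Wold:
  fixes X Y :: "nat \<Rightarrow> 'a \<Rightarrow> real"
  assumes X[measurable]: "\<And>i. X i \<in> borel_measurable M" and Y[measurable]: "\<And>i. Y i \<in> borel_measurable M"
    and eq: "\<And>s. distr M borel (\<lambda>\<omega>. \<Sum>i<n. s i * X i \<omega>) = distr M borel (\<lambda>\<omega>. \<Sum>i<n. s i * Y i \<omega>)"
  shows "distr M (PiM {..<n} (\<lambda>_. borel)) (\<lambda>\<omega>. \<lambda>i\<in>{..<n}. X i \<omega>) = distr M (PiM {..<n} (\<lambda>_. borel)) (\<lambda>\<omega>. \<lambda>i\<in>{..<n}. Y i \<omega>)"
    (is "?P X = ?P Y")
proof -
  have prob: "prob_space (?P Z)" if [measurable]: "\<And>i. Z i \<in> borel_measurable M" for Z :: "nat \<Rightarrow> 'a \<Rightarrow> real"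
    by (rule prob_space_distr) measurable
  have em: "emeasure (?P Z) (Pi\<^sub>E {..<n} B) = ennreal (expectation (\<lambda>\<omega>. (\<Prod>i<n. indicator (B i) (Z i \<omega>)) * cos ((\<Sum>j\<in>{n..<n}. 0 * Z j \<omega>) + 0)))"
    if Z[measurable]: "\<And>i. Z i \<in> borel_measurable M" and B: "\<And>i. B i \<in> sets borel" for Z :: "nat \<Rightarrow> 'a \<Rightarrow> real" and B
  proof -
    have [measurable]: "B i \<in> sets borel" for i by (rule B)
    have "emeasure (?P Z) (Pi\<^sub>E {..<n} B) = emeasure M ((\<lambda>\<omega>. \<lambda>i\<in>{..<n}. Z i \<omega>) -` Pi\<^sub>E {..<n} B \<inter> space M)"
      by (rule emeasure_distr[OF measurable_restrict[OF Z]]) (auto intro!: sets_PiM_I_finite B)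
    also have "\<dots> = (\<integral>\<^sup>+\<omega>. indicator ((\<lambda>\<omega>. \<lambda>i\<in>{..<n}. Z i \<omega>) -` Pi\<^sub>E {..<n} B \<inter> space M) \<omega> \<partial>M)"
      by (rule nn_integral_indicator[symmetric], rule measurable_sets[OF measurable_restrict[OF Z]])
        (auto intro!: sets_PiM_I_finite B)
    also have "\<dots> = (\<integral>\<^sup>+\<omega>. ennreal (\<Prod>i<n. indicator (B i) (Z i \<omega>)) \<partial>M)"
    proof (intro nn_integral_cong)
      fix \<omega> assume "\<omega> \<in> space M"
      then show "indicator ((\<lambda>\<omega>. \<lambda>i\<in>{..<n}. Z i \<omega>) -` Pi\<^sub>E {..<n} B \<inter> space M) \<omega> = ennreal (\<Prod>i<n. indicator (B i) (Z i \<omega>))"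
      proof (cases "\<forall>i<n. Z i \<omega> \<in> B i")
        case False
        then have z: "(\<Prod>i<n. indicator (B i) (Z i \<omega>)) = (0::real)" by (intro prod_zero) (auto simp: indicator_def)
        show ?thesis unfolding z using False by (auto simp: indicator_def PiE_iff)
      qed (auto simp: indicator_def PiE_iff)
    qed
    also have "\<dots> = ennreal (expectation (\<lambda>\<omega>. \<Prod>i<n. indicator (B i) (Z i \<omega>)))"
    proof (rule nn_integral_eq_integral)
      show "integrable M (\<lambda>\<omega>. \<Prod>i<n. indicator (B i) (Z i \<omega>) :: real)"
        by (rule integrable_bounded[where B = 1])
          (auto intro!: prod_nonneg prod_le_1 simp: abs_prod indicator_def)
      show "AE \<omega> in M. 0 \<le> (\<Prod>i<n. indicator (B i) (Z i \<omega>) :: real)"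
        by (auto intro!: prod_nonneg)
    qed
    finally show ?thesis by simp
  qed
  show ?thesis
  proof (rule measure_eqI_PiM_finite[of "{..<n}" _ "\<lambda>_. borel" _ "\<lambda>_. Pi\<^sub>E {..<n} (\<lambda>_. UNIV)"])
    fix B :: "nat \<Rightarrow> real set" assume B: "\<And>i. i \<in> {..<n} \<Longrightarrow> B i \<in> sets borel"
    define B' where "B' = (\<lambda>i. if i < n then B i else UNIV)"
    have B': "B' i \<in> sets borel" for i using B by (auto simp: B'_def)
    have "Pi\<^sub>E {..<n} B = Pi\<^sub>E {..<n} B'" by (rule PiE_cong) (auto simp: B'_def)
    then show "emeasure (?P X) (Pi\<^sub>E {..<n} B) = emeasure (?P Y) (Pi\<^sub>E {..<n} B)"
      using em[OF X B'] em[OF Y B'] expectation_prod_cos[where s = "\<lambda>_. 0" and c = 0, OF X Y eq B' order_refl] by simp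
  next
    interpret PX: prob_space "?P X" by (rule prob[OF X])
    show "emeasure (?P X) (Pi\<^sub>E {..<n} (\<lambda>_. UNIV)) \<noteq> \<infinity>"
      unfolding infinity_ennreal_def by (rule PX.emeasure_finite)
    show "range (\<lambda>_::nat. Pi\<^sub>E {..<n} (\<lambda>_. UNIV)) \<subseteq> prod_algebra {..<n} (\<lambda>_. borel :: real measure)"
      using prod_algebraI_finite[of "{..<n}" "\<lambda>_. UNIV" "\<lambda>_. borel :: real measure"] by auto
  qed (simp_all add: space_PiM)
qed

subsection \<open>Gaussian variables and fields\<close>

definition gaussian :: "'a measure \<Rightarrow> ('a \<Rightarrow> real) \<Rightarrow> bool" where
  "gaussian M X \<longleftrightarrow> X \<in> borel_measurable M \<and>
     (distr M borel X = return borel 0 \<or> (\<exists>\<sigma>>0. distr M borel X = density lborel (normal_density 0 \<sigma>)))"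

text \<open>\<open>\<sigma> = 0\<close> stands for the point mass, so the second moment determines
  the law in all cases. The fourth moment controls the tails in
  \<open>gaussian_field\<close>.\<close>

lemma (in prob_space) gaussian_moments:
  assumes "gaussian M X"
  obtains \<sigma> where "\<sigma> \<ge> 0" "distr M borel X = (if \<sigma> = 0 then return borel 0 else density lborel (normal_density 0 \<sigma>))"
    "integrable M (\<lambda>x. (X x)\<^sup>2)" "expectation (\<lambda>x. (X x)\<^sup>2) = \<sigma>\<^sup>2"
    "integrable M (\<lambda>x. (X x) ^ 4)" "expectation (\<lambda>x. (X x) ^ 4) = 3 * \<sigma> ^ 4"
proof -
  have X[measurable]: "X \<in> borel_measurable M" using assms by (simp add: gaussian_def)
  consider "distr M borel X = return borel 0" | \<sigma> where "\<sigma> > 0" "distr M borel X = density lborel (normal_density 0 \<sigma>)"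
    using assms by (auto simp: gaussian_def)
  then show ?thesis
  proof cases
    case 1
    have e: "has_bochner_integral M (\<lambda>x. h (X x)) (h 0)" if [measurable]: "h \<in> borel_measurable borel" for h :: "real \<Rightarrow> real"
    proof -
      have "integrable (return borel 0) h" by (subst integrable_iff_bounded) (simp add: nn_integral_return)
      then have "integrable M (\<lambda>x. h (X x))" unfolding 1[symmetric] by (subst (asm) integrable_distr_eq) auto
      moreover have "expectation (\<lambda>x. h (X x)) = h 0"
        using integral_distr[OF X, of h] unfolding 1 by (simp add: integral_return)
      ultimately show ?thesis by (simp add: has_bochner_integral_iff)
    qed
    show ?thesis using that[of 0] 1 e[of "\<lambda>x. x\<^sup>2"] e[of "\<lambda>x. x ^ 4"] by (auto simp: has_bochner_integral_iff)
  next
    case 2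
    have e: "has_bochner_integral M (\<lambda>x. h (X x)) c" if [measurable]: "h \<in> borel_measurable borel"
      and h: "has_bochner_integral lborel (\<lambda>x. normal_density 0 \<sigma> x * h x) c" for h :: "real \<Rightarrow> real" and c
    proof -
      have "has_bochner_integral (distr M borel X) h c"
        unfolding 2 using h by (intro has_bochner_integral_density) (auto simp: normal_density_nonneg)
      then show ?thesis by (auto simp: has_bochner_integral_iff integrable_distr_eq integral_distr)
    qed
    have "has_bochner_integral M (\<lambda>x. (X x)\<^sup>2) (\<sigma>\<^sup>2)"
      using e[of "\<lambda>x. x\<^sup>2"] normal_moment_even[OF 2(1), of 0 1] by simp
    moreover have "fact (2 * 2) / ((2 / \<sigma>\<^sup>2) ^ 2 * fact 2) = 3 * \<sigma> ^ 4"
      using 2(1) by (simp add: fact_numeral power_divide power_mult[symmetric])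
    then have "has_bochner_integral M (\<lambda>x. (X x) ^ 4) (3 * \<sigma> ^ 4)"
      using e[of "\<lambda>x. x ^ 4" "3 * \<sigma> ^ 4"] normal_moment_even[OF 2(1), of 0 2] by simp
    ultimately show ?thesis using that[of \<sigma>] 2 by (auto simp: has_bochner_integral_iff)
  qed
qed

lemma (in prob_space) sqint_gaussian:
  assumes "gaussian M X" shows "sqint M X"
  using assms gaussian_moments[OF assms] by (auto simp: sqint_def gaussian_def)

lemma (in prob_space) gaussian_distr_eq:
  assumes X: "gaussian M X" and Y: "gaussian M Y" and eq: "ip M X X = ip M Y Y"
  shows "distr M borel X = distr M borel Y"
proof -
  obtain a where a: "a \<ge> 0" "distr M borel X = (if a = 0 then return borel 0 else density lborel (normal_density 0 a))"
      "expectation (\<lambda>x. (X x)\<^sup>2) = a\<^sup>2" using gaussian_moments[OF X] by metis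
  obtain b where b: "b \<ge> 0" "distr M borel Y = (if b = 0 then return borel 0 else density lborel (normal_density 0 b))"
      "expectation (\<lambda>x. (Y x)\<^sup>2) = b\<^sup>2" using gaussian_moments[OF Y] by metis
  have "a = b" using eq a(1,3) b(1,3) by (simp add: ip_self)
  then show ?thesis using a b by simp
qed

text \<open>If \<open>R\<close> is uncorrelated with jointly Gaussian \<open>L\<close>, then \<open>(L, R)\<close> and \<open>(L, - R)\<close> have the same law,
  and the parallelogram identity shows that no function of \<open>L\<close>, linear or not, beats the
  linear prediction.\<close>

lemma (in prob_space) gaussian_prediction:
  fixes L :: "nat \<Rightarrow> 'a \<Rightarrow> real" and n :: nat
  assumes gauss: "\<And>t s. gaussian M (\<lambda>\<omega>. (\<Sum>i<n. s i * L i \<omega>) + t * R \<omega>)"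
    and L: "\<And>i. i < n \<Longrightarrow> gaussian M (L i)" and R: "gaussian M R"
    and orth: "\<And>i. i < n \<Longrightarrow> ip M R (L i) = 0"
    and \<psi>[measurable]: "\<psi> \<in> borel_measurable (PiM {..<n} (\<lambda>_. borel))"
  shows "ennreal (ip M R R) \<le> (\<integral>\<^sup>+\<omega>. ennreal (((R \<omega> + (\<Sum>i<n. b i * L i \<omega>)) - \<psi> (\<lambda>i\<in>{..<n}. L i \<omega>))\<^sup>2) \<partial>M)"
proof -
  have sR: "sqint M R" and sL: "\<And>i. i < n \<Longrightarrow> sqint M (L i)" using R L by (auto intro: sqint_gaussian)
  have R[measurable]: "R \<in> borel_measurable M" using sR by (auto simp: sqint_def)
  \<comment> \<open>Coordinate n carries \<open>r * R\<close>, with \<open>r = 1\<close> and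
    \<open>r = -1\<close> to be compared. The zero padding is there because
    \<open>Cramer_Wold\<close> quantifies over all indices.\<close>
  define X where "X = (\<lambda>r i. if i < n then L i else if i = n then (\<lambda>\<omega>. r * R \<omega>) else (\<lambda>_. 0))"
  have X[measurable]: "X r i \<in> borel_measurable M" for r i
    using sL by (auto simp: X_def sqint_def)
  have lin: "(\<Sum>i<Suc n. s i * X r i \<omega>) = (\<Sum>i<n. s i * L i \<omega>) + (s n * r) * R \<omega>" for s r \<omega>
    by (simp add: X_def mult.assoc)
  have "distr M borel (\<lambda>\<omega>. \<Sum>i<Suc n. s i * X 1 i \<omega>) = distr M borel (\<lambda>\<omega>. \<Sum>i<Suc n. s i * X (-1) i \<omega>)" for s
  proof (rule gaussian_distr_eq)
    let ?U = "\<lambda>\<omega>. \<Sum>i<n. s i * L i \<omega>"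
    have sU: "sqint M ?U" by (rule sqint_lincomb[OF sL])
    have UR: "ip M ?U R = 0"
      using ip_lincomb[where c = s, OF sL sR] orth by (simp add: ip_commute[of M "L _"])
    \<comment> \<open>There is no cross term, so replacing t by -t preserves the second moment and
      hence the Gaussian law.\<close>
    have sq: "ip M (\<lambda>\<omega>. ?U \<omega> + t * R \<omega>) (\<lambda>\<omega>. ?U \<omega> + t * R \<omega>) = ip M ?U ?U + t * t * ip M R R" for t
    proof -
      have l: "ip M (\<lambda>\<omega>. ?U \<omega> + t * R \<omega>) v = ip M ?U v + t * ip M R v" if "sqint M v" for v
        by (simp only: ip_add[OF sU sqint_scale[OF sR] that] ip_scale)
      have s: "sqint M (\<lambda>\<omega>. ?U \<omega> + t * R \<omega>)" by (intro sqint_add sU sqint_scale sR)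
      show ?thesis using l[OF s] l[OF sU] l[OF sR] UR
        ip_commute[of M ?U "\<lambda>\<omega>. ?U \<omega> + t * R \<omega>"] ip_commute[of M R "\<lambda>\<omega>. ?U \<omega> + t * R \<omega>"] ip_commute[of M R ?U] by simp
    qed
    show "ip M (\<lambda>\<omega>. \<Sum>i<Suc n. s i * X 1 i \<omega>) (\<lambda>\<omega>. \<Sum>i<Suc n. s i * X 1 i \<omega>)
        = ip M (\<lambda>\<omega>. \<Sum>i<Suc n. s i * X (-1) i \<omega>) (\<lambda>\<omega>. \<Sum>i<Suc n. s i * X (-1) i \<omega>)"
      unfolding lin sq by simp
  qed (unfold lin, rule gauss, rule gauss)
  then have D: "distr M (PiM {..<Suc n} (\<lambda>_. borel)) (\<lambda>\<omega>. \<lambda>i\<in>{..<Suc n}. X 1 i \<omega>)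
      = distr M (PiM {..<Suc n} (\<lambda>_. borel)) (\<lambda>\<omega>. \<lambda>i\<in>{..<Suc n}. X (-1) i \<omega>)"
    by (intro Cramer_Wold) auto
  \<comment> \<open>The squared error read off the joint vector, coordinate n being the
    residual.\<close>
  define H where "H = (\<lambda>y :: nat \<Rightarrow> real. ennreal ((y n + ((\<Sum>i<n. b i * y i) - \<psi> (restrict y {..<n})))\<^sup>2))"
  have [measurable]: "(\<lambda>y. restrict y {..<n}) \<in> measurable (PiM {..<Suc n} (\<lambda>_. borel :: real measure)) (PiM {..<n} (\<lambda>_. borel))"
    by (rule measurable_restrict_subset) auto
  have [measurable]: "H \<in> borel_measurable (PiM {..<Suc n} (\<lambda>_. borel))" unfolding H_def by measurable
  define \<tau> where "\<tau> = (\<lambda>\<omega>. (\<Sum>i<n. b i * L i \<omega>) - \<psi> (\<lambda>i\<in>{..<n}. L i \<omega>))"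
  have HX: "H (\<lambda>i\<in>{..<Suc n}. X r i \<omega>) = ennreal ((r * R \<omega> + \<tau> \<omega>)\<^sup>2)" for r \<omega>
  proof -
    have "restrict (\<lambda>i\<in>{..<Suc n}. X r i \<omega>) {..<n} = (\<lambda>i\<in>{..<n}. L i \<omega>)" by (auto simp: X_def restrict_def)
    then show ?thesis by (simp add: H_def \<tau>_def X_def)
  qed
  have m: "(\<lambda>\<omega>. ennreal ((r * R \<omega> + \<tau> \<omega>)\<^sup>2)) \<in> borel_measurable M" for r
    unfolding HX[symmetric] by measurable
  have "(\<integral>\<^sup>+\<omega>. ennreal ((1 * R \<omega> + \<tau> \<omega>)\<^sup>2) \<partial>M) = (\<integral>\<^sup>+y. H y \<partial>distr M (PiM {..<Suc n} (\<lambda>_. borel)) (\<lambda>\<omega>. \<lambda>i\<in>{..<Suc n}. X 1 i \<omega>))"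
    unfolding HX[symmetric] by (rule nn_integral_distr[symmetric]) measurable
  also have "\<dots> = (\<integral>\<^sup>+\<omega>. ennreal (((-1) * R \<omega> + \<tau> \<omega>)\<^sup>2) \<partial>M)"
    unfolding D HX[symmetric] by (rule nn_integral_distr) measurable
  finally have E: "(\<integral>\<^sup>+\<omega>. ennreal ((1 * R \<omega> + \<tau> \<omega>)\<^sup>2) \<partial>M) = (\<integral>\<^sup>+\<omega>. ennreal (((-1) * R \<omega> + \<tau> \<omega>)\<^sup>2) \<partial>M)" .
  have "2 * ennreal (ip M R R) = (\<integral>\<^sup>+\<omega>. 2 * ennreal ((R \<omega>)\<^sup>2) \<partial>M)"
    by (simp add: nn_integral_cmult nn_integral_sqint[OF sR])
  also have "\<dots> \<le> (\<integral>\<^sup>+\<omega>. ennreal ((1 * R \<omega> + \<tau> \<omega>)\<^sup>2) + ennreal (((-1) * R \<omega> + \<tau> \<omega>)\<^sup>2) \<partial>M)"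
  proof (intro nn_integral_mono)
    fix \<omega>
    have "2 * (R \<omega>)\<^sup>2 \<le> (1 * R \<omega> + \<tau> \<omega>)\<^sup>2 + ((-1) * R \<omega> + \<tau> \<omega>)\<^sup>2"
      by (simp add: power2_eq_square algebra_simps)
    then have "ennreal (2 * (R \<omega>)\<^sup>2) \<le> ennreal ((1 * R \<omega> + \<tau> \<omega>)\<^sup>2 + ((-1) * R \<omega> + \<tau> \<omega>)\<^sup>2)"
      by (rule ennreal_leI)
    then show "2 * ennreal ((R \<omega>)\<^sup>2) \<le> ennreal ((1 * R \<omega> + \<tau> \<omega>)\<^sup>2) + ennreal (((-1) * R \<omega> + \<tau> \<omega>)\<^sup>2)"
      by (simp add: ennreal_mult)
  qed
  also have "\<dots> = 2 * (\<integral>\<^sup>+\<omega>. ennreal ((1 * R \<omega> + \<tau> \<omega>)\<^sup>2) \<partial>M)"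
    unfolding nn_integral_add[OF m m] E[symmetric] by (simp add: mult_2)
  finally have "ennreal (ip M R R) \<le> (\<integral>\<^sup>+\<omega>. ennreal ((1 * R \<omega> + \<tau> \<omega>)\<^sup>2) \<partial>M)"
    by (subst (asm) ennreal_mult_le_mult_iff) auto
  then show ?thesis by (simp add: \<tau>_def add_diff_eq)
qed

text \<open>On an event \<open>A\<close> of probability at least \<open>11/12\<close> the norms of the paths are bounded, and since fourth moments are controlled by
  variances, restricting to \<open>A\<close> costs at most half of each variance.\<close>

lemma (in pair_prob_space) gaussian_field:
  assumes meas[measurable]: "(\<lambda>(\<omega>, x). f \<omega> x) \<in> borel_measurable (M1 \<Otimes>\<^sub>M M2)"
    and path: "\<And>\<omega>. \<omega> \<in> space M1 \<Longrightarrow> sqint M2 (f \<omega>)"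
    and gauss: "\<And>x. x \<in> space M2 \<Longrightarrow> gaussian M1 (\<lambda>\<omega>. f \<omega> x)"
  shows "field M1 M2 f"
proof -
  define h where "h = (\<lambda>\<omega>. \<integral>\<^sup>+x. ennreal ((f \<omega> x)\<^sup>2) \<partial>M2)"
  have [measurable]: "h \<in> borel_measurable M1" unfolding h_def by measurable
  have hfin: "h \<omega> < \<infinity>" if "\<omega> \<in> space M1" for \<omega> using path[OF that] by (auto simp: h_def sqint_iff_nn)
  define A where "A = (\<lambda>n. {\<omega> \<in> space M1. h \<omega> \<le> of_nat n})"
  have A[measurable]: "A n \<in> sets M1" for n unfolding A_def by measurable
  have "(\<Union>n. A n) = space M1"
  proof (intro equalityI subsetI)
    fix \<omega> assume w: "\<omega> \<in> space M1"
    obtain n where "h \<omega> < of_nat n" using ennreal_Ex_less_of_nat hfin[OF w] by auto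
    then show "\<omega> \<in> (\<Union>n. A n)" using w by (auto simp: A_def intro: less_imp_le)
  qed (auto simp: A_def)
  moreover have "incseq A" unfolding A_def incseq_def by (auto intro: order_trans)
  ultimately have "(\<lambda>n. M1.prob (A n)) \<longlonglongrightarrow> 1"
    using M1.finite_Lim_measure_incseq[of A] M1.prob_space by (auto simp: image_subset_iff)
  \<comment> \<open>The threshold 1/12 for the complement makes
    \<open>3 * \<sigma>\<^sup>2 * (1 / 12)\<close> a quarter of the variance; the fourth moment term
    supplies another quarter.\<close>
  then have "eventually (\<lambda>n. M1.prob (A n) > 11 / 12) sequentially" by (rule order_tendstoD) simp
  then obtain n where n: "M1.prob (A n) > 11 / 12" by (auto simp: eventually_sequentially)
  define B where "B = space M1 - A n"
  have B[measurable]: "B \<in> sets M1" unfolding B_def by simp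
  have PB: "M1.prob B \<le> 1 / 12" using n unfolding B_def by (subst M1.prob_compl) auto
  have half: "(\<integral>\<^sup>+\<omega>. ennreal ((f \<omega> x)\<^sup>2) \<partial>M1) \<le> 2 * (\<integral>\<^sup>+\<omega>. ennreal ((f \<omega> x)\<^sup>2) * indicator (A n) \<omega> \<partial>M1)"
    if x: "x \<in> space M2" for x
  proof -
    obtain \<sigma> where s0: "\<sigma> \<ge> 0" and i2: "integrable M1 (\<lambda>\<omega>. (f \<omega> x)\<^sup>2)" and s2: "M1.expectation (\<lambda>\<omega>. (f \<omega> x)\<^sup>2) = \<sigma>\<^sup>2"
      and i4: "integrable M1 (\<lambda>\<omega>. (f \<omega> x) ^ 4)" and s4: "M1.expectation (\<lambda>\<omega>. (f \<omega> x) ^ 4) = 3 * \<sigma> ^ 4"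
      using M1.gaussian_moments[OF gauss[OF x]] by metis
    have iA: "integrable M1 (\<lambda>\<omega>. (f \<omega> x)\<^sup>2 * indicator (A n) \<omega>)" and iB: "integrable M1 (\<lambda>\<omega>. (f \<omega> x)\<^sup>2 * indicator B \<omega>)"
      using i2 by (auto intro!: integrable_real_mult_indicator)
    have le: "M1.expectation (\<lambda>\<omega>. (f \<omega> x)\<^sup>2 * indicator B \<omega>) \<le> \<sigma>\<^sup>2 / 2"
    proof (cases "\<sigma> = 0")
      case True
      have "M1.expectation (\<lambda>\<omega>. (f \<omega> x)\<^sup>2 * indicator B \<omega>) \<le> M1.expectation (\<lambda>\<omega>. (f \<omega> x)\<^sup>2)"
        by (rule integral_mono[OF iB i2]) (auto simp: indicator_def)
      then show ?thesis using True s2 by simp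
    next
      case False
      then have s: "\<sigma> > 0" using s0 by simp
      have "M1.expectation (\<lambda>\<omega>. (f \<omega> x)\<^sup>2 * indicator B \<omega>)
        \<le> M1.expectation (\<lambda>\<omega>. (f \<omega> x) ^ 4 / (12 * \<sigma>\<^sup>2) + 3 * \<sigma>\<^sup>2 * indicator B \<omega>)"
      proof (rule integral_mono[OF iB])
        fix \<omega>
        \<comment> \<open>Young's inequality as a square; the constant 6 balances the fourth moment
          \<open>3 * \<sigma> ^ 4\<close> against the probability 1/12.\<close>
        have "0 \<le> (((f \<omega> x)\<^sup>2 - 6 * \<sigma>\<^sup>2)\<^sup>2) / (12 * \<sigma>\<^sup>2)" by simp
        also have "\<dots> = (f \<omega> x) ^ 4 / (12 * \<sigma>\<^sup>2) + 3 * \<sigma>\<^sup>2 - (f \<omega> x)\<^sup>2"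
          using s by (simp add: field_simps power2_eq_square power4_eq_xxxx)
        finally show "(f \<omega> x)\<^sup>2 * indicator B \<omega> \<le> (f \<omega> x) ^ 4 / (12 * \<sigma>\<^sup>2) + 3 * \<sigma>\<^sup>2 * indicator B \<omega>"
          by (auto simp: indicator_def)
      qed (use i4 in \<open>auto simp: less_top[symmetric]\<close>)
      also have "\<dots> = 3 * \<sigma> ^ 4 / (12 * \<sigma>\<^sup>2) + 3 * \<sigma>\<^sup>2 * M1.prob B"
        using i4 s4 by (simp add: less_top[symmetric])
      also have "\<dots> \<le> 3 * \<sigma> ^ 4 / (12 * \<sigma>\<^sup>2) + 3 * \<sigma>\<^sup>2 * (1 / 12)"
        by (intro add_left_mono mult_left_mono PB) auto
      also have "\<dots> = \<sigma>\<^sup>2 / 2" using s by (simp add: field_simps power2_eq_square power4_eq_xxxx)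
      finally show ?thesis .
    qed
    have "\<sigma>\<^sup>2 = M1.expectation (\<lambda>\<omega>. (f \<omega> x)\<^sup>2 * indicator (A n) \<omega> + (f \<omega> x)\<^sup>2 * indicator B \<omega>)"
      unfolding s2[symmetric] by (intro Bochner_Integration.integral_cong) (auto simp: B_def indicator_def)
    also have "\<dots> \<le> M1.expectation (\<lambda>\<omega>. (f \<omega> x)\<^sup>2 * indicator (A n) \<omega>) + \<sigma>\<^sup>2 / 2"
      using iA iB le by simp
    finally have "\<sigma>\<^sup>2 \<le> 2 * M1.expectation (\<lambda>\<omega>. (f \<omega> x)\<^sup>2 * indicator (A n) \<omega>)" by simp
    then have "ennreal (\<sigma>\<^sup>2) \<le> 2 * ennreal (M1.expectation (\<lambda>\<omega>. (f \<omega> x)\<^sup>2 * indicator (A n) \<omega>))"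
      by (subst ennreal_numeral[symmetric], subst ennreal_mult[symmetric]) (auto intro: ennreal_leI)
    moreover have "(\<integral>\<^sup>+\<omega>. ennreal ((f \<omega> x)\<^sup>2) \<partial>M1) = ennreal (\<sigma>\<^sup>2)"
      unfolding s2[symmetric] using i2 by (intro nn_integral_eq_integral) auto
    moreover have "(\<integral>\<^sup>+\<omega>. ennreal ((f \<omega> x)\<^sup>2) * indicator (A n) \<omega> \<partial>M1) = ennreal (M1.expectation (\<lambda>\<omega>. (f \<omega> x)\<^sup>2 * indicator (A n) \<omega>))"
      using nn_integral_eq_integral[OF iA] by (simp add: ennreal_mult ennreal_indicator)
    ultimately show ?thesis by simp
  qed
  \<comment> \<open>As \<open>n\<close> does not depend on x, the bound may be integrated over x;
    after Fubini the inner integral is \<open>h\<close>, which is at most n on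
    \<open>A n\<close>.\<close>
  have "(\<integral>\<^sup>+z. ennreal ((case z of (\<omega>, x) \<Rightarrow> f \<omega> x)\<^sup>2) \<partial>(M1 \<Otimes>\<^sub>M M2)) = (\<integral>\<^sup>+x. (\<integral>\<^sup>+\<omega>. ennreal ((f \<omega> x)\<^sup>2) \<partial>M1) \<partial>M2)"
    by (subst nn_integral_snd[symmetric]) auto
  also have "\<dots> \<le> (\<integral>\<^sup>+x. 2 * (\<integral>\<^sup>+\<omega>. ennreal ((f \<omega> x)\<^sup>2) * indicator (A n) \<omega> \<partial>M1) \<partial>M2)"
    by (intro nn_integral_mono half)
  also have "\<dots> = 2 * (\<integral>\<^sup>+x. (\<integral>\<^sup>+\<omega>. ennreal ((f \<omega> x)\<^sup>2) * indicator (A n) \<omega> \<partial>M1) \<partial>M2)"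
    by (rule nn_integral_cmult) measurable
  also have "(\<integral>\<^sup>+x. (\<integral>\<^sup>+\<omega>. ennreal ((f \<omega> x)\<^sup>2) * indicator (A n) \<omega> \<partial>M1) \<partial>M2)
     = (\<integral>\<^sup>+\<omega>. (\<integral>\<^sup>+x. ennreal ((f \<omega> x)\<^sup>2) * indicator (A n) \<omega> \<partial>M2) \<partial>M1)"
    by (rule Fubini') measurable
  also have "\<dots> = (\<integral>\<^sup>+\<omega>. h \<omega> * indicator (A n) \<omega> \<partial>M1)"
    unfolding h_def by (intro nn_integral_cong nn_integral_multc) measurable
  also have "\<dots> \<le> (\<integral>\<^sup>+\<omega>. of_nat n \<partial>M1)"
    by (intro nn_integral_mono) (auto simp: A_def indicator_def)
  also have "\<dots> = of_nat n" using M1.emeasure_space_1 by simp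
  finally have "(\<integral>\<^sup>+z. ennreal ((case z of (\<omega>, x) \<Rightarrow> f \<omega> x)\<^sup>2) \<partial>(M1 \<Otimes>\<^sub>M M2)) \<le> 2 * of_nat n"
    by (simp add: mult_left_mono)
  also have "\<dots> < \<infinity>" by (simp add: ennreal_mult_less_top of_nat_less_top)
  finally show ?thesis using path M1.sqint_gaussian[OF gauss] by (auto simp: field_def sqint_iff_nn)
qed

subsection \<open>The approximation problem in a fixed dimension\<close>

locale app_dim =
  fixes S :: setting and d :: nat
  assumes app: "app_setting S" and d: "1 \<le> d"
begin

abbreviation "M \<equiv> mu S d"
abbreviation "G \<equiv> Gm S d"
abbreviation "F \<equiv> sp S d"
abbreviation "nm \<equiv> nrm S d"

lemma app_facts:
  shows dom_sets: "dom S d \<in> sets (lebd d)"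
    and dens_meas: "dens S d \<in> borel_measurable (lebd d)"
    and dens_int: "(\<integral>\<^sup>+ x \<in> dom S d. ennreal (dens S d x) \<partial>lebd d) = 1"
    and bfs: "banach_fun_space S d"
    and eval_bounded: "\<And>x. x \<in> dom S d \<Longrightarrow> \<exists>C. \<forall>f\<in>F. \<bar>f x\<bar> \<le> C * nm f"
    and sp_L2: "F \<subseteq> L2set S d"
    and embed: "\<exists>C. \<forall>f\<in>F. gnorm2 S d f \<le> ennreal ((C * nm f)\<^sup>2)"
    and space_M: "space M = F"
    and sets_M: "sets M = sigma_sets F (Collect (Fopen S d))"
    and prob_M: "prob_space M"
    and gauss: "\<And>L. Fdual S d L \<Longrightarrow> distr M borel L = return borel 0 \<or>
         (\<exists>\<sigma>>0. distr M borel L = density lborel (normal_density 0 \<sigma>))"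
  using app d unfolding app_setting_def by blast+

lemma banach_facts:
  shows F_zero: "(\<lambda>x. 0) \<in> F"
    and F_add: "\<And>f g. f \<in> F \<Longrightarrow> g \<in> F \<Longrightarrow> (\<lambda>x. f x + g x) \<in> F"
    and F_scale: "\<And>f c. f \<in> F \<Longrightarrow> (\<lambda>x. c * f x) \<in> F"
    and nm_nonneg: "\<And>f. f \<in> F \<Longrightarrow> 0 \<le> nm f"
    and nm_triangle: "\<And>f g. f \<in> F \<Longrightarrow> g \<in> F \<Longrightarrow> nm (\<lambda>x. f x + g x) \<le> nm f + nm g"
    and separable: "\<exists>Q. countable Q \<and> Q \<subseteq> F \<and> (\<forall>f\<in>F. \<forall>e>0. \<exists>g\<in>Q. nm (\<lambda>x. f x - g x) < e)"
  using bfs unfolding banach_fun_space_def by blast+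

lemma F_diff: "f \<in> F \<Longrightarrow> g \<in> F \<Longrightarrow> (\<lambda>x. f x - g x) \<in> F"
  using F_add[of f "\<lambda>x. (-1) * g x"] F_scale[of g "-1"] by simp

lemma space_G: "space G = dom S d"
  using sets.sets_into_space[OF dom_sets] by (auto simp: Gm_def space_restrict_space)

lemma prob_G: "prob_space G"
proof (rule prob_spaceI)
  have m: "(\<lambda>x. ennreal (dens S d x)) \<in> borel_measurable (restrict_space (lebd d) (dom S d))"
    using dens_meas by (intro measurable_restrict_space1) measurable
  have sp: "space (restrict_space (lebd d) (dom S d)) = dom S d"
    using sets.sets_into_space[OF dom_sets] by (auto simp: space_restrict_space)
  have "emeasure G (space G) = (\<integral>\<^sup>+x. ennreal (dens S d x) * indicator (dom S d) x \<partial>restrict_space (lebd d) (dom S d))"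
    unfolding space_G unfolding Gm_def
    by (rule emeasure_density[OF m]) (metis sp sets.top)
  also have "\<dots> = (\<integral>\<^sup>+x. ennreal (dens S d x) \<partial>restrict_space (lebd d) (dom S d))"
    by (intro nn_integral_cong) (simp add: sp)
  also have "\<dots> = (\<integral>\<^sup>+ x \<in> dom S d. ennreal (dens S d x) \<partial>lebd d)"
    using dom_sets sets.sets_into_space[OF dom_sets]
    by (subst nn_integral_restrict_space) (auto simp: Int_absorb2)
  finally show "emeasure G (space G) = 1" using dens_int by simp
qed

sublocale MG: pair_prob_space M G
  using prob_M prob_G by (simp add: pair_prob_space_def pair_sigma_finite_def prob_space_imp_sigma_finite)

lemma L2set_iff: "g \<in> L2set S d \<longleftrightarrow> sqint G g"
  by (simp add: L2set_def gnorm2_def sqint_iff_nn)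

lemma gnorm2_sqint: "sqint G g \<Longrightarrow> gnorm2 S d g = ennreal (ip G g g)"
  by (simp add: gnorm2_def nn_integral_sqint)

lemma sqint_F: "f \<in> F \<Longrightarrow> sqint G f"
  using sp_L2 L2set_iff by auto

lemma embedE:
  obtains C where "C > 0" "\<And>f. f \<in> F \<Longrightarrow> ip G f f \<le> (C * nm f)\<^sup>2"
proof -
  obtain C where C: "\<And>f. f \<in> F \<Longrightarrow> gnorm2 S d f \<le> ennreal ((C * nm f)\<^sup>2)" using embed by blast
  have "ip G f f \<le> ((\<bar>C\<bar> + 1) * nm f)\<^sup>2" if f: "f \<in> F" for f
  proof -
    have "ip G f f \<le> (C * nm f)\<^sup>2" using C[OF f] by (simp add: gnorm2_sqint[OF sqint_F[OF f]])
    also have "\<dots> = (\<bar>C\<bar> * nm f)\<^sup>2" by (simp add: power_mult_distrib)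
    also have "\<dots> \<le> ((\<bar>C\<bar> + 1) * nm f)\<^sup>2"
      using nm_nonneg[OF f] by (intro power_mono mult_right_mono) auto
    finally show ?thesis .
  qed
  then show ?thesis using that[of "\<bar>C\<bar> + 1"] by force
qed

lemma Fdual_eval: "x \<in> dom S d \<Longrightarrow> Fdual S d (\<lambda>f. f x)"
  using eval_bounded unfolding Fdual_def by auto

lemma Fdual_zero: "Fdual S d (\<lambda>f. 0)"
  unfolding Fdual_def by (auto intro: exI[of _ 0])

lemma Fdual_add:
  assumes "Fdual S d L" "Fdual S d L'" shows "Fdual S d (\<lambda>f. L f + L' f)"
proof -
  obtain C C' where C: "\<And>f. f \<in> F \<Longrightarrow> \<bar>L f\<bar> \<le> C * nm f" "\<And>f. f \<in> F \<Longrightarrow> \<bar>L' f\<bar> \<le> C' * nm f"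
    using assms unfolding Fdual_def by blast
  have "\<bar>L f + L' f\<bar> \<le> (C + C') * nm f" if "f \<in> F" for f
    using C[OF that] by (simp add: distrib_right)
  then have ex: "\<exists>K. \<forall>f\<in>F. \<bar>L f + L' f\<bar> \<le> K * nm f" by blast
  show ?thesis unfolding Fdual_def
    by (intro conjI ex) (use assms in \<open>simp_all add: Fdual_def distrib_left\<close>)
qed

lemma Fdual_scale:
  assumes "Fdual S d L" shows "Fdual S d (\<lambda>f. c * L f)"
proof -
  obtain C where C: "\<And>f. f \<in> F \<Longrightarrow> \<bar>L f\<bar> \<le> C * nm f"
    using assms unfolding Fdual_def by blast
  have "\<bar>c * L f\<bar> \<le> (\<bar>c\<bar> * C) * nm f" if "f \<in> F" for f
    using mult_left_mono[OF C[OF that], of "\<bar>c\<bar>"] by (simp add: abs_mult mult.assoc)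
  then have ex: "\<exists>K. \<forall>f\<in>F. \<bar>c * L f\<bar> \<le> K * nm f" by blast
  show ?thesis unfolding Fdual_def
    by (intro conjI ex) (use assms in \<open>simp_all add: Fdual_def distrib_left\<close>)
qed

lemma Fdual_sum: "(\<And>i. i \<in> I \<Longrightarrow> Fdual S d (L i)) \<Longrightarrow> Fdual S d (\<lambda>f. \<Sum>i\<in>I. L i f)"
  by (induction I rule: infinite_finite_induct) (auto intro: Fdual_add Fdual_zero)

lemma Fdual_diff: "Fdual S d L \<Longrightarrow> Fdual S d L' \<Longrightarrow> Fdual S d (\<lambda>f. L f - L' f)"
  using Fdual_add[OF _ Fdual_scale[of L' "-1"], of L] by simp

text \<open>Makes the L2 coefficients of f Gaussian variables: Cauchy-Schwarz bounds them by the
  norm in G_d, and the embedding bounds that by the norm of F_d.\<close>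

lemma Fdual_ip:
  assumes w: "sqint G w" shows "Fdual S d (\<lambda>f. ip G f w)"
proof -
  obtain C where C: "C > 0" "\<And>f. f \<in> F \<Longrightarrow> ip G f f \<le> (C * nm f)\<^sup>2" using embedE by blast
  have "\<bar>ip G f w\<bar> \<le> (C * sqrt (ip G w w)) * nm f" if f: "f \<in> F" for f
  proof -
    have "(ip G f w)\<^sup>2 \<le> ip G f f * ip G w w" by (rule ip_Cauchy_Schwarz[OF sqint_F[OF f] w])
    also have "\<dots> \<le> (C * nm f)\<^sup>2 * ip G w w" by (intro mult_right_mono C f) simp
    also have "\<dots> = ((C * sqrt (ip G w w)) * nm f)\<^sup>2" by (simp add: power_mult_distrib)
    finally have "\<bar>ip G f w\<bar> \<le> \<bar>(C * sqrt (ip G w w)) * nm f\<bar>" by (simp add: abs_le_square_iff)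
    then show ?thesis using C(1) nm_nonneg[OF f] by (simp add: abs_mult)
  qed
  then have ex: "\<exists>K. \<forall>f\<in>F. \<bar>ip G f w\<bar> \<le> K * nm f" by blast
  show ?thesis unfolding Fdual_def
    by (intro conjI ex ballI allI) (simp_all only: ip_add[OF sqint_F sqint_F w] ip_scale)
qed

text \<open>The law is given; what is left is Borel measurability. A bounded functional is
  continuous, so preimages of open sets are \<open>Fopen\<close> and hence measurable.\<close>

lemma Fdual_gaussian:
  assumes L: "Fdual S d L" shows "gaussian M L"
proof -
  obtain C where C: "\<And>f. f \<in> F \<Longrightarrow> \<bar>L f\<bar> \<le> C * nm f" using L unfolding Fdual_def by blast
  have add: "L (\<lambda>x. f x + g x) = L f + L g" if "f \<in> F" "g \<in> F" for f g
    using L that by (simp add: Fdual_def)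
  have scale: "L (\<lambda>x. c * f x) = c * L f" if "f \<in> F" for c f
    using L that by (simp add: Fdual_def)
  have Ldiff: "L g - L f = L (\<lambda>x. g x - f x)" if "f \<in> F" "g \<in> F" for f g
    using add[OF that(2) F_scale[OF that(1), of "-1"]] scale[OF that(1), of "-1"] by simp
  have "L \<in> borel_measurable M"
  proof (rule borel_measurableI)
    fix T :: "real set" assume T: "open T"
    have "Fopen S d (L -` T \<inter> F)"
      unfolding Fopen_def
    proof (intro conjI ballI)
      fix f assume f: "f \<in> L -` T \<inter> F"
      then obtain e where e: "e > 0" "\<And>y. dist y (L f) < e \<Longrightarrow> y \<in> T" using T unfolding open_dist by blast
      show "\<exists>e>0. \<forall>g\<in>F. nm (\<lambda>x. g x - f x) < e \<longrightarrow> g \<in> L -` T \<inter> F"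
      \<comment> \<open>\<open>\<bar>C\<bar> + 1\<close> instead of C keeps the divisor
        positive.\<close>
      proof (intro exI[of _ "e / (\<bar>C\<bar> + 1)"] conjI ballI impI)
        fix g assume g: "g \<in> F" "nm (\<lambda>x. g x - f x) < e / (\<bar>C\<bar> + 1)"
        have gf: "(\<lambda>x. g x - f x) \<in> F" using F_diff f g by auto
        have "\<bar>L g - L f\<bar> \<le> C * nm (\<lambda>x. g x - f x)" using Ldiff[of f g] C[OF gf] f g by simp
        also have "\<dots> \<le> (\<bar>C\<bar> + 1) * nm (\<lambda>x. g x - f x)" using nm_nonneg[OF gf] by (intro mult_right_mono) auto
        also have "\<dots> < e" using g(2) by (simp add: pos_less_divide_eq mult.commute add_nonneg_pos)
        finally show "g \<in> L -` T \<inter> F" using e(2)[of "L g"] g by (simp add: dist_real_def)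
      qed (use e in \<open>simp add: add_nonneg_pos\<close>)
    qed auto
    then show "L -` T \<inter> space M \<in> sets M" unfolding sets_M space_M by (intro sigma_sets.Basic) simp
  qed
  then show ?thesis using gauss[OF L] by (simp add: gaussian_def)
qed

lemma dense_sequence:
  obtains q where "\<And>k::nat. q k \<in> F" "\<And>f e. f \<in> F \<Longrightarrow> e > 0 \<Longrightarrow> \<exists>k. nm (\<lambda>x. f x - q k x) < e"
proof -
  obtain Q where Q: "countable Q" "Q \<subseteq> F" "\<And>f e. f \<in> F \<Longrightarrow> e > 0 \<Longrightarrow> \<exists>g\<in>Q. nm (\<lambda>x. f x - g x) < e"
    using separable by blast
  have "Q \<noteq> {}" using Q(3)[OF F_zero, of 1] by auto
  then have r: "range (from_nat_into Q) = Q" using Q(1) by (rule range_from_nat_into)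
  show ?thesis
  proof (rule that)
    show "from_nat_into Q k \<in> F" for k using r Q(2) by blast
    fix f and e :: real assume "f \<in> F" "e > 0"
    then obtain g where g: "g \<in> Q" "nm (\<lambda>x. f x - g x) < e" using Q(3) by blast
    then obtain k where "g = from_nat_into Q k" using r by blast
    then show "\<exists>k. nm (\<lambda>x. f x - from_nat_into Q k x) < e" using g(2) by blast
  qed
qed

text \<open>Evaluation is the limit of \<open>q (N j f) x\<close>, where \<open>N j f\<close> is the
  first index in a dense sequence that comes within \<open>1 / (real j + 1)\<close> of f. Each
  approximation is measurable because \<open>N j\<close> takes countably many values, and continuity
  of point evaluation gives the convergence.\<close>

lemma joint_measurable: "(\<lambda>(f, x). f x) \<in> borel_measurable (M \<Otimes>\<^sub>M G)"
proof -
  obtain q where q: "\<And>k::nat. q k \<in> F" and dense: "\<And>f e. f \<in> F \<Longrightarrow> e > 0 \<Longrightarrow> \<exists>k. nm (\<lambda>x. f x - q k x) < e"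
    using dense_sequence by blast
  define N where "N = (\<lambda>(j::nat) f. LEAST k. nm (\<lambda>x. f x - q k x) < 1 / (real j + 1))"
  have "Measurable.pred M (\<lambda>f. nm (\<lambda>x. f x - q k x) < e)" for k e
  proof -
    have "Fopen S d {f \<in> F. nm (\<lambda>x. f x - q k x) < e}"
      unfolding Fopen_def
    proof (intro conjI ballI)
      fix f assume f: "f \<in> {f \<in> F. nm (\<lambda>x. f x - q k x) < e}"
      show "\<exists>e'>0. \<forall>g\<in>F. nm (\<lambda>x. g x - f x) < e' \<longrightarrow> g \<in> {f \<in> F. nm (\<lambda>x. f x - q k x) < e}"
      proof (intro exI[of _ "e - nm (\<lambda>x. f x - q k x)"] conjI ballI impI)
        fix g assume g: "g \<in> F" "nm (\<lambda>x. g x - f x) < e - nm (\<lambda>x. f x - q k x)"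
        have "nm (\<lambda>x. g x - q k x) = nm (\<lambda>x. (g x - f x) + (f x - q k x))" by simp
        also have "\<dots> \<le> nm (\<lambda>x. g x - f x) + nm (\<lambda>x. f x - q k x)"
          using f g by (intro nm_triangle F_diff q) auto
        finally show "g \<in> {f \<in> F. nm (\<lambda>x. f x - q k x) < e}" using g by simp
      qed (use f in simp)
    qed auto
    then have "{f \<in> space M. nm (\<lambda>x. f x - q k x) < e} \<in> sets M"
      unfolding sets_M space_M by (intro sigma_sets.Basic) simp
    then show ?thesis by (simp add: pred_def)
  qed
  then have N[measurable]: "N j \<in> measurable M (count_space UNIV)" for j
    unfolding N_def by (intro measurable_Least)
  have q_meas[measurable]: "q k \<in> borel_measurable G" for k using sqint_F[OF q] by (simp add: sqint_def)
  show ?thesis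
  proof (rule borel_measurable_LIMSEQ_real)
    fix j
    have "(\<lambda>z. (\<lambda>z. q (N j (fst z)) (snd z)) z) \<in> borel_measurable (M \<Otimes>\<^sub>M G)"
      by (rule measurable_compose_countable[where f = "\<lambda>k z. q k (snd z)" and g = "\<lambda>z. N j (fst z)"]) measurable
    then show "(\<lambda>(f, x). q (N j f) x) \<in> borel_measurable (M \<Otimes>\<^sub>M G)" by (simp add: case_prod_unfold)
  next
    fix z assume "z \<in> space (M \<Otimes>\<^sub>M G)"
    then obtain f x where z: "z = (f, x)" and f: "f \<in> F" and x: "x \<in> dom S d"
      by (auto simp: space_pair_measure space_M space_G)
    obtain C where C: "\<And>f. f \<in> F \<Longrightarrow> \<bar>f x\<bar> \<le> C * nm f" using eval_bounded[OF x] by blast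
    have close: "\<bar>q (N j f) x - f x\<bar> \<le> \<bar>C\<bar> * (1 / (real j + 1))" for j
    proof -
      obtain k where "nm (\<lambda>x. f x - q k x) < 1 / (real j + 1)" using dense[OF f, of "1 / (real j + 1)"] by auto
      then have lt: "nm (\<lambda>x. f x - q (N j f) x) < 1 / (real j + 1)" unfolding N_def by (rule LeastI)
      have fq: "(\<lambda>x. f x - q (N j f) x) \<in> F" by (rule F_diff[OF f q])
      have "\<bar>f x - q (N j f) x\<bar> \<le> C * nm (\<lambda>x. f x - q (N j f) x)" using C[OF fq] by simp
      also have "\<dots> \<le> \<bar>C\<bar> * (1 / (real j + 1))" using lt nm_nonneg[OF fq] by (intro mult_mono) auto
      finally show ?thesis by (simp add: abs_minus_commute)
    qed
    have "(\<lambda>j. \<bar>C\<bar> * (1 / (real j + 1))) \<longlonglongrightarrow> \<bar>C\<bar> * 0"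
      using LIMSEQ_inverse_real_of_nat by (intro tendsto_mult tendsto_const) (simp add: inverse_eq_divide add.commute)
    then have lim: "(\<lambda>j. \<bar>C\<bar> * (1 / (real j + 1))) \<longlonglongrightarrow> 0" by simp
    have "(\<lambda>j. q (N j f) x - f x) \<longlonglongrightarrow> 0"
      by (rule Lim_null_comparison[OF always_eventually lim]) (simp only: real_norm_def close simp_thms)
    then show "(\<lambda>j. case z of (f, x) \<Rightarrow> q (N j f) x) \<longlonglongrightarrow> (case z of (f, x) \<Rightarrow> f x)"
      by (simp add: z LIM_zero_iff)
  qed
qed

text \<open>The probability space is F_d itself, each f being its own path. This yields the finite
  mean square of f in G_d on which the later uses of Fubini rest.\<close>

lemma field_id: "field M G (\<lambda>f. f)"
  by (rule MG.gaussian_field)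
    (auto simp: space_M space_G intro: joint_measurable sqint_F Fdual_gaussian Fdual_eval)

end

section \<open>Mean square projections and the lower bound for arbitrary information\<close>

context app_dim
begin

text \<open>Projecting onto the span of the first members of a dense sequence makes the error tend
  to 0 for each f. It is dominated by the squared norm of f, which is integrable by
  \<open>field_id\<close>.\<close>

lemma projections_dense:
  assumes e: "e > 0"
  shows "\<exists>m w. orthonormal G m w \<and> msq M G (\<lambda>f x. f x - proj G m w f x) < e"
proof -
  obtain q where q: "\<And>k::nat. q k \<in> F" and dense: "\<And>f e. f \<in> F \<Longrightarrow> e > 0 \<Longrightarrow> \<exists>k. nm (\<lambda>x. f x - q k x) < e"
    using dense_sequence by blast
  define P where "P = (\<lambda>k m w. orthonormal G m w \<and> (\<forall>i<Suc k. \<exists>c. AE x in G. q i x = (\<Sum>j<m. c j * w j x)))"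
  have "\<exists>m w. P k m w" for k
    using orthonormalise[of "Suc k" G q] sqint_F[OF q] unfolding P_def by blast
  then obtain m w where P: "\<And>k. P k (m k) (w k)" by metis
  then have o: "\<And>k. orthonormal G (m k) (w k)"
    and rep: "\<And>k i. i < Suc k \<Longrightarrow> \<exists>c. AE x in G. q i x = (\<Sum>j<m k. c j * w k j x)" by (auto simp: P_def)
  define D where "D = (\<lambda>k f. ip G (\<lambda>x. f x - proj G (m k) (w k) f x) (\<lambda>x. f x - proj G (m k) (w k) f x))"
  have fld: "field M G (\<lambda>f x. f x - proj G (m k) (w k) f x)" for k
    by (intro field_diff MG.field_proj field_id o)
  have Dq: "D k f \<le> ip G (\<lambda>x. f x - q i x) (\<lambda>x. f x - q i x)" if f: "f \<in> F" and i: "i \<le> k" for k f i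
  proof -
    obtain c where c: "AE x in G. q i x = (\<Sum>j<m k. c j * w k j x)" using rep[of i k] i by auto
    have ae: "AE x in G. f x - q i x = f x - (\<Sum>j<m k. c j * w k j x)" using c by eventually_elim simp
    have "ip G (\<lambda>x. f x - q i x) (\<lambda>x. f x - q i x)
      = ip G (\<lambda>x. f x - (\<Sum>j<m k. c j * w k j x)) (\<lambda>x. f x - (\<Sum>j<m k. c j * w k j x))"
      by (rule ip_cong_AE[OF ae ae]) (intro sqint_diff sqint_F f q sqint_comb[OF o])+
    also have "\<dots> = D k f + (\<Sum>j<m k. (ip G f (w k j) - c j)\<^sup>2)"
      unfolding D_def proj_def ip_diff_comb[OF o sqint_F[OF f]] by simp
    finally show ?thesis using sum_nonneg[of "{..<m k}" "\<lambda>j. (ip G f (w k j) - c j)\<^sup>2"] by simp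
  qed
  have lim: "(\<lambda>k. D k f) \<longlonglongrightarrow> 0" if f: "f \<in> F" for f
  proof (rule LIMSEQ_I)
    fix r :: real assume r: "r > 0"
    obtain C where C: "C > 0" "\<And>f. f \<in> F \<Longrightarrow> ip G f f \<le> (C * nm f)\<^sup>2" using embedE by blast
    obtain i where i: "nm (\<lambda>x. f x - q i x) < sqrt r / C" using dense[OF f, of "sqrt r / C"] r C by auto
    have fq: "(\<lambda>x. f x - q i x) \<in> F" by (rule F_diff[OF f q])
    have "C * nm (\<lambda>x. f x - q i x) < sqrt r" using i C(1) by (simp add: pos_less_divide_eq mult.commute)
    then have "(C * nm (\<lambda>x. f x - q i x))\<^sup>2 < (sqrt r)\<^sup>2"
      using C(1) nm_nonneg[OF fq] by (intro power_strict_mono) auto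
    then have "ip G (\<lambda>x. f x - q i x) (\<lambda>x. f x - q i x) < r" using C(2)[OF fq] r by simp
    then have "norm (D k f - 0) < r" if "k \<ge> i" for k
      using Dq[OF f that] by (simp add: D_def)
    then show "\<exists>no. \<forall>k\<ge>no. norm (D k f - 0) < r" by blast
  qed
  have "(\<lambda>k. \<integral>f. D k f \<partial>M) \<longlonglongrightarrow> (\<integral>f. 0 \<partial>M)"
  proof (rule integral_dominated_convergence)
    show "integrable M (\<lambda>f. ip G f f)" by (rule MG.field_integrable(1)[OF field_id])
    show "D k \<in> borel_measurable M" for k
      using borel_measurable_integrable[OF MG.field_integrable(1)[OF fld]] by (simp add: D_def)
    show "AE f in M. (\<lambda>k. D k f) \<longlonglongrightarrow> 0" using lim by (intro AE_I2) (simp add: space_M)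
    show "AE f in M. norm (D k f) \<le> ip G f f" for k
    proof (rule AE_I2)
      fix f assume "f \<in> space M"
      then have "D k f = ip G f f - (\<Sum>i<m k. (ip G f (w k i))\<^sup>2)"
        unfolding D_def proj_def by (intro ip_diff_proj o sqint_F) (simp add: space_M)
      moreover have "0 \<le> D k f" by (simp add: D_def)
      ultimately show "norm (D k f) \<le> ip G f f"
        using sum_nonneg[of "{..<m k}" "\<lambda>i. (ip G f (w k i))\<^sup>2"] by simp
    qed
  qed simp
  then have "eventually (\<lambda>k. (\<integral>f. D k f \<partial>M) < e) sequentially"
    using e by (intro order_tendstoD) auto
  then obtain k where "(\<integral>f. D k f \<partial>M) < e" by (auto simp: eventually_sequentially)
  then show ?thesis using o[of k] unfolding D_def msq_def by blast
qed

text \<open>\<open>meas_phi\<close> speaks of \<open>L2open\<close> sets only. Pairing with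
  \<open>w\<close> is continuous on G_d, so preimages of open sets are \<open>L2open\<close> and the
  composition is measurable.\<close>

lemma measurable_ip_phi:
  assumes \<phi>: "meas_phi S d n \<phi>" and w: "sqint G w"
  shows "(\<lambda>y. ip G (\<phi> y) w) \<in> borel_measurable (PiM {..<n} (\<lambda>_. borel))"
proof (rule borel_measurableI)
  fix T :: "real set" assume T: "open T"
  define U where "U = {g \<in> L2set S d. ip G g w \<in> T}"
  have "L2open S d U"
    unfolding L2open_def
  proof (intro conjI ballI)
    fix g assume "g \<in> U"
    then have g: "sqint G g" and gT: "ip G g w \<in> T" by (auto simp: U_def L2set_iff)
    obtain e where e: "e > 0" "\<And>y. dist y (ip G g w) < e \<Longrightarrow> y \<in> T" using T gT unfolding open_dist by blast
    define c where "c = ip G w w + 1"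
    have c: "c > 0" unfolding c_def by (simp add: add_nonneg_pos)
    show "\<exists>e>0. \<forall>h\<in>L2set S d. gnorm2 S d (\<lambda>x. h x - g x) < ennreal e \<longrightarrow> h \<in> U"
    proof (intro exI[of _ "e\<^sup>2 / c"] conjI ballI impI)
      fix h assume hL: "h \<in> L2set S d" and lt: "gnorm2 S d (\<lambda>x. h x - g x) < ennreal (e\<^sup>2 / c)"
      then have h: "sqint G h" by (simp add: L2set_iff)
      note hg = sqint_diff[OF h g]
      have "ip G (\<lambda>x. h x - g x) (\<lambda>x. h x - g x) < e\<^sup>2 / c"
        using lt by (simp add: gnorm2_sqint[OF hg] ennreal_less_iff)
      then have "ip G (\<lambda>x. h x - g x) (\<lambda>x. h x - g x) * c < e\<^sup>2" using c by (simp add: pos_less_divide_eq)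
      moreover have "(ip G h w - ip G g w)\<^sup>2 \<le> ip G (\<lambda>x. h x - g x) (\<lambda>x. h x - g x) * ip G w w"
        using ip_Cauchy_Schwarz[OF hg w] by (simp add: ip_diff[OF h g w])
      moreover have "ip G (\<lambda>x. h x - g x) (\<lambda>x. h x - g x) * ip G w w \<le> ip G (\<lambda>x. h x - g x) (\<lambda>x. h x - g x) * c"
        by (intro mult_left_mono) (auto simp: c_def)
      ultimately have "(ip G h w - ip G g w)\<^sup>2 < e\<^sup>2" by linarith
      then have "\<bar>ip G h w - ip G g w\<bar> < e" using e(1) by (intro power2_less_imp_less[of "\<bar>_\<bar>"]) auto
      then show "h \<in> U" using e(2)[of "ip G h w"] hL by (simp add: U_def dist_real_def)
    qed (use e c in simp)
  qed (auto simp: U_def)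
  then have "{y \<in> space (PiM {..<n} (\<lambda>_. borel :: real measure)). \<phi> y \<in> U} \<in> sets (PiM {..<n} (\<lambda>_. borel))"
    using \<phi> by (auto simp: meas_phi_def)
  moreover have "{y \<in> space (PiM {..<n} (\<lambda>_. borel :: real measure)). \<phi> y \<in> U}
     = (\<lambda>y. ip G (\<phi> y) w) -` T \<inter> space (PiM {..<n} (\<lambda>_. borel))"
    using \<phi> by (auto simp: meas_phi_def U_def)
  ultimately show "(\<lambda>y. ip G (\<phi> y) w) -` T \<inter> space (PiM {..<n} (\<lambda>_. borel)) \<in> sets (PiM {..<n} (\<lambda>_. borel))" by simp
qed

text \<open>The coordinates of f along a nearly exhausting system \<open>w\<close> are predicted
  separately. No \<open>\<phi>\<close> beats the linear predictor in any coordinate, and Bessel's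
  inequality adds up the coordinates. The linear predictors together range in a space of dimension
  at most n, and projecting onto it is at least as good as predicting; \<open>e\<close> pays for the
  part of f that \<open>w\<close> misses.\<close>

lemma lower_bound:
  assumes L: "\<And>i. i < n \<Longrightarrow> Fdual S d (L i)" and \<phi>: "meas_phi S d n \<phi>" and e: "e > 0"
  shows "\<exists>m \<eta>. m \<le> n \<and> orthonormal G m \<eta> \<and>
    ennreal (msq M G (\<lambda>f x. f x - proj G m \<eta> f x))
      \<le> (\<integral>\<^sup>+f. gnorm2 S d (\<lambda>x. f x - \<phi> (\<lambda>i\<in>{..<n}. L i f) x) \<partial>M) + ennreal e"
proof -
  obtain N w where o: "orthonormal G N w" and small: "msq M G (\<lambda>f x. f x - proj G N w f x) < e"
    using projections_dense[OF e] by blast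
  have w: "\<And>k. k < N \<Longrightarrow> sqint G (w k)" using o by (auto simp: orthonormal_def)
  define Z where "Z = (\<lambda>k f. ip G f (w k))"
  have Z: "Fdual S d (Z k)" if "k < N" for k unfolding Z_def by (rule Fdual_ip[OF w[OF that]])
  note gs = Fdual_gaussian
  have sL: "sqint M (L i)" if "i < n" for i using MG.M1.sqint_gaussian[OF gs[OF L[OF that]]] .
  \<comment> \<open>Coefficients of the best linear prediction of \<open>Z k\<close> from the
    information, with orthogonality in L2 of M.\<close>
  define B where "B = (\<lambda>k b. \<forall>j<n. ip M (\<lambda>f. Z k f - (\<Sum>i<n. b i * L i f)) (L j) = 0)"
  have "\<exists>b. B k b" if "k < N" for k
    unfolding B_def by (rule normal_equations[OF sL MG.M1.sqint_gaussian[OF gs[OF Z[OF that]]]])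
  then obtain b where "\<And>k. k < N \<Longrightarrow> B k (b k)" by metis
  then have b: "\<And>k j. k < N \<Longrightarrow> j < n \<Longrightarrow> ip M (\<lambda>f. Z k f - (\<Sum>i<n. b k i * L i f)) (L j) = 0"
    by (simp add: B_def)
  define R where "R = (\<lambda>k f. Z k f - (\<Sum>i<n. b k i * L i f))"
  have R: "Fdual S d (R k)" if "k < N" for k
    unfolding R_def using that by (intro Fdual_diff Z Fdual_sum Fdual_scale L) auto
  have sR: "sqint M (R k)" if "k < N" for k using MG.M1.sqint_gaussian[OF gs[OF R[OF that]]] .
  define \<psi> where "\<psi> = (\<lambda>k y. ip G (\<phi> y) (w k))"
  have \<psi>: "\<psi> k \<in> borel_measurable (PiM {..<n} (\<lambda>_. borel))" if "k < N" for k
    unfolding \<psi>_def by (rule measurable_ip_phi[OF \<phi> w[OF that]])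
  let ?Lf = "\<lambda>f. \<lambda>i\<in>{..<n}. L i f"
  have pred: "ennreal (ip M (R k) (R k)) \<le> (\<integral>\<^sup>+f. ennreal ((Z k f - \<psi> k (?Lf f))\<^sup>2) \<partial>M)" if k: "k < N" for k
  proof -
    have "ennreal (ip M (R k) (R k)) \<le> (\<integral>\<^sup>+f. ennreal (((R k f + (\<Sum>i<n. b k i * L i f)) - \<psi> k (?Lf f))\<^sup>2) \<partial>M)"
    proof (rule MG.M1.gaussian_prediction)
      show "gaussian M (\<lambda>f. (\<Sum>i<n. s i * L i f) + t * R k f)" for t s
        by (intro gs Fdual_add Fdual_sum Fdual_scale R[OF k] L) auto
      show "ip M (R k) (L i) = 0" if "i < n" for i unfolding R_def by (rule b[OF k that])
    qed (use gs L R k \<psi> in auto)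
    then show ?thesis by (simp add: R_def)
  qed
  have meas: "(\<lambda>f. ennreal ((Z k f - \<psi> k (?Lf f))\<^sup>2)) \<in> borel_measurable M" if k: "k < N" for k
  proof -
    have [measurable]: "Z k \<in> borel_measurable M" using gs[OF Z[OF k]] by (simp add: gaussian_def)
    have [measurable]: "?Lf \<in> measurable M (PiM {..<n} (\<lambda>_. borel))"
      by (rule measurable_restrict) (use gs[OF L] in \<open>simp add: gaussian_def\<close>)
    note [measurable] = \<psi>[OF k]
    show ?thesis by measurable
  qed
  have "ennreal (\<Sum>k<N. ip M (R k) (R k)) = (\<Sum>k<N. ennreal (ip M (R k) (R k)))"
    by (rule sum_ennreal[symmetric]) simp
  also have "\<dots> \<le> (\<Sum>k<N. \<integral>\<^sup>+f. ennreal ((Z k f - \<psi> k (?Lf f))\<^sup>2) \<partial>M)"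
    by (intro sum_mono pred) simp
  also have "\<dots> = (\<integral>\<^sup>+f. (\<Sum>k<N. ennreal ((Z k f - \<psi> k (?Lf f))\<^sup>2)) \<partial>M)"
    by (rule nn_integral_sum[symmetric]) (use meas in simp)
  also have "\<dots> \<le> (\<integral>\<^sup>+f. gnorm2 S d (\<lambda>x. f x - \<phi> (?Lf f) x) \<partial>M)"
  proof (rule nn_integral_mono)
    fix f assume "f \<in> space M"
    then have f: "sqint G f" by (simp add: space_M sqint_F)
    have p: "sqint G (\<phi> (?Lf f))" using \<phi> by (simp add: meas_phi_def L2set_iff space_PiM)
    have "(\<Sum>k<N. ennreal ((Z k f - \<psi> k (?Lf f))\<^sup>2)) = ennreal (\<Sum>k<N. (ip G (\<lambda>x. f x - \<phi> (?Lf f) x) (w k))\<^sup>2)"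
      by (simp add: sum_ennreal Z_def \<psi>_def ip_diff[OF f p w])
    also have "\<dots> \<le> gnorm2 S d (\<lambda>x. f x - \<phi> (?Lf f) x)"
      unfolding gnorm2_sqint[OF sqint_diff[OF f p]] by (intro ennreal_leI bessel[OF o] sqint_diff f p)
    finally show "(\<Sum>k<N. ennreal ((Z k f - \<psi> k (?Lf f))\<^sup>2)) \<le> gnorm2 S d (\<lambda>x. f x - \<phi> (?Lf f) x)" .
  qed
  finally have RE: "ennreal (\<Sum>k<N. ip M (R k) (R k)) \<le> (\<integral>\<^sup>+f. gnorm2 S d (\<lambda>x. f x - \<phi> (?Lf f) x) \<partial>M)" .
  \<comment> \<open>The linear prediction of f along \<open>w\<close>, regrouped by functional, is
    the sum of \<open>L i f * a i\<close>: it takes values in the span of n functions, however large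
    N is.\<close>
  define a where "a = (\<lambda>i x. \<Sum>k<N. b k i * w k x)"
  have sa: "sqint G (a i)" for i unfolding a_def by (rule sqint_comb[OF o])
  obtain m \<eta> where m: "m \<le> n" and o': "orthonormal G m \<eta>"
    and ex: "\<forall>i<n. \<exists>c. AE x in G. a i x = (\<Sum>j<m. c j * \<eta> j x)"
    using orthonormalise[of n G a] sa by blast
  define P where "P = (\<lambda>i c. AE x in G. a i x = (\<Sum>j<m. c j * \<eta> j x))"
  have "\<exists>c. P i c" if "i < n" for i using ex that unfolding P_def by blast
  then obtain c where "\<And>i. i < n \<Longrightarrow> P i (c i)" by metis
  then have c: "\<And>i. i < n \<Longrightarrow> AE x in G. a i x = (\<Sum>j<m. c i j * \<eta> j x)" by (simp add: P_def)
  have le: "ip G (\<lambda>x. f x - proj G m \<eta> f x) (\<lambda>x. f x - proj G m \<eta> f x)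
      \<le> ip G (\<lambda>x. f x - proj G N w f x) (\<lambda>x. f x - proj G N w f x) + (\<Sum>k<N. (R k f)\<^sup>2)" if "f \<in> F" for f
  proof -
    have f: "sqint G f" using that by (rule sqint_F)
    \<comment> \<open>Coefficients of the linear prediction with respect to \<eta>, those with
      respect to \<open>w\<close> being \<open>t\<close>.\<close>
    define s where "s = (\<lambda>j. \<Sum>i<n. L i f * c i j)"
    define t where "t = (\<lambda>k. \<Sum>i<n. b k i * L i f)"
    have "AE x in G. \<forall>i\<in>{..<n}. a i x = (\<Sum>j<m. c i j * \<eta> j x)"
      by (rule AE_finite_allI) (use c in auto)
    then have ae: "AE x in G. f x - (\<Sum>j<m. s j * \<eta> j x) = f x - (\<Sum>k<N. t k * w k x)"
    proof eventually_elim
      case (elim x)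
      have "(\<Sum>j<m. s j * \<eta> j x) = (\<Sum>j<m. \<Sum>i<n. L i f * (c i j * \<eta> j x))"
        by (simp add: s_def sum_distrib_right mult.assoc)
      also have "\<dots> = (\<Sum>i<n. \<Sum>j<m. L i f * (c i j * \<eta> j x))" by (rule sum.swap)
      also have "\<dots> = (\<Sum>i<n. L i f * a i x)" using elim by (simp add: sum_distrib_left)
      also have "\<dots> = (\<Sum>i<n. \<Sum>k<N. L i f * (b k i * w k x))" by (simp add: a_def sum_distrib_left)
      also have "\<dots> = (\<Sum>k<N. \<Sum>i<n. L i f * (b k i * w k x))" by (rule sum.swap)
      also have "\<dots> = (\<Sum>k<N. t k * w k x)" by (simp add: t_def sum_distrib_right mult.assoc mult.left_commute)
      finally show ?case by simp
    qed
    have "ip G (\<lambda>x. f x - proj G m \<eta> f x) (\<lambda>x. f x - proj G m \<eta> f x)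
      \<le> ip G (\<lambda>x. f x - (\<Sum>j<m. s j * \<eta> j x)) (\<lambda>x. f x - (\<Sum>j<m. s j * \<eta> j x))"
      unfolding proj_def ip_diff_comb[OF o' f] by (simp add: sum_nonneg)
    also have "\<dots> = ip G (\<lambda>x. f x - (\<Sum>k<N. t k * w k x)) (\<lambda>x. f x - (\<Sum>k<N. t k * w k x))"
      by (rule ip_cong_AE[OF ae ae]) (intro sqint_diff f sqint_comb[OF o] sqint_comb[OF o'])+
    also have "\<dots> = ip G (\<lambda>x. f x - proj G N w f x) (\<lambda>x. f x - proj G N w f x) + (\<Sum>k<N. (R k f)\<^sup>2)"
      unfolding proj_def ip_diff_comb[OF o f] by (simp add: R_def Z_def t_def)
    finally show ?thesis .
  qed
  note i1 = MG.field_integrable(1)[OF field_diff[OF field_id MG.field_proj[OF field_id o']]]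
  note i2 = MG.field_integrable(1)[OF field_diff[OF field_id MG.field_proj[OF field_id o]]]
  have i3: "integrable M (\<lambda>f. \<Sum>k<N. (R k f)\<^sup>2)" using sR by (auto simp: sqint_def)
  have "msq M G (\<lambda>f x. f x - proj G m \<eta> f x)
     \<le> (\<integral>f. ip G (\<lambda>x. f x - proj G N w f x) (\<lambda>x. f x - proj G N w f x) + (\<Sum>k<N. (R k f)\<^sup>2) \<partial>M)"
    unfolding msq_def using le i1 i2 i3 by (intro integral_mono) (auto simp: space_M)
  also have "\<dots> = msq M G (\<lambda>f x. f x - proj G N w f x) + (\<Sum>k<N. ip M (R k) (R k))"
    unfolding msq_def ip_self[of M] using i2 i3 sR by (simp add: sqint_def)
  also have "\<dots> \<le> e + (\<Sum>k<N. ip M (R k) (R k))" using small by simp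
  finally have "ennreal (msq M G (\<lambda>f x. f x - proj G m \<eta> f x)) \<le> ennreal (e + (\<Sum>k<N. ip M (R k) (R k)))"
    by (rule ennreal_leI)
  also have "\<dots> = ennreal (\<Sum>k<N. ip M (R k) (R k)) + ennreal e"
    using e by (simp add: ennreal_plus sum_nonneg add.commute)
  also have "\<dots> \<le> (\<integral>\<^sup>+f. gnorm2 S d (\<lambda>x. f x - \<phi> (?Lf f) x) \<partial>M) + ennreal e"
    by (intro add_right_mono RE)
  finally show ?thesis using m o' by blast
qed

end

subsection \<open>Sampling algorithms\<close>

text \<open>Sets open in the maximum distance are countable unions of rational boxes. Openness is
  spelled out because the points are extensional functions on \<open>{..<n}\<close>.\<close>

lemma sets_PiM_open_box:
  fixes V :: "(nat \<Rightarrow> real) set"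
  assumes sub: "V \<subseteq> space (PiM {..<n} (\<lambda>_. borel))"
    and nbh: "\<And>y. y \<in> V \<Longrightarrow> \<exists>r>0. \<forall>y'\<in>space (PiM {..<n} (\<lambda>_. borel :: real measure)). (\<forall>i<n. \<bar>y' i - y i\<bar> < r) \<longrightarrow> y' \<in> V"
  shows "V \<in> sets (PiM {..<n} (\<lambda>_. borel))"
proof -
  define box where "box = (\<lambda>(c :: nat \<Rightarrow> real, r). Pi\<^sub>E {..<n} (\<lambda>i. ball (c i) r))"
  define I where "I = {p \<in> Pi\<^sub>E {..<n} (\<lambda>_. \<rat>) \<times> \<rat>. box p \<subseteq> V}"
  have "countable (Pi\<^sub>E {..<n} (\<lambda>_. \<rat> :: real set) \<times> (\<rat> :: real set))"
    by (intro countable_SIGMA countable_PiE countable_rat) auto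
  then have cI: "countable I" by (rule countable_subset[rotated]) (auto simp: I_def)
  have "V = (\<Union>p\<in>I. box p)"
  proof (intro equalityI subsetI)
    fix y assume y: "y \<in> V"
    then obtain r where r: "r > 0" "\<And>y'. y' \<in> space (PiM {..<n} (\<lambda>_. borel :: real measure)) \<Longrightarrow> (\<And>i. i < n \<Longrightarrow> \<bar>y' i - y i\<bar> < r) \<Longrightarrow> y' \<in> V"
      using nbh by blast
    \<comment> \<open>Radius s and an offset of the rational centre below s together stay below
      r.\<close>
    obtain s where s: "s \<in> \<rat>" "0 < s" "s < r / 2" using Rats_dense_in_real[of 0 "r / 2"] r by auto
    have "\<exists>c\<in>\<rat>. \<bar>c - y i\<bar> < s" for i
    proof -
      obtain c where "c \<in> \<rat>" "y i - s < c" "c < y i + s" using Rats_dense_in_real[of "y i - s" "y i + s"] s by auto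
      then show ?thesis by (intro bexI[of _ c]) (auto simp: abs_less_iff)
    qed
    then obtain c where c: "\<And>i. c i \<in> \<rat>" "\<And>i. \<bar>c i - y i\<bar> < s" by metis
    have ye: "y \<in> Pi\<^sub>E {..<n} (\<lambda>_. UNIV)" using sub y by (auto simp: space_PiM)
    have "y \<in> box (restrict c {..<n}, s)"
      using ye c(2) by (auto simp: box_def PiE_def dist_real_def)
    moreover have "box (restrict c {..<n}, s) \<subseteq> V"
    proof
      fix y' assume y': "y' \<in> box (restrict c {..<n}, s)"
      show "y' \<in> V"
      proof (rule r(2))
        show "y' \<in> space (PiM {..<n} (\<lambda>_. borel))" using y' by (auto simp: box_def space_PiM PiE_def)
        fix i assume i: "i < n"
        have "\<bar>c i - y' i\<bar> < s" using y' i by (auto simp: box_def PiE_def Pi_def dist_real_def)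
        then show "\<bar>y' i - y i\<bar> < r" using c(2)[of i] s(3) by linarith
      qed
    qed
    moreover from this have "(restrict c {..<n}, s) \<in> I" using c(1) s(1) by (auto simp: I_def)
    ultimately show "y \<in> (\<Union>p\<in>I. box p)" by blast
  qed (auto simp: I_def)
  also have "\<dots> \<in> sets (PiM {..<n} (\<lambda>_. borel))"
    by (intro sets.countable_UN' cI) (auto simp: box_def intro!: sets_PiM_I_finite)
  finally show ?thesis .
qed

lemma ensqrt_ennreal: "0 \<le> x \<Longrightarrow> ensqrt (ennreal x) = ennreal (sqrt x)"
  by (simp add: ensqrt_def)

lemma ensqrt_top [simp]: "ensqrt \<top> = \<top>"
  by (simp add: ensqrt_def)

context app_dim
begin

text \<open>A linear map from coefficients to G_d is continuous, so preimages of
  \<open>L2open\<close> sets are open. Allowing \<open>m \<le> n\<close> lets the reconstruction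
  ignore surplus data.\<close>

lemma meas_phi_linear:
  assumes us: "\<And>i. i < m \<Longrightarrow> sqint G (us i)" and mn: "m \<le> n"
  shows "meas_phi S d n (\<lambda>y x. \<Sum>i<m. y i * us i x)"
  unfolding meas_phi_def
proof (intro conjI ballI allI impI)
  let ?P = "PiM {..<n} (\<lambda>_. borel :: real measure)"
  have sq: "sqint G (\<lambda>x. \<Sum>i<m. y i * us i x)" for y by (rule sqint_lincomb[OF us])
  show L: "(\<lambda>x. \<Sum>i<m. y i * us i x) \<in> L2set S d" for y by (simp add: L2set_iff sq)
  fix U assume U: "L2open S d U"
  show "{y \<in> space ?P. (\<lambda>x. \<Sum>i<m. y i * us i x) \<in> U} \<in> sets ?P"
  proof (rule sets_PiM_open_box)
    fix y assume "y \<in> {y \<in> space ?P. (\<lambda>x. \<Sum>i<m. y i * us i x) \<in> U}"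
    then have yU: "(\<lambda>x. \<Sum>i<m. y i * us i x) \<in> U" by simp
    obtain e where e: "e > 0"
      and near: "\<forall>h\<in>L2set S d. gnorm2 S d (\<lambda>x. h x - (\<Sum>i<m. y i * us i x)) < ennreal e \<longrightarrow> h \<in> U"
      using bspec[OF conjunct2[OF U[unfolded L2open_def]] yU] by (elim exE conjE)
    define C where "C = (\<Sum>i<m. ip G (us i) (us i)) + 1"
    have C: "C > 0" unfolding C_def by (intro add_nonneg_pos sum_nonneg) auto
    \<comment> \<open>Chosen so that \<open>(real m + 1) * r\<^sup>2 * C = e\<close>; the extra 1
      covers \<open>m = 0\<close> and makes the final estimate strict.\<close>
    define r where "r = sqrt (e / ((real m + 1) * C))"
    have D: "(real m + 1) * C > 0" using C by (intro mult_pos_pos) auto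
    have r: "r > 0" unfolding r_def using e D by simp
    have "r\<^sup>2 = e / ((real m + 1) * C)" unfolding r_def using e D by (simp add: less_imp_le)
    then have "((real m + 1) * C) * r\<^sup>2 = e" using C by simp
    then have r2: "(real m + 1) * r\<^sup>2 * C = e" by (simp only: mult_ac)
    show "\<exists>r>0. \<forall>y'\<in>space ?P. (\<forall>i<n. \<bar>y' i - y i\<bar> < r) \<longrightarrow> y' \<in> {y \<in> space ?P. (\<lambda>x. \<Sum>i<m. y i * us i x) \<in> U}"
    proof (intro exI[of _ r] conjI ballI impI r)
      fix y' assume y': "y' \<in> space ?P" and close: "\<forall>i<n. \<bar>y' i - y i\<bar> < r"
      define a where "a = (\<lambda>i. y' i - y i)"
      have eq: "(\<Sum>i<m. y' i * us i x) - (\<Sum>i<m. y i * us i x) = (\<Sum>i<m. a i * us i x)" for x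
        by (simp add: a_def left_diff_distrib sum_subtractf)
      have "(\<Sum>i<m. (a i)\<^sup>2) \<le> (\<Sum>i<m. r\<^sup>2)"
      proof (rule sum_mono)
        fix i assume "i \<in> {..<m}"
        then have "\<bar>a i\<bar> \<le> r" using close mn by (auto simp: a_def less_imp_le)
        then show "(a i)\<^sup>2 \<le> r\<^sup>2" using power_mono[of "\<bar>a i\<bar>" r 2] by simp
      qed
      then have a2: "(\<Sum>i<m. (a i)\<^sup>2) \<le> real m * r\<^sup>2" by simp
      have "ip G (\<lambda>x. \<Sum>i<m. a i * us i x) (\<lambda>x. \<Sum>i<m. a i * us i x) \<le> (\<integral>x. (\<Sum>i<m. (a i)\<^sup>2) * (\<Sum>i<m. (us i x)\<^sup>2) \<partial>G)"
        unfolding ip_self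
      proof (rule integral_mono)
        show "integrable G (\<lambda>x. (\<Sum>i<m. a i * us i x)\<^sup>2)" using sq[of a] by (simp add: sqint_def)
        show "integrable G (\<lambda>x. (\<Sum>i<m. (a i)\<^sup>2) * (\<Sum>i<m. (us i x)\<^sup>2))"
          using us by (intro integrable_mult_right Bochner_Integration.integrable_sum) (auto simp: sqint_def)
      qed (rule Cauchy_Schwarz_ineq_sum)
      also have "\<dots> = (\<Sum>i<m. (a i)\<^sup>2) * (\<Sum>i<m. ip G (us i) (us i))"
        unfolding ip_self using us by (simp add: sqint_def)
      also have "\<dots> \<le> (real m * r\<^sup>2) * (\<Sum>i<m. ip G (us i) (us i))"
        by (intro mult_right_mono a2 sum_nonneg) auto
      also have "\<dots> \<le> (real m * r\<^sup>2) * C" by (intro mult_left_mono) (auto simp: C_def)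
      also have "\<dots> < (real m + 1) * r\<^sup>2 * C" using C r by (simp add: distrib_right)
      finally have "ip G (\<lambda>x. \<Sum>i<m. a i * us i x) (\<lambda>x. \<Sum>i<m. a i * us i x) < e" unfolding r2 .
      then have "gnorm2 S d (\<lambda>x. (\<Sum>i<m. y' i * us i x) - (\<Sum>i<m. y i * us i x)) < ennreal e"
        unfolding eq gnorm2_sqint[OF sq] by (simp add: ennreal_less_iff)
      then show "y' \<in> {y \<in> space ?P. (\<lambda>x. \<Sum>i<m. y i * us i x) \<in> U}" using bspec[OF near L] y' by simp
    qed
  qed auto
qed

lemma eavg_std_le:
  assumes xs: "\<And>i. i < m \<Longrightarrow> xs i \<in> dom S d \<and> sqint G (us i)" and mn: "m \<le> n"
  shows "eavg S Lstd n d \<le> ensqrt (ennreal (msq M G (\<lambda>f y. f y - (\<Sum>i<m. f (xs i) * us i y))))"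
proof -
  have us: "\<And>i. i < m \<Longrightarrow> sqint G (us i)" using xs by blast
  let ?A = "\<lambda>f y. \<Sum>i<m. f (xs i) * us i y"
  have fld: "field M G (\<lambda>f y. f y - ?A f y)"
    using xs by (intro field_diff field_id field_sum MG.field_tensor fieldD(2)[OF field_id]) (auto simp: space_G)
  have err: "err_avg S d ?A = ensqrt (ennreal (msq M G (\<lambda>f y. f y - ?A f y)))"
    unfolding err_avg_def gnorm2_def by (simp add: MG.nn_integral_field[OF fld])
  have "?A \<in> algs S Lstd n d"
  proof (cases "n = 0")
    case True
    then show ?thesis using mn by (simp add: algs_def)
  next
    case False
    \<comment> \<open>Surplus functionals evaluate at an arbitrary \<open>x0\<close>, since an
      algorithm in \<open>algs\<close> has exactly n of them.\<close>
    obtain x0 where x0: "x0 \<in> dom S d" using prob_space.not_empty[OF prob_G] by (auto simp: space_G)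
    have "?A = (\<lambda>f. (\<lambda>y x. \<Sum>i<m. y i * us i x) (\<lambda>i\<in>{..<n}. f (if i < m then xs i else x0)))"
      using mn by (intro ext sum.cong) auto
    then show ?thesis using False meas_phi_linear[OF us mn] xs x0
      unfolding algs_def by (auto simp: lam_def intro!: exI[of _ "\<lambda>i f. f (if i < m then xs i else x0)"]
          exI[of _ "\<lambda>y x. \<Sum>i<m. y i * us i x"])
  qed
  then show ?thesis unfolding eavg_def err[symmetric] by (rule INF_lower)
qed

lemma eavg_all_le_std: "eavg S Lall n d \<le> eavg S Lstd n d"
proof -
  have "lam S Lstd d \<subseteq> lam S Lall d" using Fdual_eval by (auto simp: lam_def)
  then have "algs S Lstd n d \<subseteq> algs S Lall n d" unfolding algs_def by auto
  then show ?thesis unfolding eavg_def by (rule INF_superset_mono) simp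
qed

lemma eavg_0: "eavg S Lstd 0 d = eavg S Lall 0 d"
  by (simp add: eavg_def algs_def)

lemma eavg_std_tends_0:
  assumes \<delta>: "\<delta> > 0" shows "\<exists>n. eavg S Lstd n d \<le> ennreal \<delta>"
proof -
  \<comment> \<open>4 times \<open>\<delta>\<^sup>2 / 8\<close> plus
    \<open>\<delta>\<^sup>2 / 2\<close> is \<open>\<delta>\<^sup>2\<close>.\<close>
  obtain m w where o: "orthonormal G m w" and small: "msq M G (\<lambda>f x. f x - proj G m w f x) < \<delta>\<^sup>2 / 8"
    using projections_dense[of "\<delta>\<^sup>2 / 8"] \<delta> by auto
  obtain n :: nat and xs us where xs: "\<forall>i<n. xs i \<in> space G \<and> sqint G (us i)"
    and le: "msq M G (\<lambda>f y. f y - (\<Sum>i<n. f (xs i) * us i y)) \<le> 4 * msq M G (\<lambda>f x. f x - proj G m w f x) + \<delta>\<^sup>2 / 2"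
    using MG.exists_many_samples[OF field_id o, of "\<delta>\<^sup>2 / 2"] \<delta> by auto
  have "eavg S Lstd n d \<le> ensqrt (ennreal (msq M G (\<lambda>f y. f y - (\<Sum>i<n. f (xs i) * us i y))))"
    by (rule eavg_std_le) (use xs in \<open>auto simp: space_G\<close>)
  also have "\<dots> \<le> ennreal \<delta>"
    unfolding ensqrt_ennreal[OF msq_nonneg] using le small \<delta> by (intro ennreal_leI real_le_lsqrt) (auto simp: msq_nonneg)
  finally show ?thesis by blast
qed

text \<open>Combines \<open>lower_bound\<close> with \<open>exists_samples\<close> for the subspace
  found there. The infimum defining a(n) need not be attained, so each algorithm is treated
  separately and the constant is passed through the infimum at the end.\<close>

lemma eavg_std_le_all: "eavg S Lstd n d \<le> ennreal (real n + 1) * eavg S Lall n d"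
proof (cases "n = 0")
  \<comment> \<open>\<open>algs\<close> has its own clause for \<open>n = 0\<close>, where both
    classes contain only the zero algorithm.\<close>
  case True
  then show ?thesis by (simp add: eavg_0)
next
  case False
  have "eavg S Lstd n d \<le> ennreal (real n + 1) * err_avg S d A" if A: "A \<in> algs S Lall n d" for A
  proof -
    obtain L \<phi> where L: "\<And>i. i < n \<Longrightarrow> Fdual S d (L i)" and \<phi>: "meas_phi S d n \<phi>"
      and A_eq: "A = (\<lambda>f. \<phi> (\<lambda>i\<in>{..<n}. L i f))"
      using A False by (auto simp: algs_def lam_def)
    define E where "E = (\<integral>\<^sup>+f. gnorm2 S d (\<lambda>x. f x - A f x) \<partial>M)"
    show ?thesis
    proof (cases "E = \<top>")
      case True
      then show ?thesis by (simp add: err_avg_def E_def[symmetric] ennreal_mult_top)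
    next
      case False
      then obtain r where r: "r \<ge> 0" "E = ennreal r" by (cases E) auto
      have errA: "err_avg S d A = ennreal (sqrt r)" unfolding err_avg_def E_def[symmetric] r(2) by (rule ensqrt_ennreal[OF r(1)])
      have "eavg S Lstd n d \<le> ennreal ((real n + 1) * sqrt r) + ennreal \<delta>" if \<delta>: "\<delta> > 0" for \<delta>
      proof -
        \<comment> \<open>Makes the excess \<open>(real n + 1) * t\<close> equal to
          \<delta>.\<close>
        define t where "t = \<delta> / (real n + 1)"
        have t: "t > 0" using \<delta> by (simp add: t_def)
        then have t2: "t\<^sup>2 > 0" by simp
        obtain m \<eta> where m: "m \<le> n" and o: "orthonormal G m \<eta>"
          and le: "ennreal (msq M G (\<lambda>f x. f x - proj G m \<eta> f x)) \<le> E + ennreal (t\<^sup>2)"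
          using lower_bound[of n L \<phi>, OF L \<phi> t2] unfolding E_def A_eq by blast
        have le': "msq M G (\<lambda>f x. f x - proj G m \<eta> f x) \<le> r + t\<^sup>2"
          using le r(1) unfolding r(2) by (simp add: ennreal_plus[symmetric] del: ennreal_plus)
        obtain xs us where xs: "\<forall>i<m. xs i \<in> space G \<and> sqint G (us i)"
          and s: "msq M G (\<lambda>f y. f y - (\<Sum>i<m. f (xs i) * us i y)) \<le> (real m + 1) * msq M G (\<lambda>f x. f x - proj G m \<eta> f x)"
          using MG.exists_samples[OF field_id o] by blast
        note s
        also have "(real m + 1) * msq M G (\<lambda>f x. f x - proj G m \<eta> f x) \<le> (real n + 1) * (r + t\<^sup>2)"
          using m le' by (intro mult_mono) (auto simp: msq_nonneg)
        \<comment> \<open>Enlarging the factor to \<open>(real n + 1)\<^sup>2\<close> and completing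
          the square makes the root explicit.\<close>
        also have "\<dots> \<le> (real n + 1)\<^sup>2 * (sqrt r + t)\<^sup>2"
        proof (rule mult_mono)
          show "real n + 1 \<le> (real n + 1)\<^sup>2" by (simp add: power2_eq_square)
          show "r + t\<^sup>2 \<le> (sqrt r + t)\<^sup>2" using r(1) t by (simp add: power2_sum)
        qed (use r(1) in auto)
        also have "\<dots> = ((real n + 1) * (sqrt r + t))\<^sup>2" by (simp add: power_mult_distrib)
        finally have sq: "sqrt (msq M G (\<lambda>f y. f y - (\<Sum>i<m. f (xs i) * us i y))) \<le> (real n + 1) * (sqrt r + t)"
          using r(1) t by (intro real_le_lsqrt) (auto simp: msq_nonneg)
        have "eavg S Lstd n d \<le> ensqrt (ennreal (msq M G (\<lambda>f y. f y - (\<Sum>i<m. f (xs i) * us i y))))"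
          by (rule eavg_std_le[OF _ m]) (use xs in \<open>auto simp: space_G\<close>)
        also have "\<dots> \<le> ennreal ((real n + 1) * (sqrt r + t))"
          unfolding ensqrt_ennreal[OF msq_nonneg] by (rule ennreal_leI[OF sq])
        also have "(real n + 1) * (sqrt r + t) = (real n + 1) * sqrt r + \<delta>"
          by (simp add: t_def distrib_left)
        finally show ?thesis using r(1) \<delta> by (simp add: ennreal_plus)
      qed
      note eps = this
      have "eavg S Lstd n d \<le> ennreal ((real n + 1) * sqrt r)" by (rule ennreal_le_epsilon, rule eps)
      then show ?thesis unfolding errA using r(1) by (simp add: ennreal_mult)
    qed
  qed
  note le = this
  define c where "c = ennreal (real n + 1)"
  have c: "c \<noteq> 0" "c \<noteq> \<top>" by (auto simp: c_def ennreal_eq_0_iff)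
  have "eavg S Lstd n d / c \<le> eavg S Lall n d"
    unfolding eavg_def[of S Lall]
  proof (rule INF_greatest)
    fix A assume "A \<in> algs S Lall n d"
    from divide_right_mono_ennreal[OF le[OF this], of c]
    show "eavg S Lstd n d / c \<le> err_avg S d A"
      unfolding c_def[symmetric] by (simp add: mult.commute[of c] mult_divide_eq_ennreal[OF c])
  qed
  then have "c * (eavg S Lstd n d / c) \<le> c * eavg S Lall n d" by (rule mult_left_mono) simp
  moreover have "c * (eavg S Lstd n d / c) = eavg S Lstd n d"
    unfolding ennreal_times_divide by (subst mult.commute) (rule mult_divide_eq_ennreal[OF c])
  ultimately show ?thesis unfolding c_def[symmetric] by simp
qed

end

subsection \<open>Tractability\<close>

text \<open>Uses ln y <= y - 1 at \<open>y = x / (2 * p + 1)\<close>; the 1 keeps the divisor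
  positive for \<open>p = 0\<close>. With \<open>x = 1 + ln (1 / s\<^sup>2)\<close> the exponential
  is \<open>1 / s\<close>, so any power of the logarithm is absorbed by the square root of the
  accuracy.\<close>

lemma powr_le_exp_half:
  fixes p :: real
  assumes p: "p \<ge> 0"
  shows "\<exists>D\<ge>1. \<forall>x\<ge>1. x powr p \<le> D * exp ((x - 1) / 2)"
proof (intro exI[of _ "exp (p * ln (2 * p + 1) + 1 / 2)"] conjI allI impI)
  show "1 \<le> exp (p * ln (2 * p + 1) + 1 / 2)" using p by simp
  fix x :: real assume x: "x \<ge> 1"
  have "ln (x / (2 * p + 1)) \<le> x / (2 * p + 1) - 1" using x p by (intro ln_le_minus_one) auto
  then have "ln x \<le> ln (2 * p + 1) + x / (2 * p + 1)" using x p by (simp add: ln_div)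
  then have "p * ln x \<le> p * (ln (2 * p + 1) + x / (2 * p + 1))" using p by (rule mult_left_mono)
  also have "\<dots> \<le> p * ln (2 * p + 1) + x / 2"
    using x p by (simp add: distrib_left field_simps)
  finally have "exp (p * ln x) \<le> exp (p * ln (2 * p + 1) + x / 2)" by simp
  then show "x powr p \<le> exp (p * ln (2 * p + 1) + 1 / 2) * exp ((x - 1) / 2)"
    using x by (simp add: powr_def exp_add[symmetric] field_simps)
qed

context app_dim
begin

text \<open>Guarantees that \<^const>\<open>nstar\<close> never is the \<open>LEAST\<close> element of an empty set.\<close>

lemma std_reaches:
  assumes e: "\<epsilon> > 0" shows "\<exists>n. eavg S Lstd n d \<le> ennreal \<epsilon> * CRI S crit d"
proof (cases crit)
  case ABS
  then show ?thesis using eavg_std_tends_0[OF e] by (simp add: CRI_def)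
next
  case NOR
  define c where "c = CRI S crit d"
  \<comment> \<open>If CRI is 0, so is the initial error and n = 0 suffices; if it is infinite,
    every n does.\<close>
  consider "c = 0" | "c = \<top>" | r where "r > 0" "c = ennreal r"
    by (cases c) (auto simp: ennreal_eq_0_iff, metis ennreal_0 less_eq_real_def)
  then show ?thesis
  proof cases
    case 1
    have "Gamma S d = 0"
      using 1 unfolding c_def CRI_def NOR ensqrt_def
      by (cases "Gamma S d") (auto split: if_splits simp: ennreal_eq_0_iff)
    then have "eavg S Lstd 0 d = 0" by (simp add: Gamma_def eavg_0)
    then show ?thesis by (intro exI[of _ 0]) simp
  next
    case 2
    then show ?thesis using e by (simp add: c_def[symmetric] ennreal_mult_top)
  next
    case 3
    then show ?thesis using eavg_std_tends_0[of "\<epsilon> * r"] e by (simp add: c_def[symmetric] ennreal_mult)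
  qed
qed

lemma nstar_attained:
  assumes "\<epsilon> > 0" shows "eavg S c (nstar S crit c \<epsilon> d) d \<le> ennreal \<epsilon> * CRI S crit d"
proof -
  obtain n where n: "eavg S Lstd n d \<le> ennreal \<epsilon> * CRI S crit d" using std_reaches[OF assms] by blast
  then have "eavg S c n d \<le> ennreal \<epsilon> * CRI S crit d"
    using eavg_all_le_std[of n] by (cases c) (auto intro: order_trans)
  then show ?thesis unfolding nstar_def by (rule LeastI)
qed

lemma nstar_all_le_std: "\<epsilon> > 0 \<Longrightarrow> nstar S crit Lall \<epsilon> d \<le> nstar S crit Lstd \<epsilon> d"
  unfolding nstar_def[of S crit Lall]
  by (rule Least_le) (rule order_trans[OF eavg_all_le_std nstar_attained])

text \<open>Both errors are measured against the same CRI, so the factor n + 1 can be traded against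
  the accuracy under either criterion.\<close>

lemma nstar_std_le:
  assumes e: "\<epsilon>' > 0" and le: "(real (nstar S crit Lall \<epsilon>' d) + 1) * \<epsilon>' \<le> \<epsilon>"
  shows "nstar S crit Lstd \<epsilon> d \<le> nstar S crit Lall \<epsilon>' d"
  unfolding nstar_def[of S crit Lstd]
proof (rule Least_le)
  let ?n = "nstar S crit Lall \<epsilon>' d"
  have "eavg S Lstd ?n d \<le> ennreal (real ?n + 1) * eavg S Lall ?n d" by (rule eavg_std_le_all)
  also have "\<dots> \<le> ennreal (real ?n + 1) * (ennreal \<epsilon>' * CRI S crit d)"
    by (intro mult_left_mono nstar_attained e) simp
  also have "\<dots> = ennreal ((real ?n + 1) * \<epsilon>') * CRI S crit d"
    using e by (simp add: ennreal_mult mult.assoc)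
  also have "\<dots> \<le> ennreal \<epsilon> * CRI S crit d"
    by (intro mult_right_mono ennreal_leI le) simp
  finally show "eavg S Lstd ?n d \<le> ennreal \<epsilon> * CRI S crit d" .
qed

text \<open>Running the bound for \<open>Lall\<close> at accuracy \<open>(\<epsilon> / (2 B D))\<^sup>2\<close> pays for the factor \<open>n + 1\<close> lost
  by sampling, and costs only a constant factor in \<open>1 + ln (1 / \<epsilon>)\<close>.\<close>

lemma nstar_std_bound:
  assumes p: "p \<ge> 0" and D: "D \<ge> 1" "\<And>x. x \<ge> 1 \<Longrightarrow> x powr p \<le> D * exp ((x - 1) / 2)" and B: "B \<ge> 1"
    and all: "\<And>\<epsilon>. 0 < \<epsilon> \<Longrightarrow> \<epsilon> < 1 \<Longrightarrow> real (nstar S crit Lall \<epsilon> d) \<le> B * (1 + ln (1 / \<epsilon>)) powr p"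
    and e: "0 < \<epsilon>" "\<epsilon> < 1"
  shows "real (nstar S crit Lstd \<epsilon> d) \<le> B * (3 + 2 * ln (2 * B * D)) powr p * (1 + ln (1 / \<epsilon>)) powr p"
proof -
  \<comment> \<open>At accuracy \<open>s\<^sup>2\<close>, with s as below, n + 1 will be at most
    \<open>2 * B * D / s\<close>, and the product of the two is
    \<open>2 * B * D * s = \<epsilon>\<close>.\<close>
  have BD: "B * D \<ge> 1" using mult_mono[of 1 B 1 D] B D by simp
  define s where "s = \<epsilon> / (2 * B * D)"
  have s: "0 < s" "s < 1" using e BD by (auto simp: s_def field_simps)
  have e': "0 < s\<^sup>2" "s\<^sup>2 < 1" using s by (auto simp: power_less_one_iff)
  define x where "x = 1 + ln (1 / s\<^sup>2)"
  have lns: "ln (1 / s\<^sup>2) = 2 * ln (1 / s)" using s by (simp add: ln_div ln_realpow)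
  have x1: "x \<ge> 1" unfolding x_def lns using s by (simp add: ln_div)
  let ?n = "nstar S crit Lall (s\<^sup>2) d"
  have n: "real ?n \<le> B * x powr p" unfolding x_def by (rule all[OF e'])
  also have "\<dots> \<le> B * (D * exp ((x - 1) / 2))" using B by (intro mult_left_mono D x1) auto
  also have "exp ((x - 1) / 2) = 1 / s" unfolding x_def lns using s by simp
  finally have "real ?n + 1 \<le> B * D * (1 / s) + 1" by simp
  also have "\<dots> \<le> B * D * (1 / s) + B * D * (1 / s)"
    using BD s mult_mono[of 1 "B * D" 1 "1 / s"] by (intro add_left_mono) auto
  also have "\<dots> = 2 * B * D * (1 / s)" by simp
  finally have "(real ?n + 1) * s\<^sup>2 \<le> (2 * B * D * (1 / s)) * s\<^sup>2" by (rule mult_right_mono) simp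
  also have "\<dots> = \<epsilon>" using B D(1) by (simp add: s_def power2_eq_square)
  finally have "nstar S crit Lstd \<epsilon> d \<le> ?n" by (rule nstar_std_le[OF e'(1)])
  then have "real (nstar S crit Lstd \<epsilon> d) \<le> B * x powr p" using n by linarith
  \<comment> \<open>Here x is \<open>1 + 2 * ln (2 * B * D) + 2 * ln (1 / \<epsilon>)\<close>, and
    the further terms of the expanded product are nonnegative.\<close>
  also have "\<dots> \<le> B * ((3 + 2 * ln (2 * B * D)) * (1 + ln (1 / \<epsilon>))) powr p"
  proof (intro mult_left_mono powr_mono2 p)
    have l: "ln (1 / \<epsilon>) \<ge> 0" "ln (2 * B * D) \<ge> 0" using e BD by (auto simp: ln_div)
    have "1 / s = (2 * B * D) * (1 / \<epsilon>)" by (simp add: s_def)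
    moreover have "ln ((2 * B * D) * (1 / \<epsilon>)) = ln (2 * B * D) + ln (1 / \<epsilon>)"
      using e B D(1) by (intro ln_mult_pos) auto
    ultimately have "ln (1 / s) = ln (2 * B * D) + ln (1 / \<epsilon>)" by simp
    then have "x = 1 + 2 * ln (2 * B * D) + 2 * ln (1 / \<epsilon>)" by (simp add: x_def lns)
    then show "x \<le> (3 + 2 * ln (2 * B * D)) * (1 + ln (1 / \<epsilon>))"
      using l mult_nonneg_nonneg[OF l(2) l(1)] by (simp add: distrib_left distrib_right mult_ac)
  qed (use x1 B in auto)
  also have "\<dots> = B * (3 + 2 * ln (2 * B * D)) powr p * (1 + ln (1 / \<epsilon>)) powr p"
    using BD e by (subst powr_mult) (auto simp: ln_div mult.assoc)
  finally show ?thesis .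
qed

end

section \<open>Transfer of the tractability notions between the two classes\<close>

lemma app_dimI: "app_setting S \<Longrightarrow> 1 \<le> d \<Longrightarrow> app_dim S d"
  by (simp add: app_dim_def)

lemma spt_bound_std_imp_all:
  assumes "app_setting S" "spt_bound S crit Lstd p" shows "spt_bound S crit Lall p"
  using assms(2) app_dim.nstar_all_le_std[OF app_dimI[OF assms(1)]]
  unfolding spt_bound_def by (meson of_nat_le_iff order_trans)

text \<open>The power p survives unchanged and only the constant grows; this is what makes the
  exponents equal.\<close>

lemma spt_bound_all_imp_std:
  assumes S: "app_setting S" and p: "p \<ge> 0" and "spt_bound S crit Lall p"
  shows "spt_bound S crit Lstd p"
proof -
  obtain C where C: "C > 0" and all: "\<And>d \<epsilon>. 1 \<le> d \<Longrightarrow> 0 < \<epsilon> \<Longrightarrow> \<epsilon> < 1 \<Longrightarrow>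
      real (nstar S crit Lall \<epsilon> d) \<le> C * (1 + ln (1 / \<epsilon>)) powr p"
    using assms(3) unfolding spt_bound_def by blast
  obtain D where D: "D \<ge> 1" "\<And>x. x \<ge> 1 \<Longrightarrow> x powr p \<le> D * exp ((x - 1) / 2)"
    using powr_le_exp_half[OF p] by blast
  define B where "B = max C 1"
  have B: "B \<ge> 1" by (simp add: B_def)
  have all': "real (nstar S crit Lall \<epsilon> d) \<le> B * (1 + ln (1 / \<epsilon>)) powr p" if "1 \<le> d" "0 < \<epsilon>" "\<epsilon> < 1" for d \<epsilon>
    by (rule order_trans[OF all[OF that] mult_right_mono]) (auto simp: B_def)
  have BD: "2 * B * D \<ge> 1" using mult_mono[of 1 B 1 D] B D by simp
  show ?thesis
    unfolding spt_bound_def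
  proof (intro exI[of _ "B * (3 + 2 * ln (2 * B * D)) powr p"] conjI allI impI)
    have "3 + 2 * ln (2 * B * D) > 0" using BD by (simp add: add_pos_nonneg)
    then show "0 < B * (3 + 2 * ln (2 * B * D)) powr p" using B by simp
    fix d \<epsilon> assume d: "(1::nat) \<le> d" and e: "0 < \<epsilon> \<and> \<epsilon> < (1::real)"
    show "real (nstar S crit Lstd \<epsilon> d) \<le> B * (3 + 2 * ln (2 * B * D)) powr p * (1 + ln (1 / \<epsilon>)) powr p"
      by (rule app_dim.nstar_std_bound[OF app_dimI[OF S d] p D B all'[OF d]]) (use e in auto)
  qed
qed

lemma exp_pt_std_imp_all:
  assumes "app_setting S" "exp_pt S crit Lstd" shows "exp_pt S crit Lall"
  using assms(2) app_dim.nstar_all_le_std[OF app_dimI[OF assms(1)]]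
  unfolding exp_pt_def by (meson of_nat_le_iff order_trans)

text \<open>With \<open>B = (C + 1) * real d powr q\<close> the factor containing
  \<open>ln (2 * B * D)\<close> grows with d, but only logarithmically. Bounded by a multiple of d
  and raised to the power p, it contributes at most p to the exponent of d, whence
  \<open>q + p\<close>.\<close>

lemma exp_pt_all_imp_std:
  assumes S: "app_setting S" and "exp_pt S crit Lall"
  shows "exp_pt S crit Lstd"
proof -
  obtain C p q where C: "C > 0" and p: "p \<ge> 0" and q: "q \<ge> 0"
    and all: "\<And>d \<epsilon>. 1 \<le> d \<Longrightarrow> 0 < \<epsilon> \<Longrightarrow> \<epsilon> < 1 \<Longrightarrow>
      real (nstar S crit Lall \<epsilon> d) \<le> C * real d powr q * (1 + ln (1 / \<epsilon>)) powr p"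
    using assms(2) unfolding exp_pt_def by blast
  obtain D where D: "D \<ge> 1" "\<And>x. x \<ge> 1 \<Longrightarrow> x powr p \<le> D * exp ((x - 1) / 2)"
    using powr_le_exp_half[OF p] by blast
  define c where "c = ln (2 * (C + 1) * D)"
  have "(C + 1) * D \<ge> 1" using mult_mono[of 1 "C + 1" 1 D] C D(1) by simp
  then have CD: "2 * (C + 1) * D \<ge> 1" unfolding mult.assoc by linarith
  have c: "c \<ge> 0" unfolding c_def using CD by simp
  define K where "K = 3 + 2 * c + 2 * q"
  have K: "K > 0" using c q by (simp add: K_def)
  have bound: "real (nstar S crit Lstd \<epsilon> d) \<le> (C + 1) * K powr p * real d powr (q + p) * (1 + ln (1 / \<epsilon>)) powr p"
    if d: "1 \<le> d" and e: "0 < \<epsilon> \<and> \<epsilon> < 1" for d \<epsilon>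
  proof -
    define B where "B = (C + 1) * real d powr q"
    have dq: "real d powr q \<ge> 1" using d q by (simp add: ge_one_powr_ge_zero)
    have B: "B \<ge> 1" unfolding B_def using mult_mono[of 1 "C + 1" 1 "real d powr q"] C dq by simp
    have all': "real (nstar S crit Lall \<epsilon> d) \<le> B * (1 + ln (1 / \<epsilon>)) powr p" if "0 < \<epsilon>" "\<epsilon> < 1" for \<epsilon>
      by (rule order_trans[OF all[OF d that]]) (auto simp: B_def intro!: mult_right_mono)
    have "real (nstar S crit Lstd \<epsilon> d) \<le> B * (3 + 2 * ln (2 * B * D)) powr p * (1 + ln (1 / \<epsilon>)) powr p"
      by (rule app_dim.nstar_std_bound[OF app_dimI[OF S d] p D B all']) (use e in auto)
    also have "\<dots> \<le> B * (K * real d) powr p * (1 + ln (1 / \<epsilon>)) powr p"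
    proof (intro mult_right_mono mult_left_mono powr_mono2 p)
      have "2 * B * D = (2 * (C + 1) * D) * real d powr q" by (simp add: B_def)
      then have "ln (2 * B * D) = c + q * ln (real d)"
        unfolding c_def using C D d by (simp only:) (subst ln_mult_pos, auto simp: ln_powr)
      also have "\<dots> \<le> c * real d + q * real d"
        using c q d ln_le_minus_one[of "real d"] mult_left_mono[of 1 "real d" c]
        by (intro add_mono mult_left_mono) auto
      finally have "3 + 2 * ln (2 * B * D) \<le> 3 * real d + 2 * (c * real d + q * real d)" using d by simp
      then show "3 + 2 * ln (2 * B * D) \<le> K * real d" by (simp add: K_def algebra_simps)
      have "2 * B * D \<ge> 1" using mult_mono[of 1 B 1 D] B D by simp
      then show "0 \<le> 3 + 2 * ln (2 * B * D)" by simp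
    qed (use B in auto)
    also have "\<dots> = (C + 1) * K powr p * real d powr (q + p) * (1 + ln (1 / \<epsilon>)) powr p"
      using K d by (simp add: B_def powr_mult powr_add)
    finally show ?thesis .
  qed
  have "(C + 1) * K powr p > 0" "q + p \<ge> 0" using C K p q by auto
  with p bound show ?thesis unfolding exp_pt_def by blast
qed

theorem theorem5p2:
  fixes S :: setting
  assumes "app_setting S"
  shows "(exp_pt S ABS Lall \<longleftrightarrow> exp_pt S ABS Lstd) \<and>
         (exp_spt S ABS Lall \<longleftrightarrow> exp_spt S ABS Lstd) \<and>
         (\<forall>crit. exp_spt S crit Lall \<longrightarrow>
             exp_spt S crit Lstd \<and> exp_p S crit Lall = exp_p S crit Lstd)"
proof -
  \<comment> \<open>The sets of admissible p coincide, hence so do their infima.\<close>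
  have "0 \<le> p \<and> spt_bound S crit Lall p \<longleftrightarrow> 0 \<le> p \<and> spt_bound S crit Lstd p" for crit p
    using spt_bound_all_imp_std[OF assms] spt_bound_std_imp_all[OF assms] by blast
  then show ?thesis
    using exp_pt_all_imp_std[OF assms] exp_pt_std_imp_all[OF assms]
    by (auto simp: exp_spt_def exp_p_def)
qed

end
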